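(* Let $T=[v_0,v_1,v_2,v_3]\subset\mathbb R^3$ be a tetrahedron and for each edge $e_{\ell m}=[v_\ell,v_m]$, $0\le\ell<m\le3$, let $\gamma_{\ell m}^0,\gamma_{\ell m}^1\in e_{\ell m}^\perp$ be linearly independent. Then the degrees of freedom consisting of - the vertex data $z(v_i)$, $\nabla z(v_i)$ for $i=0,\dots,3$, - the edge-gradient data $4\,\nabla z(\mathrm{mid}(e_{\ell m}))\cdot\gamma_{\ell m}^j$ for $j=0,1$ and $0\le\ell<m\le3$, - the facet functionals, for $i=0,\dots,3$, $$\mathcal C_i(z)=6z(\mathrm{mid}(f_i))-2\sum_{j\in J_i}z(v_j)+\sum_{j\in J_i}\nabla z(v_j)\cdot(v_j-\mathrm{mid}(f_i)),$$ are unisolvent for $Z_3^{\mathrm{cub}}(T)$ (the linear map $Z_3^{\mathrm{cub}}(T)\to\mathbb R^{32}$ they define is bijective). Moreover, $$Z_3^{\mathrm{sing}}(T)\cap\mathcal B_{\mathrm{cub}}(T)=Z_3^{\mathrm{sing}}(T)\cap\mathcal B_{\mathrm{cub}}^{\mathrm{cor}}(T)=\{0\}\quad\text{and}\quad\dim Z_3^{\mathrm{cub}}(T)=32.$$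
   Context: $T=[v_0,v_1,v_2,v_3]\subset\mathbb R^3$ is a (nondegenerate) tetrahedron with barycentric coordinates $\lambda_0,\dots,\lambda_3$. Set $I=\{0,1,2,3\}$, $J_i=I\setminus\{i\}$. Let $f_i=\{\lambda_i=0\}$ be the face opposite to $v_i$, $\nu_i$ its outer unit normal, $\mathrm{mid}(f_i)$ its barycenter, and $d_{ji}=\nabla\lambda_j\cdot\nu_i$. For an edge $e$, $\mathrm{mid}(e)$ is its midpoint and $e^\perp=\{\nu\in\mathbb R^3:\nu\perp e\}$. $\mathcal P_k$ denotes polynomials of total degree at most $k$. Polynomial Zienkiewicz space: $Z_3^0(T)=\mathcal P_2(T)\oplus\mathrm{span}\{\lambda_i^2\lambda_j-\lambda_j^2\lambda_i:0\le i<j\le3\}$. Singular edge bubbles: for $0\le\ell<m\le3$ and $n\in I\setminus\{\ell,m\}$, $$E_{\ell m}^n=\frac{\lambda_n\lambda_\ell^2\lambda_m^2}{(\lambda_n+\lambda_\ell)(\lambda_n+\lambda_m)}.$$ Edge-enriched space: $Z_3^e(T)=Z_3^0(T)+\mathrm{span}\{E_{\ell m}^n:0\le\ell<m\le3,\ n\in I\setminus\{\ell,m\}\}$. On the face $f_i$ put $\mu_j=\lambda_j|_{f_i}$ for $j\in J_i$. For an edge $e_{\ell m}\subset f_i$ ($\ell<m$) with $\{n\}=I\setminus\{i,\ell,m\}$ set $$\Phi_{\ell m,\ell}^{n,i}=\frac{\mu_n\mu_\ell\mu_m^2(2\mu_n+\mu_\ell)}{(\mu_n+\mu_\ell)^2(\mu_n+\mu_m)},\quad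 \Phi_{\ell m,m}^{n,i}=\frac{\mu_n\mu_\ell^2\mu_m(2\mu_n+\mu_m)}{(\mu_n+\mu_\ell)(\mu_n+\mu_m)^2},$$ $$\Phi_{\ell m,n}^{n,i}=\frac{\mu_\ell^2\mu_m^2(\mu_\ell\mu_m-\mu_n^2)}{(\mu_n+\mu_\ell)^2(\mu_n+\mu_m)^2}-\mu_\ell\mu_m,$$ and let $Q_{\mathrm{edge}}(f_i)$ be the span of these functions over all edges $e_{\ell m}\subset f_i$. For $q\in Q_{\mathrm{edge}}(f_i)$ the canonical barycentric extension $\widetilde q$ to $T$ is obtained by replacing $\mu_j$ by $\lambda_j$ for all $j\in J_i$ in these formulas (extended linearly). The normal lift is $$L_iq=\frac{\lambda_i}{d_{ii}}\Theta_i\,\widetilde q,\qquad \Theta_i=\prod_{j\in J_i}\frac{\lambda_j}{\lambda_i+\lambda_j}.$$ Every $z\in Z_3^e(T)$ has on each face a unique decomposition $\partial_{\nu_i}z|_{f_i}=p_i(z)+q_i(z)$ with $p_i(z)\in\mathcal P_2(f_i)$, $q_i(z)\in Q_{\mathrm{edge}}(f_i)$. Set $\mathcal R_Tz=z-\sum_{i=0}^3L_iq_i(z)$ and $Z_3^{\mathrm{sing}}(T)=\mathcal R_TZ_3^e(T)$. Cubic face bubbles: $B_i=\prod_{j\in J_i}\lambda_j$, $\mathcal B_{\mathrm{cub}}(T)=\mathrm{span}\{B_0,\dots,B_3\}$. Corrected bubbles: $$W_i=B_i-\sum_{e_{\ell m}\subset f_i,\ \{i,\ell,m,n\}=I}\mathcal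 R_TE_{\ell m}^n,\qquad \mathcal B_{\mathrm{cub}}^{\mathrm{cor}}(T)=\mathrm{span}\{W_0,\dots,W_3\}$$ (the sum runs over the three edges of $f_i$, with $n$ the vertex index of $f_i$ not on the edge). The cubic singular Zienkiewicz space is $$Z_3^{\mathrm{cub}}(T)=Z_3^{\mathrm{sing}}(T)+\mathcal B_{\mathrm{cub}}(T)=Z_3^{\mathrm{sing}}(T)+\mathcal B_{\mathrm{cub}}^{\mathrm{cor}}(T).$$ Values and gradients at points of $\partial T$ are understood by continuous extension. *)

theory Defs
  imports "HOL-Analysis.Analysis" "HOL-Library.Function_Algebras"
begin

text \<open>Real-valued functions on a set form a real vector space under the pointwise operations.\<close>

instantiation "fun" :: (type, real_vector) real_vector
begin

definition scaleR_fun :: "real \<Rightarrow> ('a \<Rightarrow> 'b) \<Rightarrow> 'a \<Rightarrow> 'b" where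
  "scaleR_fun c f = (\<lambda>x. c *\<^sub>R f x)"

instance
  by standard (simp_all add: scaleR_fun_def fun_eq_iff scaleR_add_right scaleR_add_left)

end

text \<open>
  Conventions on function spaces. The rational functions below are regular in the interior of the
  tetrahedron T, but some denominators vanish on its edges. A function on T is therefore represented
  by its values on the interior of T, extended by 0 to the whole space (so that equality of
  representatives is equality of functions on T), and its values and gradients at points of the
  boundary are limits from the interior. In the same way, a function on a face is represented by
  its values on the relative interior of the face, extended by 0. The value of a quotient with
  vanishing denominator is thus never used.
\<close>

definition restrict_to :: "'a set \<Rightarrow> ('a \<Rightarrow> real) \<Rightarrow> 'a \<Rightarrow> real" where
  "restrict_to S f = (\<lambda>x. if x \<in> S then f x else 0)"

definition grad :: "('a::real_inner \<Rightarrow> real) \<Rightarrow> 'a \<Rightarrow> 'a" where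
  "grad f x = (THE D. GDERIV f x :> D)"

definition polys :: "nat \<Rightarrow> (real ^ 3 \<Rightarrow> real) set" where
  "polys k = span {\<lambda>x. x $ 1 ^ a * x $ 2 ^ b * x $ 3 ^ c | a b c. a + b + c \<le> k}"


subsection \<open>The tetrahedron\<close>

definition II :: "nat set" where
  "II = {0, 1, 2, 3}"

definition JJ :: "nat \<Rightarrow> nat set" where
  "JJ i = II - {i}"

definition nondegenerate :: "(nat \<Rightarrow> real ^ 3) \<Rightarrow> bool" where
  "nondegenerate v \<longleftrightarrow> inj_on v II \<and> \<not> affine_dependent (v ` II)"

definition tet :: "(nat \<Rightarrow> real ^ 3) \<Rightarrow> (real ^ 3) set" where
  "tet v = convex hull (v ` II)"

abbreviation tet_int :: "(nat \<Rightarrow> real ^ 3) \<Rightarrow> (real ^ 3) set" where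
  "tet_int v \<equiv> interior (tet v)"

definition bary :: "(nat \<Rightarrow> real ^ 3) \<Rightarrow> nat \<Rightarrow> real ^ 3 \<Rightarrow> real" where
  "bary v j x = (THE u. (\<forall>i. i \<notin> II \<longrightarrow> u i = 0) \<and> (\<Sum>i\<in>II. u i) = 1 \<and> (\<Sum>i\<in>II. u i *\<^sub>R v i) = x) j"

definition face :: "(nat \<Rightarrow> real ^ 3) \<Rightarrow> nat \<Rightarrow> (real ^ 3) set" where
  "face v i = {x \<in> tet v. bary v i x = 0}"

abbreviation face_int :: "(nat \<Rightarrow> real ^ 3) \<Rightarrow> nat \<Rightarrow> (real ^ 3) set" where
  "face_int v i \<equiv> rel_interior (face v i)"

definition mid_face :: "(nat \<Rightarrow> real ^ 3) \<Rightarrow> nat \<Rightarrow> real ^ 3" where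
  "mid_face v i = (1 / 3) *\<^sub>R (\<Sum>j\<in>JJ i. v j)"

definition outer_normal :: "(nat \<Rightarrow> real ^ 3) \<Rightarrow> nat \<Rightarrow> real ^ 3" where
  "outer_normal v i = (THE \<nu>. norm \<nu> = 1 \<and>
     (\<forall>x\<in>face v i. \<forall>y\<in>face v i. \<nu> \<bullet> (x - y) = 0) \<and> (\<forall>x\<in>face v i. \<nu> \<bullet> (v i - x) < 0))"

text \<open>The gradient of a barycentric coordinate is constant, so it may be taken at 0.\<close>

definition dcoef :: "(nat \<Rightarrow> real ^ 3) \<Rightarrow> nat \<Rightarrow> nat \<Rightarrow> real" where
  "dcoef v j i = grad (bary v j) 0 \<bullet> outer_normal v i"

definition edge_perp :: "(nat \<Rightarrow> real ^ 3) \<Rightarrow> nat \<Rightarrow> nat \<Rightarrow> (real ^ 3) set" where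
  "edge_perp v l m = {w. orthogonal w (v m - v l)}"

definition bd_value :: "(nat \<Rightarrow> real ^ 3) \<Rightarrow> (real ^ 3 \<Rightarrow> real) \<Rightarrow> real ^ 3 \<Rightarrow> real" where
  "bd_value v z p = Lim (at p within tet_int v) z"

definition bd_grad :: "(nat \<Rightarrow> real ^ 3) \<Rightarrow> (real ^ 3 \<Rightarrow> real) \<Rightarrow> real ^ 3 \<Rightarrow> real ^ 3" where
  "bd_grad v z p = Lim (at p within tet_int v) (grad z)"

definition normal_trace :: "(nat \<Rightarrow> real ^ 3) \<Rightarrow> nat \<Rightarrow> (real ^ 3 \<Rightarrow> real) \<Rightarrow> real ^ 3 \<Rightarrow> real" where
  "normal_trace v i z = restrict_to (face_int v i) (\<lambda>x. bd_grad v z x \<bullet> outer_normal v i)"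


subsection \<open>Edge-enriched Zienkiewicz space\<close>

definition Z0 :: "(nat \<Rightarrow> real ^ 3) \<Rightarrow> (real ^ 3 \<Rightarrow> real) set" where
  "Z0 v = restrict_to (tet_int v) ` polys 2 +
     span {restrict_to (tet_int v) (\<lambda>x. (bary v i x)\<^sup>2 * bary v j x - (bary v j x)\<^sup>2 * bary v i x)
           | i j. i < j \<and> j \<le> 3}"

definition edge_bubble :: "(nat \<Rightarrow> real ^ 3) \<Rightarrow> nat \<Rightarrow> nat \<Rightarrow> nat \<Rightarrow> real ^ 3 \<Rightarrow> real" where
  "edge_bubble v l m n = restrict_to (tet_int v) (\<lambda>x.
     bary v n x * (bary v l x)\<^sup>2 * (bary v m x)\<^sup>2
       / ((bary v n x + bary v l x) * (bary v n x + bary v m x)))"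

definition Ze :: "(nat \<Rightarrow> real ^ 3) \<Rightarrow> (real ^ 3 \<Rightarrow> real) set" where
  "Ze v = Z0 v + span {edge_bubble v l m n | l m n. l < m \<and> m \<le> 3 \<and> n \<in> II - {l, m}}"


subsection \<open>Removal of the singular normal derivatives\<close>

text \<open>
  Triples (l, m, n): an edge of the face opposite to vertex i, with ends l < m, and the remaining
  vertex n of that face. As II has four elements, i, l, m, n are distinct.
\<close>

definition face_edges :: "nat \<Rightarrow> (nat \<times> nat \<times> nat) set" where
  "face_edges i = {(l, m, n). l < m \<and> {i, l, m, n} = II}"

text \<open>
  The formulas for the singular traces, as functions of a tuple of barycentric coordinates. They are
  shared by the functions on a face and their barycentric extensions to T.
\<close>

definition Phi :: "nat \<Rightarrow> nat \<Rightarrow> nat \<Rightarrow> nat \<Rightarrow> (nat \<Rightarrow> real) \<Rightarrow> real" where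
  "Phi l m n k \<mu> =
    (if k = l then
       \<mu> n * \<mu> l * (\<mu> m)\<^sup>2 * (2 * \<mu> n + \<mu> l) / ((\<mu> n + \<mu> l)\<^sup>2 * (\<mu> n + \<mu> m))
     else if k = m then
       \<mu> n * (\<mu> l)\<^sup>2 * \<mu> m * (2 * \<mu> n + \<mu> m) / ((\<mu> n + \<mu> l) * (\<mu> n + \<mu> m)\<^sup>2)
     else
       (\<mu> l)\<^sup>2 * (\<mu> m)\<^sup>2 * (\<mu> l * \<mu> m - (\<mu> n)\<^sup>2) / ((\<mu> n + \<mu> l)\<^sup>2 * (\<mu> n + \<mu> m)\<^sup>2) - \<mu> l * \<mu> m)"

definition Phi_index :: "nat \<Rightarrow> (nat \<times> nat \<times> nat \<times> nat) set" where
  "Phi_index i = {(l, m, n, k). (l, m, n) \<in> face_edges i \<and> k \<in> {l, m, n}}"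

definition Phi_on :: "(nat \<Rightarrow> real ^ 3) \<Rightarrow> (real ^ 3) set \<Rightarrow> nat \<times> nat \<times> nat \<times> nat \<Rightarrow> real ^ 3 \<Rightarrow> real" where
  "Phi_on v S = (\<lambda>(l, m, n, k). restrict_to S (\<lambda>x. Phi l m n k (\<lambda>j. bary v j x)))"

definition Q_edge :: "(nat \<Rightarrow> real ^ 3) \<Rightarrow> nat \<Rightarrow> (real ^ 3 \<Rightarrow> real) set" where
  "Q_edge v i = span (Phi_on v (face_int v i) ` Phi_index i)"

text \<open>
  The extension does not depend on the coefficients c representing q: the formulas are homogeneous
  of degree 2, so a linear relation between them on the face persists off the face.
\<close>

definition bary_ext :: "(nat \<Rightarrow> real ^ 3) \<Rightarrow> nat \<Rightarrow> (real ^ 3 \<Rightarrow> real) \<Rightarrow> real ^ 3 \<Rightarrow> real" where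
  "bary_ext v i q = (THE g. \<exists>c.
     q = (\<Sum>\<kappa>\<in>Phi_index i. c \<kappa> *\<^sub>R Phi_on v (face_int v i) \<kappa>) \<and>
     g = (\<Sum>\<kappa>\<in>Phi_index i. c \<kappa> *\<^sub>R Phi_on v (tet_int v) \<kappa>))"

definition Theta :: "(nat \<Rightarrow> real ^ 3) \<Rightarrow> nat \<Rightarrow> real ^ 3 \<Rightarrow> real" where
  "Theta v i x = (\<Prod>j\<in>JJ i. bary v j x / (bary v i x + bary v j x))"

definition normal_lift :: "(nat \<Rightarrow> real ^ 3) \<Rightarrow> nat \<Rightarrow> (real ^ 3 \<Rightarrow> real) \<Rightarrow> real ^ 3 \<Rightarrow> real" where
  "normal_lift v i q = restrict_to (tet_int v) (\<lambda>x.
     bary v i x / dcoef v i i * Theta v i x * bary_ext v i q x)"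

definition sing_part :: "(nat \<Rightarrow> real ^ 3) \<Rightarrow> nat \<Rightarrow> (real ^ 3 \<Rightarrow> real) \<Rightarrow> real ^ 3 \<Rightarrow> real" where
  "sing_part v i z = (THE q. q \<in> Q_edge v i \<and>
     (\<exists>p \<in> restrict_to (face_int v i) ` polys 2. normal_trace v i z = p + q))"

definition R_op :: "(nat \<Rightarrow> real ^ 3) \<Rightarrow> (real ^ 3 \<Rightarrow> real) \<Rightarrow> real ^ 3 \<Rightarrow> real" where
  "R_op v z = z - (\<Sum>i\<in>II. normal_lift v i (sing_part v i z))"

definition Z_sing :: "(nat \<Rightarrow> real ^ 3) \<Rightarrow> (real ^ 3 \<Rightarrow> real) set" where
  "Z_sing v = R_op v ` Ze v"


subsection \<open>Cubic bubbles and the cubic singular Zienkiewicz space\<close>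

definition face_bubble :: "(nat \<Rightarrow> real ^ 3) \<Rightarrow> nat \<Rightarrow> real ^ 3 \<Rightarrow> real" where
  "face_bubble v i = restrict_to (tet_int v) (\<lambda>x. \<Prod>j\<in>JJ i. bary v j x)"

definition B_cub :: "(nat \<Rightarrow> real ^ 3) \<Rightarrow> (real ^ 3 \<Rightarrow> real) set" where
  "B_cub v = span (face_bubble v ` II)"

definition cor_bubble :: "(nat \<Rightarrow> real ^ 3) \<Rightarrow> nat \<Rightarrow> real ^ 3 \<Rightarrow> real" where
  "cor_bubble v i = face_bubble v i - (\<Sum>(l, m, n)\<in>face_edges i. R_op v (edge_bubble v l m n))"

definition B_cub_cor :: "(nat \<Rightarrow> real ^ 3) \<Rightarrow> (real ^ 3 \<Rightarrow> real) set" where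
  "B_cub_cor v = span (cor_bubble v ` II)"

definition Z_cub :: "(nat \<Rightarrow> real ^ 3) \<Rightarrow> (real ^ 3 \<Rightarrow> real) set" where
  "Z_cub v = Z_sing v + B_cub v"


subsection \<open>Degrees of freedom\<close>

definition facet_functional :: "(nat \<Rightarrow> real ^ 3) \<Rightarrow> nat \<Rightarrow> (real ^ 3 \<Rightarrow> real) \<Rightarrow> real" where
  "facet_functional v i z = 6 * bd_value v z (mid_face v i)
     - 2 * (\<Sum>j\<in>JJ i. bd_value v z (v j))
     + (\<Sum>j\<in>JJ i. bd_grad v z (v j) \<bullet> (v j - mid_face v i))"

text \<open>A vertex gradient contributes its three Cartesian components.\<close>

definition dofs ::
  "(nat \<Rightarrow> real ^ 3) \<Rightarrow> (nat \<Rightarrow> nat \<Rightarrow> nat \<Rightarrow> real ^ 3) \<Rightarrow> ((real ^ 3 \<Rightarrow> real) \<Rightarrow> real) list" where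
  "dofs v \<gamma> =
     [(\<lambda>z. bd_value v z (v i)). i \<leftarrow> [0, 1, 2, 3]] @
     [(\<lambda>z. bd_grad v z (v i) $ k). i \<leftarrow> [0, 1, 2, 3], k \<leftarrow> [1, 2, 3]] @
     [(\<lambda>z. 4 * (bd_grad v z (midpoint (v l) (v m)) \<bullet> \<gamma> l m j)).
        (l, m) \<leftarrow> [(0, 1), (0, 2), (0, 3), (1, 2), (1, 3), (2, 3)], j \<leftarrow> [0, 1]] @
     [facet_functional v i. i \<leftarrow> [0, 1, 2, 3]]"

definition linear_functional_on :: "'a::real_vector set \<Rightarrow> ('a \<Rightarrow> real) \<Rightarrow> bool" where
  "linear_functional_on Z N \<longleftrightarrow>
     (\<forall>y\<in>Z. \<forall>z\<in>Z. N (y + z) = N y + N z) \<and> (\<forall>c. \<forall>z\<in>Z. N (c *\<^sub>R z) = c * N z)"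

text \<open>Here \<open>\<real>\<^sup>n\<close>, with n the number of functionals, is the set of real lists of length n.\<close>

definition unisolvent :: "('a::real_vector \<Rightarrow> real) list \<Rightarrow> 'a set \<Rightarrow> bool" where
  "unisolvent Ns Z \<longleftrightarrow> subspace Z \<and> (\<forall>N\<in>set Ns. linear_functional_on Z N) \<and>
     bij_betw (\<lambda>z. map (\<lambda>N. N z) Ns) Z {c. length c = length Ns}"

end

theory Submission
  imports Defs
begin

text \<open>
  The correction \<open>R_op\<close> is invisible to the degrees of freedom. The normal lifts that it subtracts
  have value 0 on the whole boundary of T and gradient 0 on all edges, so a function of the
  edge-enriched space and its correction have the same vertex data, edge gradients and facet
  functionals. What remains is a system for the Zienkiewicz functions, the edge bubbles E and the
  corrected face bubbles W, and this system is triangular. The vertex data are Hermite data for the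
  Zienkiewicz part, and the bubbles do not contribute to them. On an edge with ends l and m, only the
  two bubbles of that edge have a nonzero gradient at the midpoint, namely a quarter of the gradients
  of the two barycentric coordinates that vanish on the edge; these two vectors span the plane
  orthogonal to the edge, so the edge data determine the two coefficients. The functions
  \<open>cor_bubble v i\<close> have value and gradient 0 on all edges, because on the edges the gradient of the cubic
  bubble of a face is exactly the sum of the gradients of its three edge bubbles. At the barycenter of
  face j the function \<open>cor_bubble v i\<close> is 1/27 - 3/108 = 1/108 if i = j, and 0 otherwise. So the facet
  functionals determine the remaining four coefficients.

  Solving this system for arbitrary data gives surjectivity, and solving it for zero data gives
  injectivity (\<open>interpolation\<close>, \<open>cub_fun_coefficients_zero\<close>). The second result says that R z plus a
  combination of the functions W can vanish only if z and all coefficients vanish; this yields both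
  intersection statements. The dimension is the number of functionals.

  Two analytic facts make this work. First, \<open>R_op\<close> must be a well defined linear map. The partial
  derivatives of an edge bubble with respect to barycentric coordinates are the functions \<open>Phi\<close>, up
  to one product of two coordinates. They extend continuously to the closed tetrahedron, so every
  normal trace is a quadratic polynomial plus an element of \<open>Q_edge\<close>. The decomposition is unique, and
  the barycentric extension is a linear map, because the nine functions \<open>Phi\<close> of a face are linearly
  independent modulo quadratic polynomials (\<open>edge_traces_independent\<close>). Second, the lifts must vanish
  to first order on the edges. A lift is a combination of products of two factors, the weight
  \<open>bary v i * Theta v i\<close> and a function \<open>Phi\<close>. Each factor has bounded gradient inside T and tends to 0 at every
  edge point, so the gradient of the product tends to 0 there (\<open>boundary_data_tame_product\<close>).
\<close>

section \<open>Independence of the singular face traces\<close>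

lemma real_polynomial_function_zero:
  fixes P :: "real \<Rightarrow> real"
  assumes "real_polynomial_function P" and "\<And>t. 0 < t \<Longrightarrow> P t = 0"
  shows "P t = 0"
proof -
  obtain a n where P: "P = (\<lambda>x. \<Sum>i\<le>n. a i * x ^ i)"
    using assms(1) real_polynomial_function_iff_sum by blast
  have "infinite {x. (\<Sum>i\<le>n. a i * x ^ i) = 0}"
    using infinite_Ioi[of "0::real"] assms(2)
    by (metis (mono_tags, lifting) P finite_subset greaterThan_iff mem_Collect_eq subsetI)
  then have "\<forall>i\<le>n. a i = 0"
    using polyfun_finite_roots[of a n] polyfun_rootbound by blast
  then show ?thesis by (simp add: P)
qed

text \<open>
  For \<open>E = n l\<^sup>2 m\<^sup>2 / ((n + l) (n + m))\<close> these are the partial derivative of E by the end l of the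
  edge, and the partial derivative of E by the apex n, minus l m. By the symmetry of E in l and m, the
  derivative by the other end is \<open>dE_end n m l\<close>.
\<close>

abbreviation (input) "dE_end n l m \<equiv> n * l * m\<^sup>2 * (2 * n + l) / ((n + l)\<^sup>2 * (n + m))"
abbreviation (input) "dE_apex n l m \<equiv> l\<^sup>2 * m\<^sup>2 * (l * m - n\<^sup>2) / ((n + l)\<^sup>2 * (n + m)\<^sup>2) - l * m"

lemma cancel_denominators:
  fixes p q r A B :: real
  assumes "p \<noteq> 0" "q \<noteq> 0"
  shows "A / (p\<^sup>2 * q) * (p * q * r)\<^sup>2 = A * q * r\<^sup>2" "A / (p\<^sup>2 * q\<^sup>2) * (p * q * r)\<^sup>2 = A * r\<^sup>2"
    "(A / (p * q) + B) * (p * q * r) = A * r + B * (p * q * r)"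
  using assms by (simp_all add: field_simps power2_eq_square)

text \<open>
  Write x, y, z for the barycentric coordinates of a face. The nine functions have poles only on the
  lines x + y = 0, x + z = 0 and y + z = 0, while a quadratic polynomial has none. The relation is known
  for positive arguments only, but after multiplication by the squares of the three linear forms it is
  a polynomial identity and holds everywhere. At x = -y only the functions with a double pole along
  x + y = 0 survive; these are the end derivative by the other coordinate and the apex derivative, for
  apex x and for apex y.
\<close>

lemma double_pole:
  fixes c1 c2 c3 c4 c5 c6 c7 c8 c9 q1 q2 q3 q4 q5 q6 :: real
  assumes H: "\<And>x y z :: real. x > 0 \<Longrightarrow> y > 0 \<Longrightarrow> z > 0 \<Longrightarrow>
    c1 * dE_end z x y + c2 * dE_end z y x + c3 * dE_apex z x y +
    c4 * dE_end y x z + c5 * dE_end y z x + c6 * dE_apex y x z +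
    c7 * dE_end x y z + c8 * dE_end x z y + c9 * dE_apex x y z =
    q1 * x\<^sup>2 + q2 * y\<^sup>2 + q3 * z\<^sup>2 + q4 * (x * y) + q5 * (x * z) + q6 * (y * z)"
  shows "c7 + c9 = 0 \<and> c4 + c6 = 0"
proof -
  define W :: "real \<Rightarrow> real \<Rightarrow> real \<Rightarrow> real"
    where "W = (\<lambda>x y z. ((x + y) * (x + z) * (y + z))\<^sup>2)"
  define P where "P = (\<lambda>y z x.
    c1 * (z * x * y\<^sup>2 * (2 * z + x) * (z + y) * (x + y)\<^sup>2) +
    c2 * (z * y * x\<^sup>2 * (2 * z + y) * (z + x) * (x + y)\<^sup>2) +
    c3 * (x\<^sup>2 * y\<^sup>2 * (x * y - z\<^sup>2) * (x + y)\<^sup>2 - x * y * W x y z) +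
    c4 * (y * x * z\<^sup>2 * (2 * y + x) * (y + z) * (x + z)\<^sup>2) +
    c5 * (y * z * x\<^sup>2 * (2 * y + z) * (y + x) * (x + z)\<^sup>2) +
    c6 * (x\<^sup>2 * z\<^sup>2 * (x * z - y\<^sup>2) * (x + z)\<^sup>2 - x * z * W x y z) +
    c7 * (x * y * z\<^sup>2 * (2 * x + y) * (x + z) * (y + z)\<^sup>2) +
    c8 * (x * z * y\<^sup>2 * (2 * x + z) * (x + y) * (y + z)\<^sup>2) +
    c9 * (y\<^sup>2 * z\<^sup>2 * (y * z - x\<^sup>2) * (y + z)\<^sup>2 - y * z * W x y z) -
    (q1 * x\<^sup>2 + q2 * y\<^sup>2 + q3 * z\<^sup>2 + q4 * (x * y) + q5 * (x * z) + q6 * (y * z)) * W x y z)"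
  have poly: "real_polynomial_function (P y z)" for y z
    unfolding P_def W_def by (intro real_polynomial_function.intros(2-4)
      real_polynomial_function_diff real_polynomial_function_power real_polynomial_function.intros(1)
      bounded_linear_ident)
  have zero: "P y z x = 0" if "0 < x" "0 < y" "0 < z" for x y z
  proof -
    have pos: "z + x \<noteq> 0" "z + y \<noteq> 0" "y + x \<noteq> 0" "y + z \<noteq> 0" "x + y \<noteq> 0" "x + z \<noteq> 0"
      using that by auto
    have W: "W x y z = ((z + x) * (z + y) * (x + y))\<^sup>2" "W x y z = ((z + y) * (z + x) * (x + y))\<^sup>2"
      "W x y z = ((y + x) * (y + z) * (x + z))\<^sup>2" "W x y z = ((y + z) * (y + x) * (x + z))\<^sup>2"
      "W x y z = ((x + y) * (x + z) * (y + z))\<^sup>2" "W x y z = ((x + z) * (x + y) * (y + z))\<^sup>2"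
      by (simp_all add: W_def ac_simps)
    have ids: "dE_end z x y * W x y z = z * x * y\<^sup>2 * (2 * z + x) * (z + y) * (x + y)\<^sup>2"
      "dE_end z y x * W x y z = z * y * x\<^sup>2 * (2 * z + y) * (z + x) * (x + y)\<^sup>2"
      "dE_end y x z * W x y z = y * x * z\<^sup>2 * (2 * y + x) * (y + z) * (x + z)\<^sup>2"
      "dE_end y z x * W x y z = y * z * x\<^sup>2 * (2 * y + z) * (y + x) * (x + z)\<^sup>2"
      "dE_end x y z * W x y z = x * y * z\<^sup>2 * (2 * x + y) * (x + z) * (y + z)\<^sup>2"
      "dE_end x z y * W x y z = x * z * y\<^sup>2 * (2 * x + z) * (x + y) * (y + z)\<^sup>2"
      "dE_apex z x y * W x y z = x\<^sup>2 * y\<^sup>2 * (x * y - z\<^sup>2) * (x + y)\<^sup>2 - x * y * W x y z"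
      "dE_apex y x z * W x y z = x\<^sup>2 * z\<^sup>2 * (x * z - y\<^sup>2) * (x + z)\<^sup>2 - x * z * W x y z"
      "dE_apex x y z * W x y z = y\<^sup>2 * z\<^sup>2 * (y * z - x\<^sup>2) * (y + z)\<^sup>2 - y * z * W x y z"
      unfolding left_diff_distrib using pos cancel_denominators by (metis W)+
    have lin: "c1 * (f1 * w) + c2 * (f2 * w) + c3 * (f3 * w) + c4 * (f4 * w) + c5 * (f5 * w) +
      c6 * (f6 * w) + c7 * (f7 * w) + c8 * (f8 * w) + c9 * (f9 * w) - q * w =
      (c1 * f1 + c2 * f2 + c3 * f3 + c4 * f4 + c5 * f5 + c6 * f6 + c7 * f7 + c8 * f8 + c9 * f9 - q) * w"
      for f1 f2 f3 f4 f5 f6 f7 f8 f9 q w :: real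
      by (simp add: algebra_simps)
    show ?thesis
      unfolding P_def ids[symmetric] lin using H[OF that] by simp
  qed
  have *: "P 1 z (- 1) = 0" if "0 < z" for z
    using real_polynomial_function_zero[OF poly] zero that by (metis zero_less_one)
  \<comment> \<open>Two values of z suffice for the two unknown sums.\<close>
  show ?thesis
    using *[of 2] *[of 3] by (simp add: P_def W_def)
qed

text \<open>
  The combinations in which both ends enter with the same coefficient and the apex with the opposite
  one have simple poles only, since the corresponding derivation annihilates n + l and n + m. So it is
  enough to multiply by the three linear forms themselves before setting x = -y.
\<close>

lemma simple_pole:
  fixes a b c q1 q2 q3 q4 q5 q6 :: real
  assumes H: "\<And>x y z :: real. x > 0 \<Longrightarrow> y > 0 \<Longrightarrow> z > 0 \<Longrightarrow>
    a * (dE_end z x y + dE_end z y x - dE_apex z x y) +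
    b * (dE_end y x z + dE_end y z x - dE_apex y x z) +
    c * (dE_end x y z + dE_end x z y - dE_apex x y z) =
    q1 * x\<^sup>2 + q2 * y\<^sup>2 + q3 * z\<^sup>2 + q4 * (x * y) + q5 * (x * z) + q6 * (y * z)"
  shows "b = 0 \<and> c = 0"
proof -
  define W :: "real \<Rightarrow> real \<Rightarrow> real \<Rightarrow> real"
    where "W = (\<lambda>x y z. (x + y) * (x + z) * (y + z))"
  define N :: "real \<Rightarrow> real \<Rightarrow> real \<Rightarrow> real"
    where "N = (\<lambda>n l m. 2 * n * l * m * (l + m) - l\<^sup>2 * m\<^sup>2)"
  define P where "P = (\<lambda>y z x.
    a * (N z x y * (x + y) + x * y * W x y z) + b * (N y x z * (x + z) + x * z * W x y z) +
    c * (N x y z * (y + z) + y * z * W x y z) -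
    (q1 * x\<^sup>2 + q2 * y\<^sup>2 + q3 * z\<^sup>2 + q4 * (x * y) + q5 * (x * z) + q6 * (y * z)) * W x y z)"
  have poly: "real_polynomial_function (P y z)" for y z
    unfolding P_def W_def N_def by (intro real_polynomial_function.intros(2-4)
      real_polynomial_function_diff real_polynomial_function_power real_polynomial_function.intros(1)
      bounded_linear_ident)
  have zero: "P y z x = 0" if "0 < x" "0 < y" "0 < z" for x y z
  proof -
    have pos: "z + x \<noteq> 0" "z + y \<noteq> 0" "y + x \<noteq> 0" "y + z \<noteq> 0" "x + y \<noteq> 0" "x + z \<noteq> 0"
      using that by auto
    have G: "dE_end n l m + dE_end n m l - dE_apex n l m = N n l m / ((n + l) * (n + m)) + l * m"
      if "n + l \<noteq> 0" "n + m \<noteq> 0" for n l m :: real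
    proof -
      define s t where "s = n + l" and "t = n + m"
      have "s \<noteq> 0" "t \<noteq> 0" using that by (auto simp: s_def t_def)
      then have "A / (s\<^sup>2 * t) + B / (t\<^sup>2 * s) - (C / (s\<^sup>2 * t\<^sup>2) - e) =
          (A * t + B * s - C) / (s * t) / (s * t) + e" for A B C e
        by (simp add: field_simps power2_eq_square)
      moreover have "n * l * m\<^sup>2 * (2 * n + l) * t + n * m * l\<^sup>2 * (2 * n + m) * s -
          l\<^sup>2 * m\<^sup>2 * (l * m - n\<^sup>2) = N n l m * (s * t)"
        unfolding N_def s_def t_def by algebra
      ultimately show ?thesis
        using \<open>s \<noteq> 0\<close> \<open>t \<noteq> 0\<close> unfolding s_def[symmetric] t_def[symmetric] by simp
    qed
    have W: "W x y z = (z + x) * (z + y) * (x + y)" "W x y z = (y + x) * (y + z) * (x + z)"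
      "W x y z = (x + y) * (x + z) * (y + z)"
      by (simp_all add: W_def ac_simps)
    have ids: "(N z x y / ((z + x) * (z + y)) + x * y) * W x y z = N z x y * (x + y) + x * y * W x y z"
      "(N y x z / ((y + x) * (y + z)) + x * z) * W x y z = N y x z * (x + z) + x * z * W x y z"
      "(N x y z / ((x + y) * (x + z)) + y * z) * W x y z = N x y z * (y + z) + y * z * W x y z"
      subgoal unfolding W(1) unfolding cancel_denominators(3)[OF pos(1,2)] ..
      subgoal unfolding W(2) unfolding cancel_denominators(3)[OF pos(3,4)] ..
      subgoal unfolding W(3) unfolding cancel_denominators(3)[OF pos(5,6)] ..
      done
    have lin: "a * (f * w) + b * (g * w) + c * (h * w) - q * w = (a * f + b * g + c * h - q) * w"
      for f g h q w :: real
      by (simp add: algebra_simps)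
    show ?thesis
      unfolding P_def ids[symmetric] lin using H[OF that] pos by (simp add: G)
  qed
  have *: "P 1 z (- 1) = 0" if "0 < z" for z
    using real_polynomial_function_zero[OF poly] zero that by (metis zero_less_one)
  \<comment> \<open>The coefficient of b vanishes at z = 1, so that z = 1 gives c = 0, and then z = 2 gives b = 0.\<close>
  show ?thesis
    using *[of 1] *[of 2] by (simp add: P_def W_def N_def)
qed

text \<open>
  The double poles along the three lines leave one free coefficient for each apex, and the simple
  poles along two of the lines remove these.
\<close>

lemma edge_traces_independent:
  fixes c1 c2 c3 c4 c5 c6 c7 c8 c9 q1 q2 q3 q4 q5 q6 :: real
  assumes H: "\<And>x y z :: real. x > 0 \<Longrightarrow> y > 0 \<Longrightarrow> z > 0 \<Longrightarrow>
    c1 * dE_end z x y + c2 * dE_end z y x + c3 * dE_apex z x y +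
    c4 * dE_end y x z + c5 * dE_end y z x + c6 * dE_apex y x z +
    c7 * dE_end x y z + c8 * dE_end x z y + c9 * dE_apex x y z =
    q1 * x\<^sup>2 + q2 * y\<^sup>2 + q3 * z\<^sup>2 + q4 * (x * y) + q5 * (x * z) + q6 * (y * z)"
  shows "c1 = 0 \<and> c2 = 0 \<and> c3 = 0 \<and> c4 = 0 \<and> c5 = 0 \<and> c6 = 0 \<and> c7 = 0 \<and> c8 = 0 \<and> c9 = 0"
proof -
  have xy: "c7 + c9 = 0 \<and> c4 + c6 = 0"
    using H by (rule double_pole)
  have xz: "c8 + c9 = 0 \<and> c1 + c3 = 0"
  proof (rule double_pole[of c4 c5 c6 c1 c2 c3 c8 c7 c9 q1 q3 q2 q5 q4 q6], goal_cases)
    case (1 x y z)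
    from H[OF this(1,3,2)] show ?case by (simp only: ac_simps)
  qed
  have yz: "c2 + c3 = 0 \<and> c5 + c6 = 0"
  proof (rule double_pole[of c8 c7 c9 c5 c4 c6 c2 c1 c3 q3 q2 q1 q6 q5 q4], goal_cases)
    case (1 x y z)
    from H[OF this(3,2,1)] show ?case by (simp only: ac_simps)
  qed
  have c: "c1 = - c3" "c2 = - c3" "c4 = - c6" "c5 = - c6" "c7 = - c9" "c8 = - c9"
    using xy xz yz by linarith+
  have H': "(- c3) * (dE_end z x y + dE_end z y x - dE_apex z x y) +
    (- c6) * (dE_end y x z + dE_end y z x - dE_apex y x z) +
    (- c9) * (dE_end x y z + dE_end x z y - dE_apex x y z) =
    q1 * x\<^sup>2 + q2 * y\<^sup>2 + q3 * z\<^sup>2 + q4 * (x * y) + q5 * (x * z) + q6 * (y * z)"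
    if "x > 0" "y > 0" "z > 0" for x y z :: real
  proof -
    have lin: "(- c3) * (f1 + f2 - f3) + (- c6) * (f4 + f5 - f6) + (- c9) * (f7 + f8 - f9) =
      c1 * f1 + c2 * f2 + c3 * f3 + c4 * f4 + c5 * f5 + c6 * f6 + c7 * f7 + c8 * f8 + c9 * f9"
      for f1 f2 f3 f4 f5 f6 f7 f8 f9 :: real
      unfolding c by (simp add: algebra_simps)
    show ?thesis
      unfolding lin using H[OF that] .
  qed
  have "- c6 = 0 \<and> - c9 = 0"
    using H' by (rule simple_pole)
  moreover have "- c3 = 0"
  proof (rule simple_pole[of "- c9" "- c6" "- c3" q3 q2 q1 q6 q5 q4, THEN conjunct2], goal_cases)
    case (1 x y z)
    from H'[OF this(3,2,1)] show ?case by (simp only: ac_simps)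
  qed
  ultimately show ?thesis
    using c by simp
qed

section \<open>Barycentric coordinates\<close>

lemma sum_II: "(\<Sum>i\<in>II. f i) = f 0 + f 1 + f 2 + f (3::nat)" for f :: "nat \<Rightarrow> 'a::comm_monoid_add"
  by (simp add: II_def add.assoc)

lemma finite_II [simp]: "finite II"
  by (simp add: II_def)

lemma grad_eqI: "GDERIV f x :> D \<Longrightarrow> grad f x = D" for f :: "'a::real_inner \<Rightarrow> real"
  unfolding grad_def
proof (rule the_equality)
  fix E assume "GDERIV f x :> D" "GDERIV f x :> E"
  then have "(\<lambda>h. h \<bullet> E) = (\<lambda>h. h \<bullet> D)"
    unfolding gderiv_def by (rule has_derivative_unique[rotated])
  then show "E = D"
    by (metis inner_commute vector_eq_ldot)
qed

locale tetrahedron =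
  fixes v :: "nat \<Rightarrow> real ^ 3"
  assumes nondegenerate: "nondegenerate v"
begin

lemma inj_v: "inj_on v II" and affine_independent: "\<not> affine_dependent (v ` II)"
  using nondegenerate by (auto simp: nondegenerate_def)

lemma affine_combination_unique:
  assumes "(\<Sum>i\<in>II. u i) = (\<Sum>i\<in>II. w i)" "(\<Sum>i\<in>II. u i *\<^sub>R v i) = (\<Sum>i\<in>II. w i *\<^sub>R v i)" "j \<in> II"
  shows "u j = w j"
proof (rule ccontr)
  assume "u j \<noteq> w j"
  define U where "U = (\<lambda>x. u (inv_into II v x) - w (inv_into II v x))"
  have U: "U (v i) = u i - w i" if "i \<in> II" for i
    using that inj_v by (simp add: U_def)
  have "sum U (v ` II) = 0" "(\<Sum>x\<in>v ` II. U x *\<^sub>R x) = 0" "U (v j) \<noteq> 0"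
    using assms \<open>u j \<noteq> w j\<close> inj_v
    by (simp_all add: sum.reindex U sum_subtractf scaleR_diff_left)
  then have "affine_dependent (v ` II)"
    using assms(3) by (subst affine_dependent_explicit_finite) auto
  then show False
    using affine_independent by blast
qed

lemma affine_combination_exists: "\<exists>u. (\<Sum>i\<in>II. u i) = 1 \<and> (\<Sum>i\<in>II. u i *\<^sub>R v i) = x"
proof -
  have "card (v ` II) = Suc (DIM(real ^ 3))"
    using inj_v by (simp add: card_image) (simp add: II_def)
  then have "x \<in> affine hull (v ` II)"
    using affine_independent_span_eq[OF affine_independent] by simp
  then obtain u where "sum u (v ` II) = 1" "(\<Sum>y\<in>v ` II. u y *\<^sub>R y) = x"
    by (auto simp: affine_hull_finite)
  then have "(\<Sum>i\<in>II. u (v i)) = 1" "(\<Sum>i\<in>II. u (v i) *\<^sub>R v i) = x"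
    using inj_v by (simp_all add: sum.reindex)
  then show ?thesis by (intro exI[of _ "\<lambda>i. u (v i)"]) simp
qed

lemma bary_eqI:
  assumes "(\<Sum>i\<in>II. u i) = 1" "(\<Sum>i\<in>II. u i *\<^sub>R v i) = x" "j \<in> II"
  shows "bary v j x = u j"
proof -
  define w where "w = (\<lambda>i. if i \<in> II then u i else 0)"
  have "(THE u. (\<forall>i. i \<notin> II \<longrightarrow> u i = 0) \<and> (\<Sum>i\<in>II. u i) = 1 \<and> (\<Sum>i\<in>II. u i *\<^sub>R v i) = x) = w"
  proof (rule the_equality)
    show w: "(\<forall>i. i \<notin> II \<longrightarrow> w i = 0) \<and> (\<Sum>i\<in>II. w i) = 1 \<and> (\<Sum>i\<in>II. w i *\<^sub>R v i) = x"
      using assms(1,2) by (simp add: w_def)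
    fix u' :: "nat \<Rightarrow> real"
    assume u': "(\<forall>i. i \<notin> II \<longrightarrow> u' i = 0) \<and> (\<Sum>i\<in>II. u' i) = 1 \<and> (\<Sum>i\<in>II. u' i *\<^sub>R v i) = x"
    show "u' = w"
    proof
      fix i show "u' i = w i"
        using affine_combination_unique[of u' w i] u' w by (cases "i \<in> II") auto
    qed
  qed
  then show ?thesis
    using assms(3) by (simp add: bary_def w_def)
qed

lemma sum_bary: "(\<Sum>i\<in>II. bary v i x) = 1" and sum_bary_vertex: "(\<Sum>i\<in>II. bary v i x *\<^sub>R v i) = x"
proof -
  obtain u where u: "(\<Sum>i\<in>II. u i) = 1" "(\<Sum>i\<in>II. u i *\<^sub>R v i) = x"
    using affine_combination_exists by blast
  then show "(\<Sum>i\<in>II. bary v i x) = 1" "(\<Sum>i\<in>II. bary v i x *\<^sub>R v i) = x"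
    using bary_eqI[OF u] by simp_all
qed

lemma bary_vertex: "j \<in> II \<Longrightarrow> i \<in> II \<Longrightarrow> bary v j (v i) = (if j = i then 1 else 0)"
  by (rule bary_eqI) (simp_all add: if_distrib[of "\<lambda>c. c *\<^sub>R _"] cong: if_cong)

text \<open>
  The gradient of a barycentric coordinate is the same at every point.
\<close>

definition bgrad :: "nat \<Rightarrow> real ^ 3" where
  "bgrad j = grad (bary v j) 0"

lemma
  assumes "j \<in> II"
  shows bary_affine: "bary v j x = bary v j 0 + bgrad j \<bullet> x"
    and GDERIV_bary: "GDERIV (bary v j) x :> bgrad j"
proof -
  define f where "f = (\<lambda>x. bary v j x - bary v j 0)"
  have "linear f"
  proof (rule linearI)
    fix x y and c :: real
    have "bary v j (x + y) = bary v j x + bary v j y - bary v j 0"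
      by (rule bary_eqI[OF _ _ assms]) (simp_all add: scaleR_add_left scaleR_diff_left scaleR_scaleR[symmetric] sum.distrib sum_subtractf
        sum_distrib_left[symmetric] scaleR_sum_right[symmetric] sum_bary sum_bary_vertex del: scaleR_scaleR)
    then show "f (x + y) = f x + f y" by (simp add: f_def)
    have "bary v j (c *\<^sub>R x) = c * bary v j x + (1 - c) * bary v j 0"
      by (rule bary_eqI[OF _ _ assms]) (simp_all add: scaleR_add_left scaleR_diff_left scaleR_scaleR[symmetric] sum.distrib sum_subtractf
        sum_distrib_left[symmetric] scaleR_sum_right[symmetric] sum_bary sum_bary_vertex del: scaleR_scaleR)
    then show "f (c *\<^sub>R x) = c *\<^sub>R f x" by (simp add: f_def algebra_simps)
  qed
  define g where "g = adjoint f 1"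
  have "f x = x \<bullet> g" for x
    using adjoint_works[OF \<open>linear f\<close>, of x 1] by (simp add: g_def)
  then obtain b where eq: "bary v j = (\<lambda>x. b + x \<bullet> g)"
    by (metis (no_types, lifting) ext add.commute diff_eq_eq f_def)
  have der: "GDERIV (bary v j) x :> g" for x
    unfolding eq using GDERIV_add[OF GDERIV_const, of "\<lambda>x. x \<bullet> g" x g b]
      bounded_linear_imp_has_derivative[OF bounded_linear_inner_left, of g]
    by (simp add: gderiv_def)
  then have "bgrad j = g"
    unfolding bgrad_def by (rule grad_eqI)
  then show "bary v j x = bary v j 0 + bgrad j \<bullet> x" "GDERIV (bary v j) x :> bgrad j"
    using der by (simp_all add: eq inner_commute)
qed

lemma bgrad_diff: "j \<in> II \<Longrightarrow> bgrad j \<bullet> (x - y) = bary v j x - bary v j y"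
  using bary_affine[of j x] bary_affine[of j y] by (simp add: inner_diff_right)

lemma continuous_bary: "j \<in> II \<Longrightarrow> continuous_on S (bary v j)"
  using GDERIV_bary unfolding gderiv_def
  by (metis continuous_at_imp_continuous_on has_derivative_continuous)

lemma tendsto_bary: "j \<in> II \<Longrightarrow> (bary v j \<longlongrightarrow> bary v j p) (at p within S)"
  using continuous_bary[of j UNIV]
  by (metis UNIV_I continuous_on_def tendsto_within_subset top_greatest)

text \<open>
  The gradients of the barycentric coordinates form the dual system of the edge vectors at any
  vertex.
\<close>

lemma bgrad_expansion:
  assumes "k \<in> II"
  shows "w = (\<Sum>j\<in>II. (w \<bullet> (v j - v k)) *\<^sub>R bgrad j)"
proof (rule vector_eq_ldot[THEN iffD1, rule_format])
  fix x
  have s: "(\<Sum>j\<in>II. bgrad j \<bullet> x) = 0"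
    using sum_bary[of x] sum_bary[of 0] by (simp add: bary_affine[of _ x] sum.distrib cong: sum.cong)
  have "x = (\<Sum>j\<in>II. bary v j x *\<^sub>R v j) - (\<Sum>j\<in>II. bary v j 0 *\<^sub>R v j)"
    by (simp add: sum_bary_vertex)
  also have "\<dots> = (\<Sum>j\<in>II. (bgrad j \<bullet> x) *\<^sub>R v j)"
    unfolding sum_subtractf[symmetric] scaleR_diff_left[symmetric]
    by (intro sum.cong) (simp_all add: bary_affine[of _ x])
  also have "\<dots> = (\<Sum>j\<in>II. (bgrad j \<bullet> x) *\<^sub>R (v j - v k))"
    using s by (simp add: scaleR_diff_right sum_subtractf scaleR_sum_left[symmetric])
  finally have "x \<bullet> w = (\<Sum>j\<in>II. (bgrad j \<bullet> x) *\<^sub>R (v j - v k)) \<bullet> w"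
    by simp
  then show "x \<bullet> w = x \<bullet> (\<Sum>j\<in>II. (w \<bullet> (v j - v k)) *\<^sub>R bgrad j)"
    by (simp add: inner_sum_left inner_sum_right inner_commute mult.commute)
qed

lemma sum_image_vertex: "K \<subseteq> II \<Longrightarrow> sum h (v ` K) = (\<Sum>i\<in>K. h (v i))" for h :: "real ^ 3 \<Rightarrow> 'b::comm_monoid_add"
  using inj_v inj_on_subset by (subst sum.reindex) auto

lemma mem_tet_iff: "x \<in> tet v \<longleftrightarrow> (\<forall>j\<in>II. 0 \<le> bary v j x)"
proof
  assume "x \<in> tet v"
  then obtain u where u: "\<forall>y\<in>v ` II. 0 \<le> u y" "sum u (v ` II) = 1" "(\<Sum>y\<in>v ` II. u y *\<^sub>R y) = x"
    by (auto simp: tet_def convex_hull_finite)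
  then show "\<forall>j\<in>II. 0 \<le> bary v j x"
    using bary_eqI[of "\<lambda>i. u (v i)" x] by (simp add: sum_image_vertex)
next
  assume R: "\<forall>j\<in>II. 0 \<le> bary v j x"
  have "(\<Sum>i\<in>II. bary v i x *\<^sub>R v i) \<in> tet v"
    unfolding tet_def using R by (intro convex_sum) (auto simp: sum_bary hull_inc)
  then show "x \<in> tet v"
    by (simp add: sum_bary_vertex)
qed

lemma mem_tet_int_iff: "x \<in> tet_int v \<longleftrightarrow> (\<forall>j\<in>II. 0 < bary v j x)"
proof -
  have c: "\<not> card (v ` II) \<le> DIM(real ^ 3)"
    using inj_v by (simp add: card_image) (simp add: II_def)
  have "x \<in> tet_int v \<longleftrightarrow> (\<exists>u. (\<forall>y\<in>v ` II. 0 < u y) \<and> sum u (v ` II) = 1 \<and> (\<Sum>y\<in>v ` II. u y *\<^sub>R y) = x)"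
    unfolding tet_def interior_convex_hull_explicit_minimal[OF affine_independent] using c by auto
  also have "\<dots> \<longleftrightarrow> (\<forall>j\<in>II. 0 < bary v j x)"
  proof
    assume "\<exists>u. (\<forall>y\<in>v ` II. 0 < u y) \<and> sum u (v ` II) = 1 \<and> (\<Sum>y\<in>v ` II. u y *\<^sub>R y) = x"
    then show "\<forall>j\<in>II. 0 < bary v j x"
      using bary_eqI[of "\<lambda>i. _ (v i)" x] by (auto simp: sum_image_vertex)
  next
    assume "\<forall>j\<in>II. 0 < bary v j x"
    then show "\<exists>u. (\<forall>y\<in>v ` II. 0 < u y) \<and> sum u (v ` II) = 1 \<and> (\<Sum>y\<in>v ` II. u y *\<^sub>R y) = x"
      using sum_bary[of x] sum_bary_vertex[of x] inj_v
      by (intro exI[of _ "\<lambda>y. bary v (inv_into II v y) x"]) (simp add: sum_image_vertex)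
  qed
  finally show ?thesis .
qed

lemma face_eq: "i \<in> II \<Longrightarrow> face v i = convex hull (v ` JJ i)"
proof (intro equalityI subsetI)
  fix x assume "i \<in> II" and x: "x \<in> face v i"
  then have b: "\<forall>j\<in>II. 0 \<le> bary v j x" "bary v i x = 0"
    by (auto simp: face_def mem_tet_iff)
  have s: "(\<Sum>j\<in>II. h j) = (\<Sum>j\<in>JJ i. h j)" if "h i = 0" for h :: "nat \<Rightarrow> 'b::comm_monoid_add"
    using that \<open>i \<in> II\<close> by (simp add: JJ_def sum.remove[of II i])
  have "(\<Sum>j\<in>JJ i. bary v j x *\<^sub>R v j) \<in> convex hull (v ` JJ i)"
    using b sum_bary[of x] s[of "\<lambda>j. bary v j x"]
    by (intro convex_sum) (auto simp: hull_inc JJ_def)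
  then show "x \<in> convex hull (v ` JJ i)"
    using s[of "\<lambda>j. bary v j x *\<^sub>R v j"] b(2) by (simp add: sum_bary_vertex)
next
  fix x assume "i \<in> II" and x: "x \<in> convex hull (v ` JJ i)"
  have "bary v i x = 0 \<longleftrightarrow> bgrad i \<bullet> x = - bary v i 0" for x
    using bary_affine[OF \<open>i \<in> II\<close>, of x] by linarith
  then have "convex {x. bary v i x = 0}"
    using convex_hyperplane by simp
  moreover have "v ` JJ i \<subseteq> {x. bary v i x = 0}"
    using \<open>i \<in> II\<close> by (auto simp: JJ_def bary_vertex)
  ultimately have "bary v i x = 0"
    using x by (metis (mono_tags, lifting) hull_minimal in_mono mem_Collect_eq)
  moreover have "x \<in> tet v"
    using x hull_mono[of "v ` JJ i" "v ` II"] by (auto simp: tet_def JJ_def)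
  ultimately show "x \<in> face v i"
    by (simp add: face_def)
qed

lemma mem_face_int_iff:
  assumes i: "i \<in> II"
  shows "x \<in> face_int v i \<longleftrightarrow> bary v i x = 0 \<and> (\<forall>j\<in>JJ i. 0 < bary v j x)"
proof -
  have J: "JJ i \<subseteq> II" by (auto simp: JJ_def)
  have ind: "\<not> affine_dependent (v ` JJ i)"
    using affine_independent affine_dependent_subset J image_mono by metis
  have s: "(\<Sum>j\<in>II. h j) = (\<Sum>j\<in>JJ i. h j)" if "h i = 0" for h :: "nat \<Rightarrow> 'b::comm_monoid_add"
    using that i by (simp add: JJ_def sum.remove[of II i])
  have "x \<in> face_int v i \<longleftrightarrow>
      (\<exists>u. (\<forall>y\<in>v ` JJ i. 0 < u y) \<and> sum u (v ` JJ i) = 1 \<and> (\<Sum>y\<in>v ` JJ i. u y *\<^sub>R y) = x)"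
    unfolding face_eq[OF i] rel_interior_convex_hull_explicit[OF ind] by simp
  also have "\<dots> \<longleftrightarrow> bary v i x = 0 \<and> (\<forall>j\<in>JJ i. 0 < bary v j x)"
  proof
    assume "\<exists>u. (\<forall>y\<in>v ` JJ i. 0 < u y) \<and> sum u (v ` JJ i) = 1 \<and> (\<Sum>y\<in>v ` JJ i. u y *\<^sub>R y) = x"
    then obtain u where u: "\<forall>y\<in>v ` JJ i. 0 < u y" "(\<Sum>j\<in>JJ i. u (v j)) = 1"
        "(\<Sum>j\<in>JJ i. u (v j) *\<^sub>R v j) = x"
      using J by (auto simp: sum_image_vertex)
    define w where "w = (\<lambda>j. if j = i then 0 else u (v j))"
    have "(\<Sum>j\<in>JJ i. w j) = 1" "(\<Sum>j\<in>JJ i. w j *\<^sub>R v j) = x"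
      unfolding u(2)[symmetric] u(3)[symmetric] by (auto intro!: sum.cong simp: w_def JJ_def)
    then have "bary v j x = w j" if "j \<in> II" for j
      using that by (intro bary_eqI) (simp_all add: s w_def)
    then show "bary v i x = 0 \<and> (\<forall>j\<in>JJ i. 0 < bary v j x)"
      using i u(1) by (auto simp: w_def JJ_def)
  next
    assume R: "bary v i x = 0 \<and> (\<forall>j\<in>JJ i. 0 < bary v j x)"
    have inv: "inv_into II v (v j) = j" if "j \<in> JJ i" for j
      using that J inj_v by auto
    show "\<exists>u. (\<forall>y\<in>v ` JJ i. 0 < u y) \<and> sum u (v ` JJ i) = 1 \<and> (\<Sum>y\<in>v ` JJ i. u y *\<^sub>R y) = x"
      using sum_bary[of x] sum_bary_vertex[of x] R
        s[of "\<lambda>j. bary v j x"] s[of "\<lambda>j. bary v j x *\<^sub>R v j"]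
      by (intro exI[of _ "\<lambda>y. bary v (inv_into II v y) x"]) (simp add: sum_image_vertex J inv)
  qed
  finally show ?thesis .
qed

text \<open>
  This is what makes the limits in the definitions of \<open>bd_value\<close> and \<open>bd_grad\<close> unique.
\<close>

lemma tet_int_limit_point:
  assumes "p \<in> tet v"
  shows "at p within tet_int v \<noteq> bot"
proof -
  define m where "m = (\<Sum>i\<in>II. (1 / 4) *\<^sub>R v i)"
  have "bary v j m = 1 / 4" if "j \<in> II" for j
    unfolding m_def by (rule bary_eqI[OF _ _ that]) (simp_all add: II_def)
  then have "m \<in> tet_int v"
    unfolding mem_tet_int_iff by fastforce
  moreover have "convex (tet v)"
    by (simp add: tet_def)
  ultimately have "p \<in> closure (tet_int v)"
    using assms convex_closure_interior closure_subset by (metis empty_iff subsetD)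
  moreover have "p islimpt tet_int v" if "p \<in> tet_int v"
    using that interior_limit_point[of p "tet_int v"] by simp
  ultimately show ?thesis
    by (auto simp: closure_def trivial_limit_within)
qed

end

section \<open>Values and gradients at the boundary\<close>

lemma scaleR_fun_apply: "(c *\<^sub>R f) x = c *\<^sub>R f x"
  by (simp add: scaleR_fun_def)

lemma sum_fun_apply: "(\<Sum>s\<in>K. f s) x = (\<Sum>s\<in>K. f s x)" for f :: "'b \<Rightarrow> 'a \<Rightarrow> 'c::comm_monoid_add"
  by (induction K rule: infinite_finite_induct) auto

text \<open>
  Here r = l / (n + l) and s = m / (n + m) lie between 0 and 1, and n r = l (1 - r) exchanges a factor n
  for a factor l. The bounds say that the functions \<open>Phi\<close> tend to 0 wherever one of their three arguments
  does, although the individual quotients have no limit at the vertices.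
\<close>

lemma dE_end_bound:
  fixes n l m :: real
  assumes "0 < n" "n < 1" "0 < l" "l < 1" "0 < m" "m < 1"
  shows "\<bar>dE_end n l m\<bar> \<le> 5 * n" "\<bar>dE_end n l m\<bar> \<le> 5 * l" "\<bar>dE_end n l m\<bar> \<le> 5 * m"
proof -
  define r s where "r = l / (n + l)" and "s = m / (n + m)"
  have rs: "0 \<le> r" "r \<le> 1" "0 \<le> s" "s \<le> 1" using assms by (auto simp: r_def s_def)
  have eq: "dE_end n l m = n * m * s * r * (2 - r)" "n * r = l * (1 - r)"
    using assms by (simp_all add: r_def s_def field_simps power2_eq_square)
  have r2: "0 \<le> r * (2 - r)" "r * (2 - r) \<le> 1"
    using rs by (simp, sos)
  have nm: "0 \<le> n * m * s" "n * m * s \<le> n" "n * m * s \<le> m"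
    using assms rs by (auto intro!: mult_left_le_one_le mult_right_le_one_le mult_left_le mult_le_one simp: mult.assoc mult_left_le)
  have "0 \<le> n * m * s * (r * (2 - r))" "n * m * s * (r * (2 - r)) \<le> n * m * s * 1"
    using nm(1) r2 by (simp, intro mult_left_mono) auto
  then have a: "0 \<le> dE_end n l m" "dE_end n l m \<le> n * m * s"
    unfolding eq(1) by (simp_all add: mult.assoc)
  have "n * m * s * r * (2 - r) = l * ((1 - r) * (2 - r) * (m * s))"
    using eq(2) by (metis mult.assoc mult.commute)
  also have "\<dots> \<le> l * (1 * 2 * (1 * 1))"
    using rs assms by (intro mult_left_mono mult_mono) auto
  finally have "dE_end n l m \<le> 2 * l"
    unfolding eq(1) by simp
  moreover have "\<bar>e\<bar> \<le> 5 * n \<and> \<bar>e\<bar> \<le> 5 * l \<and> \<bar>e\<bar> \<le> 5 * m"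
    if "0 \<le> e" "e \<le> n * m * s" "e \<le> 2 * l" for e
    using that nm assms by linarith
  ultimately show "\<bar>dE_end n l m\<bar> \<le> 5 * n" "\<bar>dE_end n l m\<bar> \<le> 5 * l" "\<bar>dE_end n l m\<bar> \<le> 5 * m"
    using a by blast+
qed

lemma dE_apex_bound:
  fixes n l m :: real
  assumes "0 < n" "n < 1" "0 < l" "l < 1" "0 < m" "m < 1"
  shows "\<bar>dE_apex n l m\<bar> \<le> 5 * n" "\<bar>dE_apex n l m\<bar> \<le> 5 * l" "\<bar>dE_apex n l m\<bar> \<le> 5 * m"
proof -
  define r s where "r = l / (n + l)" and "s = m / (n + m)"
  have rs: "0 \<le> r" "r \<le> 1" "0 \<le> s" "s \<le> 1" using assms by (auto simp: r_def s_def)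
  have eq: "dE_apex n l m = (r * s)\<^sup>2 * (l * m - n\<^sup>2) - l * m"
    "n * r = l * (1 - r)" "n * s = m * (1 - s)"
    using assms by (simp_all add: r_def s_def field_simps power2_eq_square)
  define t where "t = r * s"
  have t: "0 \<le> t" "t \<le> r" "t \<le> s" "t \<le> 1" using rs by (auto simp: t_def mult_left_le mult_le_one mult_left_le_one_le)
  have t2: "0 \<le> t\<^sup>2" "t\<^sup>2 \<le> t" "t\<^sup>2 \<le> 1"
    using t by (auto simp: power2_eq_square mult_left_le mult_le_one)
  have lm: "0 \<le> l * m" "l * m \<le> l" "l * m \<le> m" using assms by (auto simp: mult_left_le)
  have n2: "0 \<le> n\<^sup>2" "n\<^sup>2 \<le> n" using assms by (auto simp: power2_eq_square mult_left_le)
  have A: "0 \<le> t\<^sup>2 * (l * m)" "t\<^sup>2 * (l * m) \<le> l * m"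
    using t2 lm by (auto simp: mult_left_le_one_le)
  have "t\<^sup>2 * n\<^sup>2 \<le> t * n" using t2 n2 t by (intro mult_mono) auto
  moreover have "t * n \<le> r * n" "t * n \<le> s * n" "t * n \<le> n"
    using t assms by (auto intro!: mult_right_mono simp: mult_left_le_one_le)
  moreover have "r * n \<le> l" "s * n \<le> m"
    using eq(2,3) rs assms by (simp_all add: mult.commute mult_left_le)
  ultimately have B: "0 \<le> t\<^sup>2 * n\<^sup>2" "t\<^sup>2 * n\<^sup>2 \<le> n" "t\<^sup>2 * n\<^sup>2 \<le> l" "t\<^sup>2 * n\<^sup>2 \<le> m"
    by (simp, linarith+)
  have "1 - t\<^sup>2 \<le> 2 * (1 - t)"
    using zero_le_power2[of "1 - t"] by (simp add: power2_eq_square algebra_simps)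
  moreover have "1 - t \<le> (1 - r) + (1 - s)"
    using mult_nonneg_nonneg[of "1 - r" "1 - s"] rs by (simp add: t_def algebra_simps)
  ultimately have "l * m * (1 - t\<^sup>2) \<le> l * m * (2 * ((1 - r) + (1 - s)))"
    using lm(1) by (intro mult_left_mono) auto
  also have "\<dots> = 2 * (m * (l * (1 - r)) + l * (m * (1 - s)))"
    by (simp add: algebra_simps)
  also have "\<dots> = 2 * n * (m * r + l * s)"
    unfolding eq(2,3)[symmetric] by (simp add: algebra_simps)
  also have "\<dots> \<le> 2 * n * (1 * 1 + 1 * 1)"
    using assms rs by (intro mult_left_mono add_mono mult_mono) auto
  finally have C: "l * m - t\<^sup>2 * (l * m) \<le> 4 * n"
    by (simp add: algebra_simps)
  have "dE_apex n l m = t\<^sup>2 * (l * m) - t\<^sup>2 * n\<^sup>2 - l * m"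
    unfolding eq(1) t_def by (simp add: algebra_simps)
  moreover have "\<bar>t\<^sup>2 * (l * m) - t\<^sup>2 * n\<^sup>2 - l * m\<bar> \<le> 5 * n"
    "\<bar>t\<^sup>2 * (l * m) - t\<^sup>2 * n\<^sup>2 - l * m\<bar> \<le> 5 * l" "\<bar>t\<^sup>2 * (l * m) - t\<^sup>2 * n\<^sup>2 - l * m\<bar> \<le> 5 * m"
    using A B C lm by linarith+
  ultimately show "\<bar>dE_apex n l m\<bar> \<le> 5 * n" "\<bar>dE_apex n l m\<bar> \<le> 5 * l" "\<bar>dE_apex n l m\<bar> \<le> 5 * m"
    by simp_all
qed

lemma Phi_eq:
  "Phi l m n l \<mu> = dE_end (\<mu> n) (\<mu> l) (\<mu> m)"
  "l \<noteq> m \<Longrightarrow> Phi l m n m \<mu> = dE_end (\<mu> n) (\<mu> m) (\<mu> l)"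
  "l \<noteq> n \<Longrightarrow> m \<noteq> n \<Longrightarrow> Phi l m n n \<mu> = dE_apex (\<mu> n) (\<mu> l) (\<mu> m)"
  by (auto simp: Phi_def ac_simps)

lemma Phi_bound:
  assumes "k \<in> {l, m, n}" "l \<noteq> m" "l \<noteq> n" "m \<noteq> n" "\<forall>j\<in>{l, m, n}. 0 < \<mu> j \<and> \<mu> j < 1" "j \<in> {l, m, n}"
  shows "\<bar>Phi l m n k \<mu>\<bar> \<le> 5 * \<mu> j"
  using assms dE_end_bound[of "\<mu> n" "\<mu> l" "\<mu> m"] dE_end_bound[of "\<mu> n" "\<mu> m" "\<mu> l"]
    dE_apex_bound[of "\<mu> n" "\<mu> l" "\<mu> m"]
  by (elim insertE emptyE) (simp_all only: Phi_eq insert_iff empty_iff simp_thms ball_simps not_False_eq_True if_True)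

text \<open>
  Because a quotient with denominator 0 has the value 0, the formulas take the value of the continuous
  extension even at the points where a denominator vanishes.
\<close>

lemma Phi_vanish:
  assumes "\<mu> l = 0 \<or> \<mu> m = 0 \<or> \<mu> n = 0" "k \<in> {l, m, n}" "l \<noteq> m" "l \<noteq> n" "m \<noteq> n"
  shows "Phi l m n k \<mu> = 0"
  using assms by (auto simp: Phi_def power2_eq_square)

context tetrahedron
begin

lemma bary_less_1:
  assumes "x \<in> tet_int v" "j \<in> II"
  shows "bary v j x < 1"
proof -
  obtain k where "k \<in> II" "k \<noteq> j" by (auto simp: II_def)
  have "bary v j x + bary v k x \<le> (\<Sum>i\<in>II. bary v i x)"
    using sum_mono2[of II "{j, k}" "\<lambda>i. bary v i x"] assms \<open>k \<in> II\<close> \<open>k \<noteq> j\<close>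
    by (auto simp: mem_tet_int_iff less_imp_le)
  then show ?thesis
    using assms \<open>k \<in> II\<close> by (auto simp: sum_bary mem_tet_int_iff)
qed

lemma eventually_in_tet_int: "eventually (\<lambda>x. x \<in> tet_int v) (at p within tet_int v)"
  by (simp add: eventually_at_filter)

text \<open>
  The functions V and H are the limits of z on the boundary and of the gradient of z at the points
  of S. Such data are additive, so that they can be computed for the basis functions separately. The
  set S is the closed tetrahedron for the edge-enriched space, and the union of the edges for the lifts.
\<close>

definition boundary_data ::
    "(real ^ 3) set \<Rightarrow> (real ^ 3 \<Rightarrow> real) \<Rightarrow> (real ^ 3 \<Rightarrow> real) \<Rightarrow> (real ^ 3 \<Rightarrow> real ^ 3) \<Rightarrow> bool" where
  "boundary_data S z V H \<longleftrightarrow> (\<forall>x\<in>tet_int v. GDERIV z x :> grad z x) \<and>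
     (\<forall>p\<in>tet v - tet_int v. (z \<longlongrightarrow> V p) (at p within tet_int v)) \<and>
     (\<forall>p\<in>S. (grad z \<longlongrightarrow> H p) (at p within tet_int v))"

lemma boundary_dataI:
  assumes der: "\<And>x. x \<in> tet_int v \<Longrightarrow> GDERIV f x :> G x"
    and val: "\<And>p. p \<in> tet v - tet_int v \<Longrightarrow> (f \<longlongrightarrow> V p) (at p within tet_int v)"
    and gr: "\<And>p. p \<in> S \<Longrightarrow> (G \<longlongrightarrow> H p) (at p within tet_int v)"
  shows "boundary_data S (restrict_to (tet_int v) f) V H"
proof -
  let ?z = "restrict_to (tet_int v) f"
  have der': "GDERIV ?z x :> G x" if "x \<in> tet_int v" for x
    using der[OF that] unfolding gderiv_def
    by (rule has_derivative_transform_within_open[OF _ open_interior that]) (simp add: restrict_to_def)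
  then have gr_eq: "grad ?z x = G x" if "x \<in> tet_int v" for x
    using grad_eqI that by blast
  have "(?z \<longlongrightarrow> L) (at p within tet_int v) \<longleftrightarrow> (f \<longlongrightarrow> L) (at p within tet_int v)" for p L
    by (intro tendsto_cong eventually_mono[OF eventually_in_tet_int]) (simp add: restrict_to_def)
  moreover have "(grad ?z \<longlongrightarrow> L) (at p within tet_int v) \<longleftrightarrow> (G \<longlongrightarrow> L) (at p within tet_int v)" for p L
    by (intro tendsto_cong eventually_mono[OF eventually_in_tet_int]) (simp add: gr_eq)
  ultimately show ?thesis
    using der' val gr by (simp add: boundary_data_def gr_eq)
qed

lemma boundary_data_smooth:
  assumes "\<And>x. GDERIV f x :> G x" "continuous_on UNIV G"
  shows "boundary_data S (restrict_to (tet_int v) f) f G"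
proof (rule boundary_dataI)
  show "(f \<longlongrightarrow> f p) (at p within tet_int v)" for p
    using assms(1)[of p] has_derivative_continuous unfolding gderiv_def
    by (metis continuous_within tendsto_within_subset top_greatest)
  show "(G \<longlongrightarrow> G p) (at p within tet_int v)" for p
    using assms(2) by (metis UNIV_I continuous_on_def tendsto_within_subset top_greatest)
qed (rule assms)

lemma boundary_data_mono: "boundary_data S z V H \<Longrightarrow> S' \<subseteq> S \<Longrightarrow> boundary_data S' z V H"
  by (auto simp: boundary_data_def)

lemma boundary_data_cong:
  assumes "boundary_data S z V H" "\<And>p. p \<in> tet v - tet_int v \<Longrightarrow> V p = V' p" "\<And>p. p \<in> S \<Longrightarrow> H p = H' p"
  shows "boundary_data S z V' H'"
  using assms by (auto simp: boundary_data_def)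

lemma boundary_data_zero: "boundary_data S 0 (\<lambda>_. 0) (\<lambda>_. 0)"
proof -
  have "boundary_data S (restrict_to (tet_int v) (\<lambda>_. 0)) (\<lambda>_. 0) (\<lambda>_. 0)"
    by (rule boundary_data_smooth) (auto simp: GDERIV_const)
  then show ?thesis
    by (simp add: restrict_to_def zero_fun_def)
qed

lemma boundary_data_add:
  assumes y: "boundary_data S y V H" and z: "boundary_data S z V' H'"
  shows "boundary_data S (y + z) (\<lambda>p. V p + V' p) (\<lambda>p. H p + H' p)"
proof -
  have der: "GDERIV (y + z) x :> grad y x + grad z x" if "x \<in> tet_int v" for x
    using GDERIV_add[of y x "grad y x" z "grad z x"] y z that
    by (simp add: boundary_data_def plus_fun_def)
  then have g: "grad (y + z) x = grad y x + grad z x" if "x \<in> tet_int v" for x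
    using that grad_eqI by blast
  have "((y + z) \<longlongrightarrow> V p + V' p) (at p within tet_int v)" if "p \<in> tet v - tet_int v" for p
    using tendsto_add[of y "V p" _ z "V' p"] y z that by (simp add: boundary_data_def plus_fun_def)
  moreover have "(grad (y + z) \<longlongrightarrow> H p + H' p) (at p within tet_int v)" if "p \<in> S" for p
    using tendsto_add[of "grad y" "H p" "at p within tet_int v" "grad z" "H' p"] y z that
    by (subst tendsto_cong[OF eventually_mono[OF eventually_in_tet_int]]) (auto simp: boundary_data_def g)
  ultimately show ?thesis
    using der by (simp add: boundary_data_def g)
qed

lemma boundary_data_scaleR:
  assumes z: "boundary_data S z V H"
  shows "boundary_data S (c *\<^sub>R z) (\<lambda>p. c * V p) (\<lambda>p. c *\<^sub>R H p)"
proof -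
  have der: "GDERIV (c *\<^sub>R z) x :> c *\<^sub>R grad z x" if "x \<in> tet_int v" for x
    using GDERIV_mult[OF GDERIV_const, of z x "grad z x" c] z that
    by (simp add: boundary_data_def scaleR_fun_def)
  then have g: "grad (c *\<^sub>R z) x = c *\<^sub>R grad z x" if "x \<in> tet_int v" for x
    using that grad_eqI by blast
  have "((c *\<^sub>R z) \<longlongrightarrow> c * V p) (at p within tet_int v)" if "p \<in> tet v - tet_int v" for p
    using tendsto_mult_left[of z "V p" _ c] z that by (simp add: boundary_data_def scaleR_fun_def)
  moreover have "(grad (c *\<^sub>R z) \<longlongrightarrow> c *\<^sub>R H p) (at p within tet_int v)" if "p \<in> S" for p
    using tendsto_scaleR[OF tendsto_const, of "grad z" "H p" "at p within tet_int v" c] z that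
    by (subst tendsto_cong[OF eventually_mono[OF eventually_in_tet_int]]) (auto simp: boundary_data_def g)
  ultimately show ?thesis
    using der by (simp add: boundary_data_def g)
qed

lemma boundary_data_sum:
  assumes "\<And>s. s \<in> K \<Longrightarrow> boundary_data S (z s) (V s) (H s)"
  shows "boundary_data S (\<Sum>s\<in>K. c s *\<^sub>R z s) (\<lambda>p. \<Sum>s\<in>K. c s * V s p) (\<lambda>p. \<Sum>s\<in>K. c s *\<^sub>R H s p)"
  using assms
proof (induction K rule: infinite_finite_induct)
  case (insert s K)
  show ?case
    unfolding sum.insert[OF insert.hyps]
    by (intro boundary_data_add boundary_data_scaleR insert) auto
qed (auto simp: boundary_data_zero)

lemma bd_value_eqI:
  "boundary_data S z V H \<Longrightarrow> p \<in> tet v - tet_int v \<Longrightarrow> bd_value v z p = V p"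
  unfolding bd_value_def boundary_data_def
  by (intro tendsto_Lim tet_int_limit_point) auto

lemma bd_grad_eqI:
  "boundary_data S z V H \<Longrightarrow> p \<in> S \<Longrightarrow> p \<in> tet v \<Longrightarrow> bd_grad v z p = H p"
  unfolding bd_grad_def boundary_data_def
  by (intro tendsto_Lim tet_int_limit_point) auto

end

section \<open>The edge bubbles at the boundary\<close>

lemma GDERIV_square_over_sum:
  fixes a b :: "'a::real_inner \<Rightarrow> real"
  assumes "GDERIV a x :> ga" "GDERIV b x :> gb" "a x + b x \<noteq> 0"
  shows "GDERIV (\<lambda>x. (b x)\<^sup>2 / (a x + b x)) x :>
    (b x * (2 * a x + b x) / (a x + b x)\<^sup>2) *\<^sub>R gb - (b x / (a x + b x))\<^sup>2 *\<^sub>R ga"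
proof -
  define s where "s = a x + b x"
  have s: "s \<noteq> 0" "a x = s - b x" using assms by (simp_all add: s_def)
  have "GDERIV (\<lambda>x. b x * b x * inverse (a x + b x)) x :>
    (b x * b x) *\<^sub>R (- (inverse (a x + b x))\<^sup>2 *\<^sub>R (ga + gb)) + inverse (a x + b x) *\<^sub>R (b x *\<^sub>R gb + b x *\<^sub>R gb)"
    by (intro GDERIV_mult GDERIV_inverse GDERIV_add assms)
  moreover have "(b x * b x) *\<^sub>R (- (inverse s)\<^sup>2 *\<^sub>R (ga + gb)) + inverse s *\<^sub>R (b x *\<^sub>R gb + b x *\<^sub>R gb) =
    (b x * (2 * a x + b x) / s\<^sup>2) *\<^sub>R gb - (b x / s)\<^sup>2 *\<^sub>R ga"
  proof -
    have coeffs: "inverse s * b x + inverse s * b x - b x * b x * (inverse s)\<^sup>2 =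
        b x * (2 * a x + b x) / s\<^sup>2"
      "b x * b x * (inverse s)\<^sup>2 = (b x / s)\<^sup>2"
      using s(1) unfolding s(2) by (simp_all add: field_simps power2_eq_square)
    have comb: "\<beta> *\<^sub>R (- (i\<^sup>2) *\<^sub>R (ga + gb)) + i *\<^sub>R (\<delta> *\<^sub>R gb + \<delta> *\<^sub>R gb) =
        (i * \<delta> + i * \<delta> - \<beta> * i\<^sup>2) *\<^sub>R gb - (\<beta> * i\<^sup>2) *\<^sub>R ga" for \<beta> \<delta> i :: real
      by (simp only: scaleR_add_left scaleR_diff_left scaleR_add_right scaleR_scaleR scaleR_minus_left
          mult_minus_right) simp
    show ?thesis
      unfolding comb coeffs(1) unfolding coeffs(2) ..
  qed
  ultimately show ?thesis
    unfolding s_def by (simp add: power2_eq_square divide_inverse)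
qed

text \<open>
  The edge bubble is the product of a and of two functions of the form \<open>b\<^sup>2 / (a + b)\<close>; its partial
  derivatives are the functions that define the singular traces.
\<close>

lemma GDERIV_edge_rational:
  fixes a b c :: "'a::real_inner \<Rightarrow> real"
  assumes a: "GDERIV a x :> ga" and b: "GDERIV b x :> gb" and c: "GDERIV c x :> gc"
    and nz: "a x + b x \<noteq> 0" "a x + c x \<noteq> 0"
  shows "GDERIV (\<lambda>x. a x * (b x)\<^sup>2 * (c x)\<^sup>2 / ((a x + b x) * (a x + c x))) x :>
    dE_end (a x) (b x) (c x) *\<^sub>R gb + dE_end (a x) (c x) (b x) *\<^sub>R gc +
    (dE_apex (a x) (b x) (c x) + b x * c x) *\<^sub>R ga"
proof -
  define s t where "s = a x + b x" and "t = a x + c x"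
  have st: "s \<noteq> 0" "t \<noteq> 0" using nz by (simp_all add: s_def t_def)
  have "GDERIV (\<lambda>x. a x * ((b x)\<^sup>2 / (a x + b x) * ((c x)\<^sup>2 / (a x + c x)))) x :>
    a x *\<^sub>R (((b x)\<^sup>2 / s) *\<^sub>R ((c x * (2 * a x + c x) / t\<^sup>2) *\<^sub>R gc - (c x / t)\<^sup>2 *\<^sub>R ga) +
       ((c x)\<^sup>2 / t) *\<^sub>R ((b x * (2 * a x + b x) / s\<^sup>2) *\<^sub>R gb - (b x / s)\<^sup>2 *\<^sub>R ga)) +
    ((b x)\<^sup>2 / s * ((c x)\<^sup>2 / t)) *\<^sub>R ga" (is "GDERIV _ _ :> ?G")
    unfolding s_def t_def by (intro GDERIV_mult GDERIV_square_over_sum assms)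
  moreover have "(\<lambda>x. a x * ((b x)\<^sup>2 / (a x + b x) * ((c x)\<^sup>2 / (a x + c x)))) =
      (\<lambda>x. a x * (b x)\<^sup>2 * (c x)\<^sup>2 / ((a x + b x) * (a x + c x)))"
    by (simp add: mult.assoc)
  moreover have "?G = dE_end (a x) (b x) (c x) *\<^sub>R gb + dE_end (a x) (c x) (b x) *\<^sub>R gc +
    (dE_apex (a x) (b x) (c x) + b x * c x) *\<^sub>R ga"
  proof -
    have coeffs: "a x * ((c x)\<^sup>2 / t * (b x * (2 * a x + b x) / s\<^sup>2)) = dE_end (a x) (b x) (c x)"
      "a x * ((b x)\<^sup>2 / s * (c x * (2 * a x + c x) / t\<^sup>2)) = dE_end (a x) (c x) (b x)"
      unfolding s_def[symmetric] t_def[symmetric] using st by (simp_all add: field_simps)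
    have apex: "b x * c x - (a x)\<^sup>2 = s * t - a x * (s + t)"
      by (simp add: s_def t_def algebra_simps power2_eq_square)
    have e3: "(b x)\<^sup>2 / s * ((c x)\<^sup>2 / t) - a x * ((b x)\<^sup>2 / s * (c x / t)\<^sup>2) - a x * ((c x)\<^sup>2 / t * (b x / s)\<^sup>2) =
      dE_apex (a x) (b x) (c x) + b x * c x"
    proof -
      have "(b x)\<^sup>2 / s * ((c x)\<^sup>2 / t) - a x * ((b x)\<^sup>2 / s * (c x / t)\<^sup>2) - a x * ((c x)\<^sup>2 / t * (b x / s)\<^sup>2) =
        (b x)\<^sup>2 * (c x)\<^sup>2 * (s * t - a x * (s + t)) / (s\<^sup>2 * t\<^sup>2)"
        using st by (simp add: field_simps power2_eq_square)
      then show ?thesis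
        unfolding s_def[symmetric] t_def[symmetric] using apex by simp
    qed
    have comb: "\<alpha> *\<^sub>R (B *\<^sub>R (p *\<^sub>R gc - q *\<^sub>R ga) + C *\<^sub>R (r *\<^sub>R gb - u *\<^sub>R ga)) + (B * C) *\<^sub>R ga =
      (\<alpha> * (C * r)) *\<^sub>R gb + (\<alpha> * (B * p)) *\<^sub>R gc + (B * C - \<alpha> * (B * q) - \<alpha> * (C * u)) *\<^sub>R ga"
      for \<alpha> B C p q r u
      by (simp add: algebra_simps)
    show ?thesis
      unfolding comb coeffs e3 ..
  qed
  ultimately show ?thesis by simp
qed
context tetrahedron
begin

lemma tendsto_squeeze_bary:
  assumes "j \<in> II" "bary v j p = 0" "\<And>x. x \<in> tet_int v \<Longrightarrow> \<bar>f x\<bar> \<le> C * bary v j x"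
  shows "(f \<longlongrightarrow> 0) (at p within tet_int v)"
proof (rule Lim_null_comparison)
  show "\<forall>\<^sub>F x in at p within tet_int v. norm (f x) \<le> C * bary v j x"
    using eventually_in_tet_int by (rule eventually_mono) (use assms(3) in simp)
  show "((\<lambda>x. C * bary v j x) \<longlongrightarrow> 0) (at p within tet_int v)"
    using tendsto_mult_left[OF tendsto_bary[OF assms(1)], of C p] assms(2) by simp
qed

text \<open>
  The functions \<open>Phi\<close> of the barycentric coordinates extend continuously to the closed tetrahedron, and
  the extension is given by the formula itself: if one of the three coordinates vanishes at p, both the
  limit and the formula are 0, and otherwise the denominators are positive at p.
\<close>

lemma tendsto_Phi:
  assumes "p \<in> tet v" "l \<in> II" "m \<in> II" "n \<in> II" "l \<noteq> m" "l \<noteq> n" "m \<noteq> n" "k \<in> {l, m, n}"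
  shows "((\<lambda>x. Phi l m n k (\<lambda>j. bary v j x)) \<longlongrightarrow> Phi l m n k (\<lambda>j. bary v j p)) (at p within tet_int v)"
proof (cases "\<exists>j\<in>{l, m, n}. bary v j p = 0")
  case True
  then obtain j where j: "j \<in> {l, m, n}" "bary v j p = 0" by blast
  have "\<bar>Phi l m n k (\<lambda>j. bary v j x)\<bar> \<le> 5 * bary v j x" if "x \<in> tet_int v" for x
    using that assms j(1) by (intro Phi_bound) (auto simp: bary_less_1 mem_tet_int_iff)
  then have "((\<lambda>x. Phi l m n k (\<lambda>j. bary v j x)) \<longlongrightarrow> 0) (at p within tet_int v)"
    using j assms by (intro tendsto_squeeze_bary[of j]) auto
  moreover have "Phi l m n k (\<lambda>j. bary v j p) = 0"
    using j assms by (intro Phi_vanish) auto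
  ultimately show ?thesis by simp
next
  case False
  then have "0 < bary v j p" if "j \<in> {l, m, n}" for j
    using that assms by (metis insert_iff empty_iff mem_tet_iff order_le_less)
  then have "bary v n p + bary v l p \<noteq> 0" "bary v n p + bary v m p \<noteq> 0"
    by (metis add_pos_pos insertCI less_irrefl)+
  then show ?thesis
    unfolding Phi_def by (simp split: if_split) (intro impI conjI tendsto_intros tendsto_bary assms; simp)
qed

lemma GDERIV_edge_bubble:
  assumes "x \<in> tet_int v" "l \<in> II" "m \<in> II" "n \<in> II" "l \<noteq> m" "l \<noteq> n" "m \<noteq> n"
  shows "GDERIV (\<lambda>x. bary v n x * (bary v l x)\<^sup>2 * (bary v m x)\<^sup>2
       / ((bary v n x + bary v l x) * (bary v n x + bary v m x))) x :>
     Phi l m n l (\<lambda>j. bary v j x) *\<^sub>R bgrad l + Phi l m n m (\<lambda>j. bary v j x) *\<^sub>R bgrad m +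
     (Phi l m n n (\<lambda>j. bary v j x) + bary v l x * bary v m x) *\<^sub>R bgrad n"
proof -
  have pos: "0 < bary v n x" "0 < bary v l x" "0 < bary v m x"
    using assms by (auto simp: mem_tet_int_iff)
  have "GDERIV (\<lambda>x. bary v n x * (bary v l x)\<^sup>2 * (bary v m x)\<^sup>2
       / ((bary v n x + bary v l x) * (bary v n x + bary v m x))) x :>
    dE_end (bary v n x) (bary v l x) (bary v m x) *\<^sub>R bgrad l +
    dE_end (bary v n x) (bary v m x) (bary v l x) *\<^sub>R bgrad m +
    (dE_apex (bary v n x) (bary v l x) (bary v m x) + bary v l x * bary v m x) *\<^sub>R bgrad n"
    by (intro GDERIV_edge_rational GDERIV_bary assms) (use pos in linarith)+
  then show ?thesis
    unfolding Phi_eq(1) Phi_eq(2)[OF \<open>l \<noteq> m\<close>] Phi_eq(3)[OF \<open>l \<noteq> n\<close> \<open>m \<noteq> n\<close>] .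
qed

lemma boundary_zero_coordinate:
  assumes "p \<in> tet v - tet_int v"
  obtains j where "j \<in> II" "bary v j p = 0"
  using assms by (auto simp: mem_tet_iff mem_tet_int_iff order_less_le)

text \<open>
  Both the bubble and its gradient extend continuously to the closed tetrahedron.
\<close>

lemma edge_bubble_data:
  assumes "l \<in> II" "m \<in> II" "n \<in> II" "l \<noteq> m" "l \<noteq> n" "m \<noteq> n"
  shows "boundary_data (tet v) (edge_bubble v l m n)
    (\<lambda>p. bary v n p * (bary v l p)\<^sup>2 * (bary v m p)\<^sup>2 / ((bary v n p + bary v l p) * (bary v n p + bary v m p)))
    (\<lambda>p. Phi l m n l (\<lambda>j. bary v j p) *\<^sub>R bgrad l + Phi l m n m (\<lambda>j. bary v j p) *\<^sub>R bgrad m +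
      (Phi l m n n (\<lambda>j. bary v j p) + bary v l p * bary v m p) *\<^sub>R bgrad n)"
  unfolding edge_bubble_def
proof (rule boundary_dataI)
  fix p assume p: "p \<in> tet v - tet_int v"
  let ?E = "\<lambda>x. bary v n x * (bary v l x)\<^sup>2 * (bary v m x)\<^sup>2 / ((bary v n x + bary v l x) * (bary v n x + bary v m x))"
  show "(?E \<longlongrightarrow> ?E p) (at p within tet_int v)"
  proof (cases "\<exists>j\<in>{l, m, n}. bary v j p = 0")
    case True
    then obtain j where j: "j \<in> {l, m, n}" "bary v j p = 0" by blast
    have bound: "0 \<le> ?E x \<and> ?E x \<le> 1 * bary v j x" if x: "x \<in> tet_int v" for x
    proof -
      have pos: "0 < bary v k x" "bary v k x < 1" if "k \<in> {l, m, n}" for k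
        using that x assms by (auto simp: bary_less_1 mem_tet_int_iff)
      define a b c where "a = bary v n x" and "b = bary v l x" and "c = bary v m x"
      have abc: "0 < a" "a < 1" "0 < b" "b < 1" "0 < c" "c < 1"
        using pos by (auto simp: a_def b_def c_def)
      define r s where "r = b / (a + b)" and "s = c / (a + c)"
      have rs: "0 \<le> r" "r \<le> 1" "0 \<le> s" "s \<le> 1" using abc by (auto simp: r_def s_def)
      have "?E x = a * b * c * (r * s)"
        by (simp add: a_def b_def c_def r_def s_def power2_eq_square)
      moreover have "0 \<le> a * b * c * (r * s)"
        using abc rs by simp
      moreover have "a * b * c * (r * s) \<le> a * b * c * 1"
        using abc rs by (intro mult_left_mono mult_le_one) auto
      moreover have "a * b * c \<le> a * 1 * 1" "a * b * c \<le> 1 * b * 1" "a * b * c \<le> 1 * 1 * c"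
        using abc by (intro mult_mono; simp)+
      ultimately show ?thesis
        using j(1) by (auto simp: a_def b_def c_def)
    qed
    have "j \<in> II" using j assms by auto
    then have "(?E \<longlongrightarrow> 0) (at p within tet_int v)"
      by (rule tendsto_squeeze_bary[OF _ j(2), where C = 1]) (metis abs_of_nonneg bound)
    moreover have "?E p = 0"
      using j by auto
    ultimately show ?thesis by (simp only:)
  next
    case False
    then have "0 < bary v j p" if "j \<in> {l, m, n}" for j
      using that assms p by (metis DiffD1 insert_iff empty_iff mem_tet_iff order_le_less)
    then have "bary v n p + bary v l p \<noteq> 0" "bary v n p + bary v m p \<noteq> 0"
      by (metis add_pos_pos insertCI less_irrefl)+
    then show ?thesis
      by (intro tendsto_intros tendsto_bary assms) simp
  qed
next
  fix p assume p: "p \<in> tet v"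
  show "((\<lambda>x. Phi l m n l (\<lambda>j. bary v j x) *\<^sub>R bgrad l + Phi l m n m (\<lambda>j. bary v j x) *\<^sub>R bgrad m +
      (Phi l m n n (\<lambda>j. bary v j x) + bary v l x * bary v m x) *\<^sub>R bgrad n) \<longlongrightarrow>
    Phi l m n l (\<lambda>j. bary v j p) *\<^sub>R bgrad l + Phi l m n m (\<lambda>j. bary v j p) *\<^sub>R bgrad m +
      (Phi l m n n (\<lambda>j. bary v j p) + bary v l p * bary v m p) *\<^sub>R bgrad n) (at p within tet_int v)"
    by (intro tendsto_intros tendsto_bary tendsto_Phi p assms) auto
qed (use GDERIV_edge_bubble assms in blast)

section \<open>Functions with bounded gradient\<close>

definition tame :: "(real ^ 3 \<Rightarrow> real) \<Rightarrow> bool" where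
  "tame f \<longleftrightarrow> (\<exists>C. \<forall>x\<in>tet_int v. \<bar>f x\<bar> \<le> C \<and> (\<exists>D. GDERIV f x :> D \<and> norm D \<le> C))"

lemma tame_bary:
  assumes "j \<in> II"
  shows "tame (bary v j)"
  unfolding tame_def
proof (intro exI ballI conjI)
  fix x assume "x \<in> tet_int v"
  then have "\<bar>bary v j x\<bar> \<le> 1"
    using assms bary_less_1[of x j] by (auto simp: mem_tet_int_iff)
  then show "\<bar>bary v j x\<bar> \<le> 1 + norm (bgrad j)"
    by (smt (verit) norm_ge_zero)
  show "GDERIV (bary v j) x :> bgrad j" "norm (bgrad j) \<le> 1 + norm (bgrad j)"
    using assms by (simp_all add: GDERIV_bary del: gderiv_deriv)
qed

lemma tame_const: "tame (\<lambda>x. c)"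
  unfolding tame_def by (rule exI[of _ "\<bar>c\<bar>"]) (auto intro!: exI[of _ 0] GDERIV_const)

lemma tame_add:
  assumes "tame f" "tame g"
  shows "tame (\<lambda>x. f x + g x)"
proof -
  obtain C D where CD: "\<forall>x\<in>tet_int v. \<bar>f x\<bar> \<le> C \<and> (\<exists>E. GDERIV f x :> E \<and> norm E \<le> C)"
    "\<forall>x\<in>tet_int v. \<bar>g x\<bar> \<le> D \<and> (\<exists>E. GDERIV g x :> E \<and> norm E \<le> D)"
    using assms unfolding tame_def by blast
  show ?thesis
    unfolding tame_def
  proof (intro exI[of _ "C + D"] ballI conjI)
    fix x assume x: "x \<in> tet_int v"
    then obtain F G where "GDERIV f x :> F" "norm F \<le> C" "GDERIV g x :> G" "norm G \<le> D"
      using CD by blast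
    then show "\<exists>E. GDERIV (\<lambda>x. f x + g x) x :> E \<and> norm E \<le> C + D"
      by (intro exI[of _ "F + G"] conjI GDERIV_add norm_add_rule_thm)
    show "\<bar>f x + g x\<bar> \<le> C + D"
      using CD x by (smt (verit))
  qed
qed

lemma tame_mult:
  assumes "tame f" "tame g"
  shows "tame (\<lambda>x. f x * g x)"
proof -
  obtain C D where CD: "\<forall>x\<in>tet_int v. \<bar>f x\<bar> \<le> C \<and> (\<exists>E. GDERIV f x :> E \<and> norm E \<le> C)"
    "\<forall>x\<in>tet_int v. \<bar>g x\<bar> \<le> D \<and> (\<exists>E. GDERIV g x :> E \<and> norm E \<le> D)"
    using assms unfolding tame_def by blast
  show ?thesis
    unfolding tame_def
  proof (intro exI[of _ "C * D + C * D"] ballI conjI)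
    fix x assume x: "x \<in> tet_int v"
    then obtain F G where FG: "GDERIV f x :> F" "norm F \<le> C" "GDERIV g x :> G" "norm G \<le> D"
      using CD by blast
    have fg: "\<bar>f x\<bar> \<le> C" "\<bar>g x\<bar> \<le> D" using CD x by auto
    have "norm (f x *\<^sub>R G + g x *\<^sub>R F) \<le> \<bar>f x\<bar> * norm G + \<bar>g x\<bar> * norm F"
      by (metis norm_scaleR norm_triangle_ineq)
    also have "\<dots> \<le> C * D + D * C"
      using FG fg by (intro add_mono mult_mono) (auto intro: order_trans[OF abs_ge_zero])
    finally show "\<exists>E. GDERIV (\<lambda>x. f x * g x) x :> E \<and> norm E \<le> C * D + C * D"
      using GDERIV_mult[OF FG(1,3)] by (auto simp: mult.commute)
    have "\<bar>f x * g x\<bar> \<le> C * D" "0 \<le> C * D"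
      using fg unfolding abs_mult by (auto intro!: mult_mono mult_nonneg_nonneg intro: order_trans[OF abs_ge_zero])
    then show "\<bar>f x * g x\<bar> \<le> C * D + C * D"
      by linarith
  qed
qed

lemma tame_diff: "tame f \<Longrightarrow> tame g \<Longrightarrow> tame (\<lambda>x. f x - g x)"
  using tame_add[OF _ tame_mult[OF tame_const[of "- 1"]], of f g] by simp

text \<open>
  The quotient of a coordinate by a sum of two coordinates has a gradient of the order of the reciprocal
  of that sum, and this is compensated if f is bounded by the sum. As the quotient is at most 1, the
  product satisfies the same bounds as f, so the lemma can be applied repeatedly; together with sums and
  products it yields all the rational functions below from the coordinates.
\<close>

lemma tame_ratio:
  assumes "tame f" and bound: "\<And>x. x \<in> tet_int v \<Longrightarrow> \<bar>f x\<bar> \<le> bary v a x + bary v b x"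
    and ab: "a \<in> II" "b \<in> II"
  shows "tame (\<lambda>x. f x * (bary v a x / (bary v a x + bary v b x)))"
proof -
  obtain C where C: "\<forall>x\<in>tet_int v. \<bar>f x\<bar> \<le> C \<and> (\<exists>E. GDERIV f x :> E \<and> norm E \<le> C)"
    using assms unfolding tame_def by blast
  define K where "K = norm (bgrad a) + norm (bgrad b)"
  show ?thesis
    unfolding tame_def
  proof (intro exI[of _ "C + K"] ballI conjI)
    fix x assume x: "x \<in> tet_int v"
    define p q where "p = bary v a x" and "q = bary v b x"
    have pq: "0 < p" "0 < q" using x ab by (auto simp: p_def q_def mem_tet_int_iff)
    define r where "r = p / (p + q)"
    have r: "0 \<le> r" "r \<le> 1" using pq by (auto simp: r_def)
    obtain F where F: "GDERIV f x :> F" "norm F \<le> C"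
      using C x by blast
    let ?R = "p *\<^sub>R (- (inverse (p + q))\<^sup>2 *\<^sub>R (bgrad a + bgrad b)) + inverse (p + q) *\<^sub>R bgrad a"
    have "GDERIV (\<lambda>x. bary v a x * inverse (bary v a x + bary v b x)) x :> ?R"
      unfolding p_def q_def using pq
      by (intro GDERIV_mult GDERIV_inverse GDERIV_add GDERIV_bary ab) (simp add: p_def q_def)
    then have der: "GDERIV (\<lambda>x. f x * (bary v a x / (bary v a x + bary v b x))) x :> f x *\<^sub>R ?R + r *\<^sub>R F"
      using GDERIV_mult[OF F(1)] unfolding r_def p_def q_def divide_inverse by blast
    have "?R = (inverse (p + q))\<^sup>2 *\<^sub>R (q *\<^sub>R bgrad a - p *\<^sub>R bgrad b)"
    proof -
      have i: "inverse (p + q) = (inverse (p + q))\<^sup>2 * (p + q)"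
        using pq by (simp add: power2_eq_square)
      have "p *\<^sub>R (- (i\<^sup>2) *\<^sub>R (bgrad a + bgrad b)) + (i\<^sup>2 * (p + q)) *\<^sub>R bgrad a =
          i\<^sup>2 *\<^sub>R (q *\<^sub>R bgrad a - p *\<^sub>R bgrad b)" for i
        by (simp add: algebra_simps)
      then show ?thesis using i by metis
    qed
    then have "norm (f x *\<^sub>R ?R) = \<bar>f x\<bar> * (inverse (p + q))\<^sup>2 * norm (q *\<^sub>R bgrad a - p *\<^sub>R bgrad b)"
      by (simp add: abs_mult)
    also have "\<dots> \<le> (p + q) * (inverse (p + q))\<^sup>2 * ((p + q) * K)"
    proof (intro mult_mono)
      have "norm (q *\<^sub>R bgrad a - p *\<^sub>R bgrad b) \<le> q * norm (bgrad a) + p * norm (bgrad b)"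
        using norm_triangle_ineq4[of "q *\<^sub>R bgrad a" "p *\<^sub>R bgrad b"] pq by simp
      also have "\<dots> \<le> (p + q) * norm (bgrad a) + (p + q) * norm (bgrad b)"
        using pq by (intro add_mono mult_right_mono) auto
      finally show "norm (q *\<^sub>R bgrad a - p *\<^sub>R bgrad b) \<le> (p + q) * K"
        by (simp add: K_def distrib_left)
    qed (use bound[OF x] pq in \<open>auto simp: p_def q_def\<close>)
    also have "\<dots> = K"
      using pq by (simp add: power2_eq_square)
    finally have "norm (f x *\<^sub>R ?R) \<le> K" .
    moreover have "norm (r *\<^sub>R F) \<le> C"
      using r F(2) mult_mono[of r 1 "norm F" C] by simp
    ultimately have "norm (f x *\<^sub>R ?R + r *\<^sub>R F) \<le> C + K"
      using norm_triangle_mono by (subst add.commute[of C K]) blast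
    then show "\<exists>E. GDERIV (\<lambda>x. f x * (bary v a x / (bary v a x + bary v b x))) x :> E \<and> norm E \<le> C + K"
      using der by blast
    have "\<bar>f x * r\<bar> \<le> C * 1"
      unfolding abs_mult using r C x by (intro mult_mono) auto
    moreover have "0 \<le> K" by (simp add: K_def)
    ultimately show "\<bar>f x * (bary v a x / (bary v a x + bary v b x))\<bar> \<le> C + K"
      unfolding r_def p_def q_def by linarith
  qed
qed

text \<open>
  If two functions with bounded gradient both tend to 0, the gradient of their product tends to 0 by
  the product rule.
\<close>

lemma boundary_data_tame_product:
  assumes f: "tame f" and g: "tame g"
    and f0: "\<And>p. p \<in> tet v - tet_int v \<Longrightarrow> (f \<longlongrightarrow> 0) (at p within tet_int v)"
    and g0: "\<And>p. p \<in> S \<Longrightarrow> (g \<longlongrightarrow> 0) (at p within tet_int v)"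
    and S: "S \<subseteq> tet v - tet_int v"
  shows "boundary_data S (restrict_to (tet_int v) (\<lambda>x. f x * g x)) (\<lambda>_. 0) (\<lambda>_. 0)"
proof -
  obtain C where C: "\<forall>x\<in>tet_int v. \<bar>f x\<bar> \<le> C \<and> (\<exists>E. GDERIV f x :> E \<and> norm E \<le> C)"
    using f unfolding tame_def by blast
  then obtain F where F: "\<And>x. x \<in> tet_int v \<Longrightarrow> GDERIV f x :> F x \<and> norm (F x) \<le> C"
    by metis
  obtain D where D: "\<forall>x\<in>tet_int v. \<bar>g x\<bar> \<le> D \<and> (\<exists>E. GDERIV g x :> E \<and> norm E \<le> D)"
    using g unfolding tame_def by blast
  then obtain G where G: "\<And>x. x \<in> tet_int v \<Longrightarrow> GDERIV g x :> G x \<and> norm (G x) \<le> D"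
    by metis
  show ?thesis
  proof (rule boundary_dataI)
    show "GDERIV (\<lambda>x. f x * g x) x :> f x *\<^sub>R G x + g x *\<^sub>R F x" if "x \<in> tet_int v" for x
      using F G that by (blast intro: GDERIV_mult)
  next
    fix p assume p: "p \<in> tet v - tet_int v"
    show "((\<lambda>x. f x * g x) \<longlongrightarrow> 0) (at p within tet_int v)"
    proof (rule Lim_null_comparison)
      show "\<forall>\<^sub>F x in at p within tet_int v. norm (f x * g x) \<le> \<bar>f x\<bar> * D"
        using eventually_in_tet_int
        by (rule eventually_mono) (use D in \<open>auto simp: abs_mult intro!: mult_left_mono\<close>)
      show "((\<lambda>x. \<bar>f x\<bar> * D) \<longlongrightarrow> 0) (at p within tet_int v)"
        using tendsto_mult_right[OF tendsto_rabs[OF f0[OF p]], of D] by simp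
    qed
  next
    fix p assume p: "p \<in> S"
    show "((\<lambda>x. f x *\<^sub>R G x + g x *\<^sub>R F x) \<longlongrightarrow> 0) (at p within tet_int v)"
    proof (rule Lim_null_comparison)
      show "\<forall>\<^sub>F x in at p within tet_int v. norm (f x *\<^sub>R G x + g x *\<^sub>R F x) \<le> \<bar>f x\<bar> * D + \<bar>g x\<bar> * C"
        using eventually_in_tet_int
        by (rule eventually_mono) (use F G in \<open>auto intro!: norm_triangle_le add_mono mult_left_mono\<close>)
      have "p \<in> tet v - tet_int v" using p S by blast
      then show "((\<lambda>x. \<bar>f x\<bar> * D + \<bar>g x\<bar> * C) \<longlongrightarrow> 0) (at p within tet_int v)"
        using tendsto_add[OF tendsto_mult_right[OF tendsto_rabs[OF f0], of p D]
          tendsto_mult_right[OF tendsto_rabs[OF g0[OF p]], of C]] by simp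
    qed
  qed
qed

end

section \<open>The normal lifts\<close>

lemma face_edges_iff:
  assumes "i \<in> II"
  shows "(l, m, n) \<in> face_edges i \<longleftrightarrow>
    l \<in> II \<and> m \<in> II \<and> n \<in> II \<and> l < m \<and> n \<noteq> l \<and> n \<noteq> m \<and> i \<noteq> l \<and> i \<noteq> m \<and> i \<noteq> n" (is "?L \<longleftrightarrow> ?R")
proof -
  have card: "card II = 4" by (simp add: II_def)
  have *: "{i, l, m, n} = II \<longleftrightarrow> {i, l, m, n} \<subseteq> II \<and> card {i, l, m, n} = 4"
    using card card_subset_eq[OF finite_II, of "{i, l, m, n}"] by auto
  have "card {i, l, m, n} = 4 \<longleftrightarrow> l \<noteq> m \<and> n \<noteq> l \<and> n \<noteq> m \<and> i \<noteq> l \<and> i \<noteq> m \<and> i \<noteq> n"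
    by (auto simp: card_insert_if)
  then show ?thesis
    unfolding face_edges_def using * assms by auto
qed

lemma Phi_index_iff:
  assumes "i \<in> II"
  shows "(l, m, n, k) \<in> Phi_index i \<longleftrightarrow> (l, m, n) \<in> face_edges i \<and> k \<in> {l, m, n}"
  by (simp add: Phi_index_def)

lemma JJ_sorted:
  assumes "i \<in> II"
  obtains a b c where "a < b" "b < c" "JJ i = {a, b, c}"
proof -
  have J: "JJ 0 = {1, 2, 3}" "JJ 1 = {0, 2, 3}" "JJ 2 = {0, 1, 3}" "JJ 3 = {0, 1, 2}"
    by (simp_all add: JJ_def II_def insert_Diff_if)
  from assms consider "i = 0" | "i = 1" | "i = 2" | "i = 3" by (auto simp: II_def)
  then show ?thesis
  proof cases
    case 1 show ?thesis by (rule that[of 1 2 3]) (use 1 J in simp_all)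
  next
    case 2 show ?thesis by (rule that[of 0 2 3]) (use 2 J in simp_all)
  next
    case 3 show ?thesis by (rule that[of 0 1 3]) (use 3 J in simp_all)
  next
    case 4 show ?thesis by (rule that[of 0 1 2]) (use 4 J in simp_all)
  qed
qed

lemma face_edges_eq:
  assumes "i \<in> II" "a < b" "b < c" "JJ i = {a, b, c}"
  shows "face_edges i = {(a, b, c), (a, c, b), (b, c, a)}"
proof (intro equalityI subsetI)
  have J: "j \<in> {a, b, c} \<longleftrightarrow> j \<in> II \<and> j \<noteq> i" for j
    unfolding assms(4)[symmetric] by (simp add: JJ_def)
  fix t
  {
    assume "t \<in> face_edges i"
    moreover obtain l m n where t: "t = (l, m, n)" by (cases t)
    ultimately have "l \<in> {a, b, c}" "m \<in> {a, b, c}" "n \<in> {a, b, c}" "l < m" "n \<noteq> l" "n \<noteq> m"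
      unfolding J by (simp_all add: face_edges_iff[OF assms(1)])
    then show "t \<in> {(a, b, c), (a, c, b), (b, c, a)}"
      unfolding t using assms(2,3) by (elim insertE emptyE) simp_all
  }
  have "a \<in> II" "b \<in> II" "c \<in> II" "a \<noteq> i" "b \<noteq> i" "c \<noteq> i"
    using J by blast+
  then show "t \<in> face_edges i" if "t \<in> {(a, b, c), (a, c, b), (b, c, a)}"
    using that assms(2,3) by (elim insertE emptyE) (simp_all add: face_edges_iff[OF assms(1)])
qed

lemma Phi_index_eq:
  assumes "i \<in> II" "a < b" "b < c" "JJ i = {a, b, c}"
  shows "Phi_index i = {(a, b, c, a), (a, b, c, b), (a, b, c, c), (a, c, b, a), (a, c, b, c), (a, c, b, b),
    (b, c, a, b), (b, c, a, c), (b, c, a, a)}"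
  unfolding Phi_index_def face_edges_eq[OF assms] by auto

lemma finite_Phi_index: "i \<in> II \<Longrightarrow> finite (Phi_index i)"
proof -
  assume i: "i \<in> II"
  then obtain a b c where "a < b" "b < c" "JJ i = {a, b, c}" by (rule JJ_sorted)
  then show ?thesis by (simp add: Phi_index_eq[OF i])
qed

text \<open>
  The singular traces are homogeneous of degree 2, like quadratic forms. Hence a relation between them
  on the triangle x + y + z = 1 persists on the positive octant.
\<close>

lemma dE_homogeneous:
  fixes n l m s :: real
  assumes "s \<noteq> 0"
  shows "dE_end (n / s) (l / s) (m / s) = dE_end n l m / s\<^sup>2" "dE_apex (n / s) (l / s) (m / s) = dE_apex n l m / s\<^sup>2"
proof -
  have sum: "a / s + b / s = (a + b) / s" "2 * (a / s) = (2 * a) / s" for a b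
    by (simp_all add: add_divide_distrib)
  have hom: "(X / (s * s * s\<^sup>2 * s)) / (D / (s\<^sup>2 * s)) = X / D / s\<^sup>2" for X D
    using assms by (simp add: power2_eq_square)
  show "dE_end (n / s) (l / s) (m / s) = dE_end n l m / s\<^sup>2"
    unfolding sum power_divide times_divide_times_eq hom ..
  have diff: "a / (s * s) - b / s\<^sup>2 = (a - b) / s\<^sup>2" for a b
    by (simp add: diff_divide_distrib power2_eq_square)
  have apex: "(X / (s\<^sup>2 * s\<^sup>2 * s\<^sup>2)) / (D / (s\<^sup>2 * s\<^sup>2)) - Y / (s * s) = (X / D - Y) / s\<^sup>2" for X D Y
    using assms by (simp add: diff_divide_distrib power2_eq_square)
  show "dE_apex (n / s) (l / s) (m / s) = dE_apex n l m / s\<^sup>2"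
    unfolding sum power_divide times_divide_times_eq diff apex ..
qed

context tetrahedron
begin

lemma tame_cong:
  assumes "tame f" "\<And>x. x \<in> tet_int v \<Longrightarrow> f x = g x"
  shows "tame g"
proof -
  have der: "GDERIV g x :> D" if "GDERIV f x :> D" "x \<in> tet_int v" for x D
    using that(1) unfolding gderiv_def
    by (rule has_derivative_transform_within_open[OF _ open_interior that(2) assms(2)])
  obtain C where C: "\<forall>x\<in>tet_int v. \<bar>f x\<bar> \<le> C \<and> (\<exists>D. GDERIV f x :> D \<and> norm D \<le> C)"
    using assms(1) unfolding tame_def by blast
  show ?thesis
    unfolding tame_def
  proof (intro exI[of _ C] ballI conjI)
    fix x assume x: "x \<in> tet_int v"
    show "\<bar>g x\<bar> \<le> C"
      using C x unfolding assms(2)[OF x, symmetric] by blast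
    show "\<exists>D. GDERIV g x :> D \<and> norm D \<le> C"
      using C x der by blast
  qed
qed

text \<open>
  These are the building blocks of degree 1 from which the functions \<open>Phi\<close> are composed; in each of
  them every quotient is multiplied by a function that is bounded by its denominator.
\<close>

lemma tame_ratio_bary:
  assumes "a \<in> II" "b \<in> II"
  shows "tame (\<lambda>x. bary v a x * (bary v b x / (bary v b x + bary v a x)))" (is "tame ?f")
    and "tame (\<lambda>x. bary v a x * (bary v b x / (bary v b x + bary v a x)) * (bary v b x / (bary v b x + bary v a x)))"
    and "tame (\<lambda>x. bary v a x * (bary v b x / (bary v b x + bary v a x)) * (bary v a x / (bary v a x + bary v b x)))"
    and "tame (\<lambda>x. bary v b x * (bary v b x / (bary v b x + bary v a x)))" (is "tame ?g")
    and "tame (\<lambda>x. bary v b x * (bary v b x / (bary v b x + bary v a x)) * (bary v b x / (bary v b x + bary v a x)))"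
proof -
  have pos: "0 < bary v a x" "0 < bary v b x" if "x \<in> tet_int v" for x
    using that assms by (auto simp: mem_tet_int_iff)
  have r: "0 \<le> bary v b x / (bary v b x + bary v a x) \<and> bary v b x / (bary v b x + bary v a x) \<le> 1"
    if "x \<in> tet_int v" for x
    using pos[OF that] by auto
  have f: "\<bar>?f x\<bar> \<le> bary v a x" "\<bar>?g x\<bar> \<le> bary v b x" if "x \<in> tet_int v" for x
  proof -
    have le: "\<bar>c * t\<bar> \<le> c" if "0 < c" "0 \<le> t \<and> t \<le> 1" for c t :: real
      using that by (simp add: abs_mult mult_left_le)
    show "\<bar>?f x\<bar> \<le> bary v a x" "\<bar>?g x\<bar> \<le> bary v b x"
      by (rule le[OF pos(1)[OF that] r[OF that]] le[OF pos(2)[OF that] r[OF that]])+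
  qed
  have b0: "\<bar>bary v a x\<bar> \<le> bary v b x + bary v a x" "\<bar>bary v b x\<bar> \<le> bary v b x + bary v a x"
    if "x \<in> tet_int v" for x
    using pos[OF that] by auto
  have b1: "\<bar>?f x\<bar> \<le> bary v b x + bary v a x" "\<bar>?f x\<bar> \<le> bary v a x + bary v b x"
    "\<bar>?g x\<bar> \<le> bary v b x + bary v a x" if "x \<in> tet_int v" for x
  proof -
    have le: "bary v a x \<le> bary v b x + bary v a x" "bary v a x \<le> bary v a x + bary v b x"
      "bary v b x \<le> bary v b x + bary v a x"
      using pos[OF that] by auto
    show "\<bar>?f x\<bar> \<le> bary v b x + bary v a x" "\<bar>?f x\<bar> \<le> bary v a x + bary v b x"
      "\<bar>?g x\<bar> \<le> bary v b x + bary v a x"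
      by (rule order_trans[OF f(1)[OF that] le(1)] order_trans[OF f(1)[OF that] le(2)]
        order_trans[OF f(2)[OF that] le(3)])+
  qed
  show 1: "tame ?f" and 2: "tame ?g"
    by (rule tame_ratio[OF tame_bary b0(1)], (assumption | rule assms)+)
       (rule tame_ratio[OF tame_bary b0(2)], (assumption | rule assms)+)
  show "tame (\<lambda>x. ?f x * (bary v b x / (bary v b x + bary v a x)))"
    by (rule tame_ratio[OF 1 b1(1)], (assumption | rule assms)+)
  show "tame (\<lambda>x. ?f x * (bary v a x / (bary v a x + bary v b x)))"
    by (rule tame_ratio[OF 1 b1(2)], (assumption | rule assms)+)
  show "tame (\<lambda>x. ?g x * (bary v b x / (bary v b x + bary v a x)))"
    by (rule tame_ratio[OF 2 b1(3)], (assumption | rule assms)+)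
qed

text \<open>
  With r = l / (l + n) and s = m / (m + n), the end derivative is \<open>m s (n r + n r (n / (n + l)))\<close> and the
  apex derivative is \<open>(l r\<^sup>2) (m s\<^sup>2) - (n r\<^sup>2) (n s\<^sup>2) - l m\<close>.
\<close>

lemma tame_Phi:
  assumes "l \<in> II" "m \<in> II" "n \<in> II" "l \<noteq> m" "l \<noteq> n" "m \<noteq> n" "k \<in> {l, m, n}"
  shows "tame (\<lambda>x. Phi l m n k (\<lambda>j. bary v j x))"
proof -
  have e: "tame (\<lambda>x. dE_end (bary v n x) (bary v a x) (bary v b x))" if "a \<in> II" "b \<in> II" for a b
  proof (rule tame_cong)
    show "tame (\<lambda>x. bary v b x * (bary v b x / (bary v b x + bary v n x)) *
      (bary v n x * (bary v a x / (bary v a x + bary v n x)) +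
       bary v n x * (bary v a x / (bary v a x + bary v n x)) * (bary v n x / (bary v n x + bary v a x))))"
      by (intro tame_mult tame_add tame_ratio_bary that assms)
    fix x assume "x \<in> tet_int v"
    then have "0 < bary v a x + bary v n x"
      using that assms by (auto simp: mem_tet_int_iff add_pos_pos)
    then have nz: "bary v a x + bary v n x \<noteq> 0" by linarith
    have "B * (B / (B + N)) * (N * (A / (A + N)) + N * (A / (A + N)) * (N / (N + A))) = dE_end N A B"
      if "A + N \<noteq> 0" for N A B :: real
    proof -
      have "N * (A / S) + N * (A / S) * (N / S) = N * A * (S + N) / S\<^sup>2" if "S \<noteq> 0" for S
        using that by (simp add: field_simps power2_eq_square)
      from this[OF that] have "N * (A / (A + N)) + N * (A / (A + N)) * (N / (N + A)) = N * A * (2 * N + A) / (A + N)\<^sup>2"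
        by (simp add: ac_simps)
      then show ?thesis
        by (simp add: power2_eq_square ac_simps)
    qed
    from this[OF nz] show "bary v b x * (bary v b x / (bary v b x + bary v n x)) *
      (bary v n x * (bary v a x / (bary v a x + bary v n x)) +
       bary v n x * (bary v a x / (bary v a x + bary v n x)) * (bary v n x / (bary v n x + bary v a x))) =
      dE_end (bary v n x) (bary v a x) (bary v b x)" .
  qed
  have "tame (\<lambda>x. bary v l x * (bary v l x / (bary v l x + bary v n x)) * (bary v l x / (bary v l x + bary v n x)) *
       (bary v m x * (bary v m x / (bary v m x + bary v n x)) * (bary v m x / (bary v m x + bary v n x))) -
       bary v n x * (bary v l x / (bary v l x + bary v n x)) * (bary v l x / (bary v l x + bary v n x)) *
       (bary v n x * (bary v m x / (bary v m x + bary v n x)) * (bary v m x / (bary v m x + bary v n x))) -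
       bary v l x * bary v m x)"
    by (intro tame_mult tame_diff tame_ratio_bary tame_bary assms)
  moreover have "l * (l / (l + n)) * (l / (l + n)) * (m * (m / (m + n)) * (m / (m + n))) -
      n * (l / (l + n)) * (l / (l + n)) * (n * (m / (m + n)) * (m / (m + n))) - l * m = dE_apex n l m"
    for n l m :: real
  proof -
    have "l * r * r * (m * s * s) - n * r * r * (n * s * s) = (r * s)\<^sup>2 * (l * m - n\<^sup>2)" for r s
      by algebra
    then have "l * (l / (l + n)) * (l / (l + n)) * (m * (m / (m + n)) * (m / (m + n))) -
        n * (l / (l + n)) * (l / (l + n)) * (n * (m / (m + n)) * (m / (m + n))) =
        (l / (l + n) * (m / (m + n)))\<^sup>2 * (l * m - n\<^sup>2)"
      by blast
    moreover have "l\<^sup>2 * m\<^sup>2 * X / ((n + l)\<^sup>2 * (n + m)\<^sup>2) = (l / (l + n) * (m / (m + n)))\<^sup>2 * X" for X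
      by (simp add: power_mult_distrib power_divide add.commute)
    ultimately show ?thesis
      by (simp only:)
  qed
  ultimately have a: "tame (\<lambda>x. dE_apex (bary v n x) (bary v l x) (bary v m x))"
    by simp
  from assms(7) consider "k = l" | "k = m" | "k = n" by blast
  then show ?thesis
    using a e[OF assms(1,2)] e[OF assms(2,1)] assms by cases (simp_all only: Phi_eq simp_thms)
qed

text \<open>
  The weight \<open>bary v i * Theta v i\<close> is the case K = \<open>JJ i\<close>. It is bounded by each of the four barycentric
  coordinates, since the product of two of them divided by their sum is at most either of the two, and
  therefore it tends to 0 at every boundary point.
\<close>

lemma lift_weight_tame:
  assumes i: "i \<in> II" and K: "K \<subseteq> II"
  shows "tame (\<lambda>x. bary v i x * (\<Prod>j\<in>K. bary v j x / (bary v i x + bary v j x))) \<and>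
    (\<forall>x\<in>tet_int v. 0 \<le> bary v i x * (\<Prod>j\<in>K. bary v j x / (bary v i x + bary v j x)) \<and>
      (\<forall>j\<in>insert i K. bary v i x * (\<Prod>j\<in>K. bary v j x / (bary v i x + bary v j x)) \<le> bary v j x))"
  using finite_subset[OF K finite_II] K
proof (induction K rule: finite_induct)
  case empty
  then show ?case using i by (auto simp: tame_bary mem_tet_int_iff less_imp_le)
next
  case (insert k K)
  let ?f = "\<lambda>x. bary v i x * (\<Prod>j\<in>K. bary v j x / (bary v i x + bary v j x))"
  have IH: "tame ?f" "\<And>x. x \<in> tet_int v \<Longrightarrow> 0 \<le> ?f x"
    "\<And>x j. x \<in> tet_int v \<Longrightarrow> j \<in> insert i K \<Longrightarrow> ?f x \<le> bary v j x"
    using insert by blast+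
  have k: "k \<in> II" using insert by simp
  have eq: "bary v i x * (\<Prod>j\<in>insert k K. bary v j x / (bary v i x + bary v j x)) =
      ?f x * (bary v k x / (bary v k x + bary v i x))" for x
    using insert.hyps by (simp add: mult.commute add.commute)
  have pos: "0 < bary v i x" "0 < bary v k x" if "x \<in> tet_int v" for x
    using that i k by (auto simp: mem_tet_int_iff)
  have "tame (\<lambda>x. ?f x * (bary v k x / (bary v k x + bary v i x)))"
  proof (rule tame_ratio[OF IH(1) _ k i])
    fix x assume x: "x \<in> tet_int v"
    show "\<bar>?f x\<bar> \<le> bary v k x + bary v i x"
      using IH(2)[OF x] IH(3)[OF x insertI1] pos[OF x] by linarith
  qed
  moreover have "0 \<le> ?f x * (bary v k x / (bary v k x + bary v i x)) \<and>
      (\<forall>j\<in>insert i (insert k K). ?f x * (bary v k x / (bary v k x + bary v i x)) \<le> bary v j x)"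
    if x: "x \<in> tet_int v" for x
  proof -
    define F where "F = ?f x"
    define r where "r = bary v k x / (bary v k x + bary v i x)"
    have r: "0 \<le> r" "r \<le> 1" using pos[OF x] by (auto simp: r_def)
    have F: "0 \<le> F" "\<And>j. j \<in> insert i K \<Longrightarrow> F \<le> bary v j x"
      using IH(2,3) x by (auto simp: F_def)
    have le: "F * r \<le> F" using r F(1) by (simp add: mult_left_le)
    have "F * r \<le> bary v i x * r"
      using F(2)[of i] r by (intro mult_right_mono) auto
    also have "\<dots> \<le> bary v k x"
      using pos[OF x] by (simp add: r_def field_simps)
    finally have "F * r \<le> bary v k x" .
    moreover have "F * r \<le> bary v j x" if "j \<in> insert i K" for j
      using le F(2)[OF that] by linarith
    ultimately show ?thesis
      unfolding F_def[symmetric] r_def[symmetric] using F(1) r by auto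
  qed
  ultimately show ?case
    unfolding eq by blast
qed

text \<open>
  The union of the edges of T, given by the vanishing of two barycentric coordinates.
\<close>

definition skeleton :: "(real ^ 3) set" where
  "skeleton = {p \<in> tet v. \<exists>i\<in>II. \<exists>j\<in>II. i \<noteq> j \<and> bary v i p = 0 \<and> bary v j p = 0}"

lemma skeleton_subset: "skeleton \<subseteq> tet v - tet_int v"
proof
  fix p assume "p \<in> skeleton"
  then obtain j where "p \<in> tet v" "j \<in> II" "bary v j p = 0"
    unfolding skeleton_def by blast
  moreover from this have "\<not> 0 < bary v j p" by simp
  ultimately show "p \<in> tet v - tet_int v"
    unfolding Diff_iff mem_tet_int_iff by blast
qed

text \<open>
  The normal lift of one singular trace, without the factor \<open>1 / dcoef v i i\<close>.
\<close>

definition Phi_lift :: "nat \<Rightarrow> nat \<times> nat \<times> nat \<times> nat \<Rightarrow> real ^ 3 \<Rightarrow> real" where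
  "Phi_lift i = (\<lambda>(l, m, n, k). restrict_to (tet_int v)
     (\<lambda>x. bary v i x * Theta v i x * Phi l m n k (\<lambda>j. bary v j x)))"

text \<open>
  A skeleton point has two vanishing coordinates, and one of them belongs to the face i, so \<open>Phi\<close> tends
  to 0 there, and so does the weight.
\<close>

lemma Phi_lift_data:
  assumes i: "i \<in> II" and "\<kappa> \<in> Phi_index i"
  shows "boundary_data skeleton (Phi_lift i \<kappa>) (\<lambda>_. 0) (\<lambda>_. 0)"
proof -
  obtain l m n k where \<kappa>: "\<kappa> = (l, m, n, k)" by (cases \<kappa>)
  have ed: "l \<in> II" "m \<in> II" "n \<in> II" "l \<noteq> m" "l \<noteq> n" "m \<noteq> n" "i \<noteq> l" "i \<noteq> m" "i \<noteq> n" "k \<in> {l, m, n}"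
    using assms by (auto simp: \<kappa> Phi_index_iff face_edges_iff)
  have II: "II = {i, l, m, n}"
    using assms(2) by (auto simp: \<kappa> Phi_index_def face_edges_def)
  have J: "JJ i \<subseteq> II" "insert i (JJ i) = II" using i by (auto simp: JJ_def)
  note w = lift_weight_tame[OF i J(1), folded Theta_def, unfolded J(2)]
  show ?thesis
    unfolding Phi_lift_def \<kappa> prod.case
  proof (rule boundary_data_tame_product)
    show "tame (\<lambda>x. bary v i x * Theta v i x)"
      using w by blast
    show "tame (\<lambda>x. Phi l m n k (\<lambda>j. bary v j x))"
      using tame_Phi ed by blast
    show "skeleton \<subseteq> tet v - tet_int v"
      by (rule skeleton_subset)
  next
    fix p assume "p \<in> tet v - tet_int v"
    then obtain j where j: "j \<in> II" "bary v j p = 0" by (rule boundary_zero_coordinate)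
    show "((\<lambda>x. bary v i x * Theta v i x) \<longlongrightarrow> 0) (at p within tet_int v)"
    proof (rule tendsto_squeeze_bary[OF j, where C = 1])
      fix x assume "x \<in> tet_int v"
      then have "0 \<le> bary v i x * Theta v i x" "bary v i x * Theta v i x \<le> bary v j x"
        using w j(1) by blast+
      then show "\<bar>bary v i x * Theta v i x\<bar> \<le> 1 * bary v j x"
        by (simp only: abs_of_nonneg mult_1_left)
    qed
  next
    fix p assume p: "p \<in> skeleton"
    then obtain r where "r \<in> II" "r \<noteq> i" "bary v r p = 0"
      unfolding skeleton_def by blast
    then have "r \<in> {l, m, n}"
      using II by blast
    then have "bary v l p = 0 \<or> bary v m p = 0 \<or> bary v n p = 0"
      using \<open>bary v r p = 0\<close> by blast
    then have "Phi l m n k (\<lambda>j. bary v j p) = 0"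
      using ed by (intro Phi_vanish) auto
    moreover have "p \<in> tet v"
      using p by (simp add: skeleton_def)
    ultimately show "((\<lambda>x. Phi l m n k (\<lambda>j. bary v j x)) \<longlongrightarrow> 0) (at p within tet_int v)"
      using tendsto_Phi[OF _ ed(1-6) ed(10), of p] by simp
  qed
qed

end

section \<open>Quadratic polynomials in barycentric coordinates\<close>

lemma span_image_sum:
  assumes "finite K" "x \<in> span (f ` K)"
  shows "\<exists>c. x = (\<Sum>s\<in>K. c s *\<^sub>R f s)"
  using assms(2)
proof (induction rule: span_induct_alt)
  case base
  show ?case by (rule exI[of _ "\<lambda>_. 0"]) simp
next
  case (step c y z)
  then obtain s d where s: "s \<in> K" "y = f s" and z: "z = (\<Sum>s\<in>K. d s *\<^sub>R f s)"
    by blast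
  have "(\<Sum>r\<in>K. (if r = s then c else 0) *\<^sub>R f r) = c *\<^sub>R f s"
  proof -
    have "(\<Sum>r\<in>K. (if r = s then c else 0) *\<^sub>R f r) = (\<Sum>r\<in>K. if r = s then c *\<^sub>R f r else 0)"
      by (rule sum.cong) simp_all
    then show ?thesis using s(1) assms(1) by simp
  qed
  then have "c *\<^sub>R y + z = (\<Sum>r\<in>K. ((if r = s then c else 0) + d r) *\<^sub>R f r)"
    unfolding scaleR_add_left sum.distrib s(2) z by (simp only:)
  then show ?case by (intro exI[of _ "\<lambda>r. (if r = s then c else 0) + d r"])
qed

lemma restrict_to_add: "restrict_to S (\<lambda>x. f x + g x) = restrict_to S f + restrict_to S g"
  and restrict_to_scaleR: "restrict_to S (\<lambda>x. c * f x) = c *\<^sub>R restrict_to S f"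
  by (auto simp: restrict_to_def scaleR_fun_def fun_eq_iff)

lemma subspace_restrict_to:
  assumes "subspace A"
  shows "subspace (restrict_to S ` A)"
proof (rule subspaceI)
  show "0 \<in> restrict_to S ` A"
    using subspace_0[OF assms] by (force simp: restrict_to_def zero_fun_def intro: image_eqI)
  fix f g assume "f \<in> restrict_to S ` A" "g \<in> restrict_to S ` A"
  then obtain f' g' where fg: "f = restrict_to S f'" "g = restrict_to S g'" and "f' \<in> A" "g' \<in> A" by blast
  then have "(\<lambda>x. f' x + g' x) \<in> A"
    using subspace_add[OF assms, of f' g'] by (simp add: plus_fun_def)
  then show "f + g \<in> restrict_to S ` A"
    unfolding fg restrict_to_add[symmetric] by (rule imageI)
next
  fix c f assume "f \<in> restrict_to S ` A"
  then obtain f' where f: "f = restrict_to S f'" and "f' \<in> A" by blast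
  then have "(\<lambda>x. c * f' x) \<in> A"
    using subspace_scale[OF assms, of f' c] by (simp add: scaleR_fun_def)
  then show "c *\<^sub>R f \<in> restrict_to S ` A"
    unfolding f restrict_to_scaleR[symmetric] by (rule imageI)
qed

lemma subspace_set_plus:
  assumes "subspace A" "subspace B"
  shows "subspace (A + B)"
proof -
  have "A + B = {x + y |x y. x \<in> A \<and> y \<in> B}"
    by (auto simp: set_plus_def)
  then show ?thesis using subspace_sums[OF assms] by (simp only:)
qed

text \<open>
  The constant 1 and the Cartesian coordinates, enumerated by the same index set as the barycentric
  coordinates. Both families span the affine functions, and the quadratic polynomials are spanned by
  the products of two members of either family.
\<close>

definition affine_coord :: "nat \<Rightarrow> real ^ 3 \<Rightarrow> real" where
  "affine_coord s x = (if s = 0 then 1 else x $ (of_nat s))"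

lemma affine_coord_simps: "affine_coord 0 x = 1" "affine_coord (Suc 0) x = x $ 1" "affine_coord 2 x = x $ 2"
  "affine_coord 3 x = x $ 3"
  by (simp_all add: affine_coord_def)

lemma affine_coord_product_in_polys:
  assumes "s \<in> II" "t \<in> II"
  shows "(\<lambda>x. affine_coord s x * affine_coord t x) \<in> polys 2"
proof -
  define a b c :: nat where "a = of_bool (s = 1) + of_bool (t = 1)" and "b = of_bool (s = 2) + of_bool (t = 2)"
    and "c = of_bool (s = 3) + of_bool (t = 3)"
  have "a + b + c \<le> 2" by (auto simp: a_def b_def c_def)
  moreover have "(\<lambda>x. affine_coord s x * affine_coord t x) = (\<lambda>x. x $ 1 ^ a * x $ 2 ^ b * x $ 3 ^ c)"
    using assms by (auto simp: II_def a_def b_def c_def affine_coord_simps fun_eq_iff)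
  ultimately show ?thesis
    unfolding polys_def by (intro span_base) blast
qed

lemma monomial_eq_affine_coord_product:
  assumes "a + b + c \<le> (2::nat)"
  shows "\<exists>s\<in>II. \<exists>t\<in>II. \<forall>x :: real ^ 3. x $ 1 ^ a * x $ 2 ^ b * x $ 3 ^ c = affine_coord s x * affine_coord t x"
proof -
  have "a = 0 \<or> a = 1 \<or> a = 2" "b = 0 \<or> b = 1 \<or> b = 2" "c = 0 \<or> c = 1 \<or> c = 2"
    using assms by auto
  then show ?thesis
    using assms by (elim disjE) (simp_all add: II_def affine_coord_simps power2_eq_square)
qed

context tetrahedron
begin

lemma bary_eq_affine_coords:
  assumes "j \<in> II"
  shows "\<exists>d. \<forall>x. bary v j x = (\<Sum>s\<in>II. d s * affine_coord s x)"
proof (intro exI allI)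
  fix x
  show "bary v j x = (\<Sum>s\<in>II. (if s = 0 then bary v j 0 else bgrad j $ of_nat s) * affine_coord s x)"
    using bary_affine[OF assms, of x]
    by (simp add: sum_II affine_coord_simps inner_vec_def sum_3)
qed

lemma bary_product_in_polys:
  assumes "i \<in> II" "j \<in> II"
  shows "(\<lambda>x. bary v i x * bary v j x) \<in> polys 2"
proof -
  obtain d e where "\<forall>x. bary v i x = (\<Sum>s\<in>II. d s * affine_coord s x)" "\<forall>x. bary v j x = (\<Sum>s\<in>II. e s * affine_coord s x)"
    using bary_eq_affine_coords assms by meson
  then have "(\<lambda>x. bary v i x * bary v j x) = (\<Sum>s\<in>II. \<Sum>t\<in>II. (d s * e t) *\<^sub>R (\<lambda>x. affine_coord s x * affine_coord t x))"
    by (simp add: fun_eq_iff sum_fun_apply scaleR_fun_apply sum_product ac_simps)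
  also have "\<dots> \<in> polys 2"
    using affine_coord_product_in_polys unfolding polys_def by (intro span_sum span_scale)
  finally show ?thesis .
qed

lemma bary_in_polys:
  assumes "i \<in> II"
  shows "bary v i \<in> polys 2"
proof -
  have "bary v i x = (\<Sum>j\<in>II. bary v i x * bary v j x)" for x
    by (simp add: sum_bary flip: sum_distrib_left)
  then have "bary v i = (\<Sum>j\<in>II. (\<lambda>x. bary v i x * bary v j x))"
    by (simp add: fun_eq_iff sum_fun_apply)
  also have "\<dots> \<in> polys 2"
    using bary_product_in_polys assms unfolding polys_def by (intro span_sum)
  finally show ?thesis .
qed

lemma affine_coord_bary: "affine_coord s x = (\<Sum>j\<in>II. affine_coord s (v j) * bary v j x)"
proof (cases "s = 0")
  case False
  have "x $ of_nat s = (\<Sum>j\<in>II. bary v j x *\<^sub>R v j) $ of_nat s"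
    by (simp add: sum_bary_vertex)
  then show ?thesis using False by (simp add: affine_coord_def mult.commute)
qed (simp add: affine_coord_def sum_bary)

lemma polys_bary_form:
  assumes "p \<in> polys 2"
  shows "\<exists>M. \<forall>x. p x = (\<Sum>j\<in>II. \<Sum>k\<in>II. M j k * (bary v j x * bary v k x))"
  using assms unfolding polys_def
proof (induction rule: span_induct_alt)
  case base
  show ?case by (rule exI[of _ "\<lambda>_ _. 0"]) simp
next
  case (step c y z)
  then obtain a b d M where abd: "a + b + d \<le> 2" "y = (\<lambda>x. x $ 1 ^ a * x $ 2 ^ b * x $ 3 ^ d)"
    and M: "\<forall>x. z x = (\<Sum>j\<in>II. \<Sum>k\<in>II. M j k * (bary v j x * bary v k x))"
    by auto
  obtain s t where st: "\<forall>x. y x = affine_coord s x * affine_coord t x"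
    using monomial_eq_affine_coord_product[OF abd(1)] abd(2) by auto
  have "y x = (\<Sum>j\<in>II. \<Sum>k\<in>II. (affine_coord s (v j) * affine_coord t (v k)) * (bary v j x * bary v k x))" for x
    unfolding st[rule_format] affine_coord_bary[of s x] affine_coord_bary[of t x]
    by (simp add: sum_product ac_simps)
  then have "(c *\<^sub>R y + z) x = (\<Sum>j\<in>II. \<Sum>k\<in>II. (c * (affine_coord s (v j) * affine_coord t (v k)) + M j k) * (bary v j x * bary v k x))" for x
    using M by (simp add: scaleR_fun_apply sum_distrib_left distrib_right sum.distrib mult.assoc)
  then show ?case
    by (intro exI[of _ "\<lambda>j k. c * (affine_coord s (v j) * affine_coord t (v k)) + M j k"] allI)
qed

text \<open>
  The point with barycentric coordinates proportional to x, y, z lies inside the face whenever these are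
  positive, so by homogeneity a relation on the face is a relation between functions of x, y, z.
\<close>

lemma edge_traces_independent_on_face:
  assumes i: "i \<in> II" and p: "p \<in> polys 2"
    and H: "\<And>x. x \<in> face_int v i \<Longrightarrow> (\<Sum>\<kappa>\<in>Phi_index i. c \<kappa> *\<^sub>R Phi_on v (face_int v i) \<kappa>) x = p x"
    and \<kappa>: "\<kappa> \<in> Phi_index i"
  shows "c \<kappa> = 0"
proof -
  obtain a b d where abd: "a < b" "b < d" "JJ i = {a, b, d}"
    using JJ_sorted[OF i] .
  have II: "a \<in> II" "b \<in> II" "d \<in> II" "i \<noteq> a" "i \<noteq> b" "i \<noteq> d" "II = {i, a, b, d}"
    using abd(3) i unfolding JJ_def by blast+
  obtain M where M: "\<And>x. p x = (\<Sum>j\<in>II. \<Sum>k\<in>II. M j k * (bary v j x * bary v k x))"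
    using polys_bary_form[OF p] by blast
  note idx = Phi_index_eq[OF i abd]
  have key: "c (a, b, d, a) * dE_end z x y + c (a, b, d, b) * dE_end z y x + c (a, b, d, d) * dE_apex z x y +
    c (a, d, b, a) * dE_end y x z + c (a, d, b, d) * dE_end y z x + c (a, d, b, b) * dE_apex y x z +
    c (b, d, a, b) * dE_end x y z + c (b, d, a, d) * dE_end x z y + c (b, d, a, a) * dE_apex x y z =
    M a a * x\<^sup>2 + M b b * y\<^sup>2 + M d d * z\<^sup>2 + (M a b + M b a) * (x * y) + (M a d + M d a) * (x * z) + (M b d + M d b) * (y * z)"
    if pos: "0 < x" "0 < y" "0 < z" for x y z :: real
  proof -
    define s where "s = x + y + z"
    have s: "s \<noteq> 0" using pos by (simp add: s_def)
    define u where "u = (\<lambda>j. if j = a then x / s else if j = b then y / s else if j = d then z / s else 0)"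
    define X where "X = (\<Sum>j\<in>II. u j *\<^sub>R v j)"
    have ne: "a \<noteq> b" "a \<noteq> d" "b \<noteq> d" using abd by auto
    have "(\<Sum>j\<in>II. u j) = (x + y + z) / s"
      unfolding II(7) using ne II(4-6) by (simp add: u_def add_divide_distrib)
    then have "(\<Sum>j\<in>II. u j) = 1" using s by (simp add: s_def)
    then have bX: "bary v j X = u j" if "j \<in> II" for j
      using that by (intro bary_eqI) (simp_all add: X_def)
    have b: "bary v a X = x / s" "bary v b X = y / s" "bary v d X = z / s" "bary v i X = 0"
      using bX II(1-6) i ne by (simp_all add: u_def)
    have "0 < s" using pos by (simp add: s_def)
    then have X: "X \<in> face_int v i"
      unfolding mem_face_int_iff[OF i] abd(3) using b pos by simp
    have "(\<Sum>\<kappa>\<in>Phi_index i. c \<kappa> *\<^sub>R Phi_on v (face_int v i) \<kappa>) X =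
      (c (a, b, d, a) * dE_end z x y + c (a, b, d, b) * dE_end z y x + c (a, b, d, d) * dE_apex z x y +
      c (a, d, b, a) * dE_end y x z + c (a, d, b, d) * dE_end y z x + c (a, d, b, b) * dE_apex y x z +
      c (b, d, a, b) * dE_end x y z + c (b, d, a, d) * dE_end x z y + c (b, d, a, a) * dE_apex x y z) / s\<^sup>2"
    proof -
      have vals: "Phi a b d a (\<lambda>j. bary v j X) = dE_end z x y / s\<^sup>2"
        "Phi a b d b (\<lambda>j. bary v j X) = dE_end z y x / s\<^sup>2"
        "Phi a b d d (\<lambda>j. bary v j X) = dE_apex z x y / s\<^sup>2"
        "Phi a d b a (\<lambda>j. bary v j X) = dE_end y x z / s\<^sup>2"
        "Phi a d b d (\<lambda>j. bary v j X) = dE_end y z x / s\<^sup>2"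
        "Phi a d b b (\<lambda>j. bary v j X) = dE_apex y x z / s\<^sup>2"
        "Phi b d a b (\<lambda>j. bary v j X) = dE_end x y z / s\<^sup>2"
        "Phi b d a d (\<lambda>j. bary v j X) = dE_end x z y / s\<^sup>2"
        "Phi b d a a (\<lambda>j. bary v j X) = dE_apex x y z / s\<^sup>2"
        unfolding Phi_eq(1) Phi_eq(2)[OF ne(1)] Phi_eq(2)[OF ne(2)] Phi_eq(2)[OF ne(3)]
          Phi_eq(3)[OF ne(2,3)] Phi_eq(3)[OF ne(1) ne(3)[symmetric]] Phi_eq(3)[OF ne(1)[symmetric] ne(2)[symmetric]]
          b dE_homogeneous[OF s] by (rule refl)+
      have "(\<Sum>\<kappa>\<in>Phi_index i. c \<kappa> *\<^sub>R Phi_on v (face_int v i) \<kappa>) X =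
        (\<Sum>\<kappa>\<in>Phi_index i. c \<kappa> * (case \<kappa> of (l, m, n, k) \<Rightarrow> Phi l m n k (\<lambda>j. bary v j X)))"
        using X by (auto intro!: sum.cong simp: sum_fun_apply scaleR_fun_apply Phi_on_def restrict_to_def)
      also have "\<dots> = c (a, b, d, a) * Phi a b d a (\<lambda>j. bary v j X) + (c (a, b, d, b) * Phi a b d b (\<lambda>j. bary v j X) +
         (c (a, b, d, d) * Phi a b d d (\<lambda>j. bary v j X) +
        (c (a, d, b, a) * Phi a d b a (\<lambda>j. bary v j X) + (c (a, d, b, d) * Phi a d b d (\<lambda>j. bary v j X) +
         (c (a, d, b, b) * Phi a d b b (\<lambda>j. bary v j X) +
        (c (b, d, a, b) * Phi b d a b (\<lambda>j. bary v j X) + (c (b, d, a, d) * Phi b d a d (\<lambda>j. bary v j X) +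
         c (b, d, a, a) * Phi b d a a (\<lambda>j. bary v j X))))))))"
        unfolding idx using ne by simp
      finally show ?thesis
        unfolding vals by (simp only: add_divide_distrib times_divide_eq_right add.assoc)
    qed
    moreover have "p X = (M a a * x\<^sup>2 + M b b * y\<^sup>2 + M d d * z\<^sup>2 + (M a b + M b a) * (x * y) + (M a d + M d a) * (x * z) +
      (M b d + M d b) * (y * z)) / s\<^sup>2"
    proof -
      have "p X = (\<Sum>j\<in>{a, b, d}. \<Sum>k\<in>{a, b, d}. M j k * (bary v j X * bary v k X))"
        unfolding M II(7) using II(4-6) b(4) by simp
      also have "\<dots> = M a a * (x / s * (x / s)) + M a b * (x / s * (y / s)) + M a d * (x / s * (z / s)) +
        M b a * (y / s * (x / s)) + M b b * (y / s * (y / s)) + M b d * (y / s * (z / s)) +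
        M d a * (z / s * (x / s)) + M d b * (z / s * (y / s)) + M d d * (z / s * (z / s))"
        using ne b by simp
      finally show ?thesis
        by (simp add: add_divide_distrib distrib_right distrib_left power2_eq_square ac_simps)
    qed
    ultimately show ?thesis
      using H[OF X] s by simp
  qed
  have "c (a, b, d, a) = 0 \<and> c (a, b, d, b) = 0 \<and> c (a, b, d, d) = 0 \<and> c (a, d, b, a) = 0 \<and> c (a, d, b, d) = 0 \<and>
      c (a, d, b, b) = 0 \<and> c (b, d, a, b) = 0 \<and> c (b, d, a, d) = 0 \<and> c (b, d, a, a) = 0"
    using key by (rule edge_traces_independent)
  then show ?thesis
    using \<kappa> unfolding idx by blast
qed

end

section \<open>A Hermite basis of the edge-enriched space\<close>

lemma GDERIV_cmult: "GDERIV g x :> dg \<Longrightarrow> GDERIV (\<lambda>x. c * g x) x :> c *\<^sub>R dg"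
  using GDERIV_mult[OF GDERIV_const, of g x dg c] by simp

context tetrahedron
begin

text \<open>
  For i = j the function has value 1 at vertex i and vanishes at the other vertices. For distinct i and
  j it vanishes at all vertices, and its gradient is that of coordinate j at vertex i and 0 at the other
  vertices. So the coefficients in this basis are, up to a linear change, the vertex data.
\<close>

definition herm_poly :: "nat \<times> nat \<Rightarrow> real ^ 3 \<Rightarrow> real" where
  "herm_poly = (\<lambda>(i, j) x. if i = j then bary v i x * bary v i x
     else (bary v i x * bary v j x + (bary v i x * bary v i x * bary v j x - bary v i x * (bary v j x * bary v j x))) / 2)"

definition herm_grad :: "nat \<times> nat \<Rightarrow> real ^ 3 \<Rightarrow> real ^ 3" where
  "herm_grad = (\<lambda>(i, j) x. if i = j then (2 * bary v i x) *\<^sub>R bgrad i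
     else ((bary v j x + 2 * (bary v i x * bary v j x) - bary v j x * bary v j x) / 2) *\<^sub>R bgrad i +
          ((bary v i x + bary v i x * bary v i x - 2 * (bary v i x * bary v j x)) / 2) *\<^sub>R bgrad j)"

definition herm :: "nat \<times> nat \<Rightarrow> real ^ 3 \<Rightarrow> real" where
  "herm s = restrict_to (tet_int v) (herm_poly s)"

definition bubble_val :: "nat \<times> nat \<times> nat \<Rightarrow> real ^ 3 \<Rightarrow> real" where
  "bubble_val = (\<lambda>(l, m, n) p.
     bary v n p * (bary v l p)\<^sup>2 * (bary v m p)\<^sup>2 / ((bary v n p + bary v l p) * (bary v n p + bary v m p)))"

definition bubble_grad :: "nat \<times> nat \<times> nat \<Rightarrow> real ^ 3 \<Rightarrow> real ^ 3" where
  "bubble_grad = (\<lambda>(l, m, n) p. Phi l m n l (\<lambda>j. bary v j p) *\<^sub>R bgrad l + Phi l m n m (\<lambda>j. bary v j p) *\<^sub>R bgrad m +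
      (Phi l m n n (\<lambda>j. bary v j p) + bary v l p * bary v m p) *\<^sub>R bgrad n)"

definition bubble :: "nat \<times> nat \<times> nat \<Rightarrow> real ^ 3 \<Rightarrow> real" where
  "bubble = (\<lambda>(l, m, n). edge_bubble v l m n)"

definition bubble_index :: "(nat \<times> nat \<times> nat) set" where
  "bubble_index = {(l, m, n). l < m \<and> m \<le> 3 \<and> n \<in> II - {l, m}}"

lemma mem_II_iff: "j \<in> II \<longleftrightarrow> j \<le> 3"
  by (auto simp: II_def)

lemma bubble_indexD:
  assumes "(l, m, n) \<in> bubble_index"
  shows "l \<in> II" "m \<in> II" "n \<in> II" "l \<noteq> m" "l \<noteq> n" "m \<noteq> n" "l < m"
  using assms by (auto simp: bubble_index_def mem_II_iff)

lemma finite_bubble_index: "finite bubble_index"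
  by (rule finite_subset[of _ "II \<times> II \<times> II"]) (auto dest: bubble_indexD)

lemma herm_data:
  assumes "s \<in> II \<times> II"
  shows "boundary_data S (herm s) (herm_poly s) (herm_grad s)"
proof -
  obtain i j where s: "s = (i, j)" and ij: "i \<in> II" "j \<in> II" using assms by auto
  note der = GDERIV_bary[OF ij(1)] GDERIV_bary[OF ij(2)]
  show ?thesis
    unfolding herm_def
  proof (rule boundary_data_smooth)
    fix x
    let ?a = "bary v i x" and ?b = "bary v j x"
    show "GDERIV (herm_poly s) x :> herm_grad s x"
    proof (cases "i = j")
      case True
      then have "herm_poly s = (\<lambda>x. bary v i x * bary v i x)" "herm_grad s x = ?a *\<^sub>R bgrad i + ?a *\<^sub>R bgrad i"
        by (simp_all add: s herm_poly_def herm_grad_def scaleR_add_left[symmetric])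
      then show ?thesis
        using GDERIV_mult[OF der(1) der(1)] by (simp only:)
    next
      case False
      let ?D = "(?a *\<^sub>R bgrad j + ?b *\<^sub>R bgrad i) +
         (((?a * ?a) *\<^sub>R bgrad j + ?b *\<^sub>R (?a *\<^sub>R bgrad i + ?a *\<^sub>R bgrad i)) -
          (?a *\<^sub>R (?b *\<^sub>R bgrad j + ?b *\<^sub>R bgrad j) + (?b * ?b) *\<^sub>R bgrad i))"
      have "GDERIV (\<lambda>x. bary v i x * bary v j x + (bary v i x * bary v i x * bary v j x - bary v i x * (bary v j x * bary v j x))) x :> ?D"
        by (intro GDERIV_add GDERIV_diff GDERIV_mult der)
      then have "GDERIV (\<lambda>x. (1 / 2) * (bary v i x * bary v j x + (bary v i x * bary v i x * bary v j x - bary v i x * (bary v j x * bary v j x)))) x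
          :> (1 / 2) *\<^sub>R ?D"
        by (rule GDERIV_cmult)
      moreover have "(1 / 2) *\<^sub>R ?D = herm_grad s x"
      proof -
        have "(1 / 2) *\<^sub>R ((a *\<^sub>R e + b *\<^sub>R d) + (((a * a) *\<^sub>R e + b *\<^sub>R (a *\<^sub>R d + a *\<^sub>R d)) -
            (a *\<^sub>R (b *\<^sub>R e + b *\<^sub>R e) + (b * b) *\<^sub>R d))) =
          ((b + 2 * (a * b) - b * b) / 2) *\<^sub>R d + ((a + a * a - 2 * (a * b)) / 2) *\<^sub>R e"
          for a b :: real and d e :: "real ^ 3"
          by (simp add: vec_eq_iff field_simps)
        then show ?thesis
          using False by (simp add: s herm_grad_def)
      qed
      ultimately show ?thesis
        using False by (simp add: s herm_poly_def)
    qed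
  next
    have "continuous_on UNIV (herm_grad (i, j))"
      unfolding herm_grad_def prod.case
      by (cases "i = j") (auto intro!: continuous_intros continuous_bary ij)
    then show "continuous_on UNIV (herm_grad s)" by (simp add: s)
  qed
qed

lemma bubble_data:
  assumes "t \<in> bubble_index"
  shows "boundary_data (tet v) (bubble t) (bubble_val t) (bubble_grad t)"
  using assms edge_bubble_data bubble_indexD
  by (cases t) (simp add: bubble_def bubble_val_def bubble_grad_def)

lemma subspace_Z0_part: "subspace (restrict_to (tet_int v) ` polys 2)"
  unfolding polys_def by (intro subspace_restrict_to subspace_span)

lemma restrict_product_in_span_herm:
  assumes "j \<in> II" "k \<in> II"
  shows "restrict_to (tet_int v) (\<lambda>x. bary v j x * bary v k x) \<in> span (herm ` (II \<times> II))"
proof (cases "j = k")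
  case True
  then have "restrict_to (tet_int v) (\<lambda>x. bary v j x * bary v k x) = herm (j, j)"
    by (simp add: herm_def herm_poly_def)
  then show ?thesis using assms by (simp add: span_base)
next
  case False
  then have "restrict_to (tet_int v) (\<lambda>x. bary v j x * bary v k x) = herm (j, k) + herm (k, j)"
    by (auto simp: herm_def herm_poly_def restrict_to_def fun_eq_iff field_simps)
  then show ?thesis using assms by (simp add: span_add span_base)
qed

text \<open>
  For distinct i and j, the sum of the basis functions (i, j) and (j, i) is the quadratic polynomial
  \<open>bary v i * bary v j\<close>, and their difference is the cubic function in the definition of \<open>Z0\<close>.
\<close>

lemma Z0_eq: "Z0 v = span (herm ` (II \<times> II))"
proof
  define cub where "cub = (\<lambda>i j. restrict_to (tet_int v)
    (\<lambda>x. (bary v i x)\<^sup>2 * bary v j x - (bary v j x)\<^sup>2 * bary v i x))"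
  have Z0: "Z0 v = restrict_to (tet_int v) ` polys 2 + span {cub i j | i j. i < j \<and> j \<le> 3}"
    by (simp add: Z0_def cub_def)
  have cub: "cub i j = herm (i, j) - herm (j, i)" if "i \<noteq> j" for i j
    using that by (auto simp: cub_def herm_def herm_poly_def restrict_to_def fun_eq_iff power2_eq_square field_simps)
  have "restrict_to (tet_int v) p \<in> span (herm ` (II \<times> II))" if "p \<in> polys 2" for p
  proof -
    obtain M where "\<And>x. p x = (\<Sum>j\<in>II. \<Sum>k\<in>II. M j k * (bary v j x * bary v k x))"
      using polys_bary_form[OF \<open>p \<in> polys 2\<close>] by blast
    then have "restrict_to (tet_int v) p =
        (\<Sum>j\<in>II. \<Sum>k\<in>II. M j k *\<^sub>R restrict_to (tet_int v) (\<lambda>x. bary v j x * bary v k x))"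
      by (auto simp: restrict_to_def fun_eq_iff sum_fun_apply scaleR_fun_apply)
    also have "\<dots> \<in> span (herm ` (II \<times> II))"
      by (intro span_sum span_scale restrict_product_in_span_herm)
    finally show ?thesis .
  qed
  moreover have "span {cub i j | i j. i < j \<and> j \<le> 3} \<subseteq> span (herm ` (II \<times> II))"
  proof (rule span_minimal[OF _ subspace_span], safe)
    fix i j :: nat assume "i < j" "j \<le> 3"
    then have "i \<in> II" "j \<in> II" "i \<noteq> j" by (auto simp: mem_II_iff)
    then show "cub i j \<in> span (herm ` (II \<times> II))"
      by (simp add: cub span_diff span_base)
  qed
  ultimately show "Z0 v \<subseteq> span (herm ` (II \<times> II))"
    unfolding Z0 set_plus_def by (auto intro: span_add)
  have sub: "subspace (Z0 v)"
    unfolding Z0 by (intro subspace_set_plus subspace_Z0_part subspace_span)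
  have quad: "restrict_to (tet_int v) (\<lambda>x. bary v i x * bary v j x) \<in> Z0 v" if "i \<in> II" "j \<in> II" for i j
    unfolding Z0 using set_plus_intro[OF imageI[OF bary_product_in_polys[OF that]] span_zero] by simp
  have cubZ: "cub i j \<in> Z0 v" if "i < j" "j \<in> II" for i j
  proof -
    have "0 \<in> restrict_to (tet_int v) ` polys 2"
      using subspace_0[OF subspace_Z0_part] .
    moreover have "cub i j \<in> span {cub i j | i j. i < j \<and> j \<le> 3}"
      using that by (intro span_base) (auto simp: mem_II_iff)
    ultimately have "0 + cub i j \<in> Z0 v"
      unfolding Z0 by (rule set_plus_intro)
    then show ?thesis by simp
  qed
  show "span (herm ` (II \<times> II)) \<subseteq> Z0 v"
  proof (rule span_minimal[OF _ sub], safe)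
    fix i j assume ij: "i \<in> II" "j \<in> II"
    consider "i = j" | "i < j" | "j < i" by linarith
    then show "herm (i, j) \<in> Z0 v"
    proof cases
      case 1
      then show ?thesis
        using quad[OF ij] by (simp add: herm_def herm_poly_def)
    next
      case 2
      then have "herm (i, j) = (1 / 2) *\<^sub>R (restrict_to (tet_int v) (\<lambda>x. bary v i x * bary v j x) + cub i j)"
        by (auto simp: herm_def herm_poly_def cub_def restrict_to_def scaleR_fun_apply fun_eq_iff power2_eq_square ac_simps)
      then show ?thesis
        using quad[OF ij] cubZ[OF 2 ij(2)] by (simp only: subspace_scale[OF sub] subspace_add[OF sub])
    next
      case 3
      then have "herm (i, j) = (1 / 2) *\<^sub>R (restrict_to (tet_int v) (\<lambda>x. bary v i x * bary v j x) - cub j i)"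
        by (auto simp: herm_def herm_poly_def cub_def restrict_to_def scaleR_fun_apply fun_eq_iff power2_eq_square ac_simps)
      then show ?thesis
        using quad[OF ij] cubZ[OF 3 ij(1)] by (simp only: subspace_scale[OF sub] subspace_diff[OF sub])
    qed
  qed
qed

lemma Ze_eq: "Ze v = span (herm ` (II \<times> II)) + span (bubble ` bubble_index)"
proof -
  have "{edge_bubble v l m n | l m n. l < m \<and> m \<le> 3 \<and> n \<in> II - {l, m}} = bubble ` bubble_index"
  proof (intro equalityI subsetI)
    fix x assume "x \<in> {edge_bubble v l m n | l m n. l < m \<and> m \<le> 3 \<and> n \<in> II - {l, m}}"
    then obtain l m n where "x = edge_bubble v l m n" "l < m \<and> m \<le> 3 \<and> n \<in> II - {l, m}" by blast
    then show "x \<in> bubble ` bubble_index"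
      by (intro image_eqI[where x = "(l, m, n)"]) (simp_all add: bubble_def bubble_index_def)
  next
    fix x assume "x \<in> bubble ` bubble_index"
    then obtain l m n where "x = edge_bubble v l m n" "l < m \<and> m \<le> 3 \<and> n \<in> II - {l, m}"
      by (auto simp: bubble_def bubble_index_def)
    then show "x \<in> {edge_bubble v l m n | l m n. l < m \<and> m \<le> 3 \<and> n \<in> II - {l, m}}" by blast
  qed
  then show ?thesis by (simp only: Ze_def Z0_eq)
qed

lemma subspace_Ze: "subspace (Ze v)"
  unfolding Ze_eq by (intro subspace_set_plus subspace_span)

lemma bubble_in_Ze:
  assumes "t \<in> bubble_index"
  shows "bubble t \<in> Ze v"
proof -
  have "0 + bubble t \<in> Ze v"
    unfolding Ze_eq by (intro set_plus_intro span_zero span_base imageI assms)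
  then show ?thesis by simp
qed

lemma herm_in_Ze:
  assumes "s \<in> II \<times> II"
  shows "herm s \<in> Ze v"
proof -
  have "herm s + 0 \<in> Ze v"
    unfolding Ze_eq by (intro set_plus_intro span_zero span_base imageI assms)
  then show ?thesis by simp
qed

lemma Ze_expansion:
  assumes "z \<in> Ze v"
  obtains a c where "z = (\<Sum>s\<in>II \<times> II. a s *\<^sub>R herm s) + (\<Sum>t\<in>bubble_index. c t *\<^sub>R bubble t)"
proof -
  obtain y w where "y \<in> span (herm ` (II \<times> II))" "w \<in> span (bubble ` bubble_index)" "z = y + w"
    using assms unfolding Ze_eq by (rule set_plus_elim)
  moreover from this obtain a where "y = (\<Sum>s\<in>II \<times> II. a s *\<^sub>R herm s)"
    using span_image_sum[of "II \<times> II" y herm] by auto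
  moreover from calculation obtain c where "w = (\<Sum>t\<in>bubble_index. c t *\<^sub>R bubble t)"
    using span_image_sum[OF finite_bubble_index, of w bubble] by auto
  ultimately show ?thesis using that by simp
qed

lemma Ze_combination:
  "(\<Sum>s\<in>II \<times> II. a s *\<^sub>R herm s) + (\<Sum>t\<in>bubble_index. c t *\<^sub>R bubble t) \<in> Ze v"
  by (intro subspace_add[OF subspace_Ze] subspace_sum[OF subspace_Ze] subspace_scale[OF subspace_Ze]
    herm_in_Ze bubble_in_Ze)

lemma Ze_data:
  "boundary_data (tet v) ((\<Sum>s\<in>II \<times> II. a s *\<^sub>R herm s) + (\<Sum>t\<in>bubble_index. c t *\<^sub>R bubble t))
    (\<lambda>p. (\<Sum>s\<in>II \<times> II. a s * herm_poly s p) + (\<Sum>t\<in>bubble_index. c t * bubble_val t p))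
    (\<lambda>p. (\<Sum>s\<in>II \<times> II. a s *\<^sub>R herm_grad s p) + (\<Sum>t\<in>bubble_index. c t *\<^sub>R bubble_grad t p))"
  by (intro boundary_data_add boundary_data_sum herm_data bubble_data)

lemma Ze_data_exists:
  assumes "z \<in> Ze v"
  obtains V H where "boundary_data (tet v) z V H"
proof -
  obtain a c where "z = (\<Sum>s\<in>II \<times> II. a s *\<^sub>R herm s) + (\<Sum>t\<in>bubble_index. c t *\<^sub>R bubble t)"
    using assms by (rule Ze_expansion)
  then show ?thesis using that Ze_data by blast
qed

end

context tetrahedron
begin

section \<open>Normal traces and the correction operator\<close>

abbreviation face_polys :: "nat \<Rightarrow> (real ^ 3 \<Rightarrow> real) set" where
  "face_polys i \<equiv> restrict_to (face_int v i) ` polys 2"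

lemma subspace_face_polys: "subspace (face_polys i)"
  unfolding polys_def by (intro subspace_restrict_to subspace_span)

lemma subspace_Q_edge: "subspace (Q_edge v i)"
  by (simp add: Q_edge_def subspace_span)

lemma Q_edge_expansion:
  assumes "i \<in> II" "q \<in> Q_edge v i"
  obtains c where "q = (\<Sum>\<kappa>\<in>Phi_index i. c \<kappa> *\<^sub>R Phi_on v (face_int v i) \<kappa>)"
  using span_image_sum[OF finite_Phi_index] assms unfolding Q_edge_def by blast

lemma face_polys_Q_edge_disjoint:
  assumes i: "i \<in> II" and "f \<in> face_polys i" "f \<in> Q_edge v i"
  shows "f = 0"
proof -
  obtain p where p: "p \<in> polys 2" "f = restrict_to (face_int v i) p"
    using assms(2) by blast
  obtain c where c: "f = (\<Sum>\<kappa>\<in>Phi_index i. c \<kappa> *\<^sub>R Phi_on v (face_int v i) \<kappa>)"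
    using Q_edge_expansion[OF i assms(3)] .
  have "c \<kappa> = 0" if "\<kappa> \<in> Phi_index i" for \<kappa>
  proof (rule edge_traces_independent_on_face[OF i p(1) _ that])
    show "(\<Sum>\<kappa>\<in>Phi_index i. c \<kappa> *\<^sub>R Phi_on v (face_int v i) \<kappa>) x = p x" if "x \<in> face_int v i" for x
      using that unfolding c[symmetric] p(2) by (simp add: restrict_to_def)
  qed
  then show ?thesis
    unfolding c by simp
qed

lemma Phi_on_coefficients_unique:
  assumes i: "i \<in> II"
    and eq: "(\<Sum>\<kappa>\<in>Phi_index i. c \<kappa> *\<^sub>R Phi_on v (face_int v i) \<kappa>) = (\<Sum>\<kappa>\<in>Phi_index i. d \<kappa> *\<^sub>R Phi_on v (face_int v i) \<kappa>)"
    and \<kappa>: "\<kappa> \<in> Phi_index i"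
  shows "c \<kappa> = d \<kappa>"
proof -
  have "(\<Sum>\<kappa>\<in>Phi_index i. (c \<kappa> - d \<kappa>) *\<^sub>R Phi_on v (face_int v i) \<kappa>) = 0"
    using eq by (simp add: scaleR_diff_left sum_subtractf)
  moreover have "(0 :: real ^ 3 \<Rightarrow> real) \<in> polys 2"
    unfolding polys_def by (rule span_zero)
  ultimately have "c \<kappa> - d \<kappa> = 0"
    using edge_traces_independent_on_face[OF i, of 0 "\<lambda>\<kappa>. c \<kappa> - d \<kappa>", OF _ _ \<kappa>] by simp
  then show ?thesis by simp
qed

text \<open>
  If the face contains only two of the vertices l, m, n, the trace is 0; otherwise it is one of the
  generators of \<open>Q_edge\<close>.
\<close>

lemma restrict_Phi_in_Q_edge:
  assumes i: "i \<in> II" and t: "(l, m, n) \<in> bubble_index" and k: "k \<in> {l, m, n}"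
  shows "restrict_to (face_int v i) (\<lambda>x. Phi l m n k (\<lambda>j. bary v j x)) \<in> Q_edge v i"
proof (cases "i \<in> {l, m, n}")
  case True
  then have "restrict_to (face_int v i) (\<lambda>x. Phi l m n k (\<lambda>j. bary v j x)) = 0"
    using bubble_indexD[OF t] k Phi_vanish[of _ l m n k]
    by (auto simp: restrict_to_def fun_eq_iff mem_face_int_iff[OF i])
  then show ?thesis
    using subspace_0[OF subspace_Q_edge] by simp
next
  case False
  then have "(l, m, n, k) \<in> Phi_index i"
    using bubble_indexD[OF t] k i by (auto simp: Phi_index_iff face_edges_iff)
  then have "Phi_on v (face_int v i) (l, m, n, k) \<in> Q_edge v i"
    unfolding Q_edge_def by (intro span_base imageI)
  then show ?thesis by (simp add: Phi_on_def)
qed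

lemma herm_trace:
  assumes "s \<in> II \<times> II"
  shows "restrict_to (face_int v i) (\<lambda>x. herm_grad s x \<bullet> \<nu>) \<in> face_polys i"
proof (rule imageI)
  obtain k j where s: "s = (k, j)" "k \<in> II" "j \<in> II" using assms by auto
  have P: "subspace (polys 2)" unfolding polys_def by (rule subspace_span)
  note mem = subspace_add[OF P] subspace_diff[OF P] subspace_scale[OF P] bary_in_polys bary_product_in_polys s(2,3)
  show "(\<lambda>x. herm_grad s x \<bullet> \<nu>) \<in> polys 2"
  proof (cases "k = j")
    case True
    then have "(\<lambda>x. herm_grad s x \<bullet> \<nu>) = (2 * (bgrad k \<bullet> \<nu>)) *\<^sub>R bary v k"
      by (simp add: s herm_grad_def fun_eq_iff scaleR_fun_apply)
    then show ?thesis using mem by simp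
  next
    case False
    have "(\<lambda>x. herm_grad s x \<bullet> \<nu>) =
      ((bgrad k \<bullet> \<nu>) / 2) *\<^sub>R (bary v j + 2 *\<^sub>R (\<lambda>x. bary v k x * bary v j x) - (\<lambda>x. bary v j x * bary v j x)) +
      ((bgrad j \<bullet> \<nu>) / 2) *\<^sub>R (bary v k + (\<lambda>x. bary v k x * bary v k x) - 2 *\<^sub>R (\<lambda>x. bary v k x * bary v j x))"
      using False by (simp add: s herm_grad_def fun_eq_iff scaleR_fun_apply inner_add_left mult.commute)
    also have "\<dots> \<in> polys 2"
      by (intro mem)
    finally show ?thesis .
  qed
qed

text \<open>
  The normal derivative is a combination of the derivatives by barycentric coordinates, which are
  functions \<open>Phi\<close>, except that the derivative by the apex n contains the additional quadratic term
  \<open>bary v l * bary v m\<close>.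
\<close>

lemma bubble_trace:
  assumes i: "i \<in> II" and "t \<in> bubble_index"
  shows "restrict_to (face_int v i) (\<lambda>x. bubble_grad t x \<bullet> \<nu>) \<in> face_polys i + Q_edge v i"
proof -
  obtain l m n where t: "t = (l, m, n)" "(l, m, n) \<in> bubble_index" using assms(2) by (cases t) auto
  let ?F = "face_int v i"
  let ?Phi = "\<lambda>k. restrict_to ?F (\<lambda>x. Phi l m n k (\<lambda>j. bary v j x))"
  have "restrict_to ?F (\<lambda>x. bubble_grad t x \<bullet> \<nu>) =
    (bgrad n \<bullet> \<nu>) *\<^sub>R restrict_to ?F (\<lambda>x. bary v l x * bary v m x) +
    ((bgrad l \<bullet> \<nu>) *\<^sub>R ?Phi l + (bgrad m \<bullet> \<nu>) *\<^sub>R ?Phi m + (bgrad n \<bullet> \<nu>) *\<^sub>R ?Phi n)"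
    by (simp add: t bubble_grad_def restrict_to_def fun_eq_iff scaleR_fun_apply inner_add_left algebra_simps)
  also have "\<dots> \<in> face_polys i + Q_edge v i"
  proof (rule set_plus_intro)
    show "(bgrad n \<bullet> \<nu>) *\<^sub>R restrict_to ?F (\<lambda>x. bary v l x * bary v m x) \<in> face_polys i"
      using bubble_indexD[OF t(2)] by (intro subspace_scale[OF subspace_face_polys] imageI bary_product_in_polys)
    show "(bgrad l \<bullet> \<nu>) *\<^sub>R ?Phi l + (bgrad m \<bullet> \<nu>) *\<^sub>R ?Phi m + (bgrad n \<bullet> \<nu>) *\<^sub>R ?Phi n \<in> Q_edge v i"
      by (intro subspace_add[OF subspace_Q_edge] subspace_scale[OF subspace_Q_edge] restrict_Phi_in_Q_edge[OF i t(2)]) auto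
  qed
  finally show ?thesis .
qed

lemma face_int_subset: "i \<in> II \<Longrightarrow> x \<in> face_int v i \<Longrightarrow> x \<in> tet v"
  using rel_interior_subset[of "face v i"] by (auto simp: face_def)

lemma normal_trace_eq:
  assumes "i \<in> II" "boundary_data (tet v) z V H"
  shows "normal_trace v i z = restrict_to (face_int v i) (\<lambda>x. H x \<bullet> outer_normal v i)"
  using bd_grad_eqI[OF assms(2)] face_int_subset[OF assms(1)]
  by (auto simp: normal_trace_def restrict_to_def fun_eq_iff)

lemma normal_trace_linear:
  assumes i: "i \<in> II" and "y \<in> Ze v" "z \<in> Ze v"
  shows "normal_trace v i (c *\<^sub>R y + z) = c *\<^sub>R normal_trace v i y + normal_trace v i z"
proof -
  obtain V H where y: "boundary_data (tet v) y V H"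
    using assms(2) by (rule Ze_data_exists)
  obtain V' H' where z: "boundary_data (tet v) z V' H'"
    using assms(3) by (rule Ze_data_exists)
  show ?thesis
    unfolding normal_trace_eq[OF i boundary_data_add[OF boundary_data_scaleR[OF y, of c] z]]
      normal_trace_eq[OF i y] normal_trace_eq[OF i z]
    by (simp add: restrict_to_def fun_eq_iff scaleR_fun_apply inner_add_left)
qed

lemma normal_trace_decomposition:
  assumes i: "i \<in> II" and "z \<in> Ze v"
  shows "normal_trace v i z \<in> face_polys i + Q_edge v i"
proof -
  let ?D = "face_polys i + Q_edge v i" and ?\<nu> = "outer_normal v i"
  obtain a c where z: "z = (\<Sum>s\<in>II \<times> II. a s *\<^sub>R herm s) + (\<Sum>t\<in>bubble_index. c t *\<^sub>R bubble t)"
    using assms(2) by (rule Ze_expansion)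
  have D: "subspace ?D"
    by (intro subspace_set_plus subspace_face_polys subspace_Q_edge)
  have "normal_trace v i z = (\<Sum>s\<in>II \<times> II. a s *\<^sub>R restrict_to (face_int v i) (\<lambda>x. herm_grad s x \<bullet> ?\<nu>)) +
      (\<Sum>t\<in>bubble_index. c t *\<^sub>R restrict_to (face_int v i) (\<lambda>x. bubble_grad t x \<bullet> ?\<nu>))"
    unfolding z normal_trace_eq[OF i Ze_data]
    by (auto simp: restrict_to_def fun_eq_iff sum_fun_apply scaleR_fun_apply inner_add_left inner_sum_left)
  also have "\<dots> \<in> ?D"
  proof (intro subspace_add[OF D] subspace_sum[OF D] subspace_scale[OF D])
    show "restrict_to (face_int v i) (\<lambda>x. herm_grad s x \<bullet> ?\<nu>) \<in> ?D" if "s \<in> II \<times> II" for s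
      using set_plus_intro[OF herm_trace[OF that] subspace_0[OF subspace_Q_edge]] by simp
  qed (rule bubble_trace[OF i])
  finally show ?thesis .
qed

text \<open>
  The decomposition is unique because quadratic polynomials and \<open>Q_edge\<close> intersect trivially.
\<close>

lemma sing_part_eqI:
  assumes i: "i \<in> II" and "q \<in> Q_edge v i" "p \<in> face_polys i" "normal_trace v i z = p + q"
  shows "sing_part v i z = q"
  unfolding sing_part_def
proof (rule the_equality)
  show "q \<in> Q_edge v i \<and> (\<exists>p\<in>face_polys i. normal_trace v i z = p + q)"
    using assms by blast
  fix q' assume "q' \<in> Q_edge v i \<and> (\<exists>p\<in>face_polys i. normal_trace v i z = p + q')"
  then obtain p' where "q' \<in> Q_edge v i" "p' \<in> face_polys i" "p + q = p' + q'"
    using assms(4) by auto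
  then have "q' - q \<in> Q_edge v i" "p - p' \<in> face_polys i" "p - p' = q' - q"
    using assms(2,3) subspace_diff[OF subspace_Q_edge] subspace_diff[OF subspace_face_polys]
    by (auto simp: algebra_simps)
  then have "q' - q = 0"
    using face_polys_Q_edge_disjoint[OF i, of "q' - q"] by simp
  then show "q' = q" by simp
qed

lemma sing_part_decomposition:
  assumes i: "i \<in> II" and "z \<in> Ze v"
  obtains p where "p \<in> face_polys i" "sing_part v i z \<in> Q_edge v i" "normal_trace v i z = p + sing_part v i z"
proof -
  obtain p q where "p \<in> face_polys i" "q \<in> Q_edge v i" "normal_trace v i z = p + q"
    using normal_trace_decomposition[OF assms] by (rule set_plus_elim)
  moreover from this have "sing_part v i z = q"
    using sing_part_eqI[OF i] by blast
  ultimately show ?thesis using that by simp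
qed

lemma sing_part_in_Q_edge: "i \<in> II \<Longrightarrow> z \<in> Ze v \<Longrightarrow> sing_part v i z \<in> Q_edge v i"
  using sing_part_decomposition by blast

lemma sing_part_linear:
  assumes i: "i \<in> II" and "y \<in> Ze v" "z \<in> Ze v"
  shows "sing_part v i (c *\<^sub>R y + z) = c *\<^sub>R sing_part v i y + sing_part v i z"
proof -
  obtain p where p: "p \<in> face_polys i" "sing_part v i y \<in> Q_edge v i" "normal_trace v i y = p + sing_part v i y"
    using sing_part_decomposition[OF i assms(2)] .
  obtain r where r: "r \<in> face_polys i" "sing_part v i z \<in> Q_edge v i" "normal_trace v i z = r + sing_part v i z"
    using sing_part_decomposition[OF i assms(3)] .
  show ?thesis
  proof (rule sing_part_eqI[OF i])
    show "c *\<^sub>R sing_part v i y + sing_part v i z \<in> Q_edge v i"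
      using p r by (intro subspace_add[OF subspace_Q_edge] subspace_scale[OF subspace_Q_edge])
    show "c *\<^sub>R p + r \<in> face_polys i"
      using p r by (intro subspace_add[OF subspace_face_polys] subspace_scale[OF subspace_face_polys])
    show "normal_trace v i (c *\<^sub>R y + z) = c *\<^sub>R p + r + (c *\<^sub>R sing_part v i y + sing_part v i z)"
      unfolding normal_trace_linear[OF assms] p(3) r(3) scaleR_add_right by (simp only: ac_simps)
  qed
qed

text \<open>
  The coefficients of an element of \<open>Q_edge\<close> are unique, hence so is its barycentric extension.
\<close>

lemma normal_lift_eq:
  assumes i: "i \<in> II"
  shows "normal_lift v i (\<Sum>\<kappa>\<in>Phi_index i. c \<kappa> *\<^sub>R Phi_on v (face_int v i) \<kappa>) =
    (\<Sum>\<kappa>\<in>Phi_index i. (c \<kappa> / dcoef v i i) *\<^sub>R Phi_lift i \<kappa>)"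
proof -
  let ?q = "\<Sum>\<kappa>\<in>Phi_index i. c \<kappa> *\<^sub>R Phi_on v (face_int v i) \<kappa>"
  have "bary_ext v i ?q = (\<Sum>\<kappa>\<in>Phi_index i. c \<kappa> *\<^sub>R Phi_on v (tet_int v) \<kappa>)"
    unfolding bary_ext_def
  proof (rule the_equality)
    show "\<exists>d. ?q = (\<Sum>\<kappa>\<in>Phi_index i. d \<kappa> *\<^sub>R Phi_on v (face_int v i) \<kappa>) \<and>
      (\<Sum>\<kappa>\<in>Phi_index i. c \<kappa> *\<^sub>R Phi_on v (tet_int v) \<kappa>) = (\<Sum>\<kappa>\<in>Phi_index i. d \<kappa> *\<^sub>R Phi_on v (tet_int v) \<kappa>)"
      by (intro exI[of _ c] conjI refl)
    fix g assume "\<exists>d. ?q = (\<Sum>\<kappa>\<in>Phi_index i. d \<kappa> *\<^sub>R Phi_on v (face_int v i) \<kappa>) \<and>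
      g = (\<Sum>\<kappa>\<in>Phi_index i. d \<kappa> *\<^sub>R Phi_on v (tet_int v) \<kappa>)"
    then obtain d where d: "?q = (\<Sum>\<kappa>\<in>Phi_index i. d \<kappa> *\<^sub>R Phi_on v (face_int v i) \<kappa>)"
      "g = (\<Sum>\<kappa>\<in>Phi_index i. d \<kappa> *\<^sub>R Phi_on v (tet_int v) \<kappa>)" by blast
    show "g = (\<Sum>\<kappa>\<in>Phi_index i. c \<kappa> *\<^sub>R Phi_on v (tet_int v) \<kappa>)"
      unfolding d(2) using Phi_on_coefficients_unique[OF i d(1)] by (intro sum.cong) auto
  qed
  then have ext: "bary_ext v i ?q x = (\<Sum>\<kappa>\<in>Phi_index i. c \<kappa> * Phi_on v (tet_int v) \<kappa> x)" for x
    by (simp add: sum_fun_apply scaleR_fun_apply)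
  have "(c \<kappa> / dcoef v i i) * Phi_lift i \<kappa> x = bary v i x / dcoef v i i * Theta v i x * (c \<kappa> * Phi_on v (tet_int v) \<kappa> x)"
    if "x \<in> tet_int v" for x \<kappa>
    using that by (cases \<kappa>) (simp add: Phi_lift_def Phi_on_def restrict_to_def)
  moreover have "Phi_lift i \<kappa> x = 0" if "x \<notin> tet_int v" for x \<kappa>
    using that by (cases \<kappa>) (simp add: Phi_lift_def restrict_to_def)
  ultimately have "normal_lift v i ?q x = (\<Sum>\<kappa>\<in>Phi_index i. (c \<kappa> / dcoef v i i) * Phi_lift i \<kappa> x)" for x
    by (cases "x \<in> tet_int v") (simp_all only: normal_lift_def restrict_to_def ext sum_distrib_left if_True if_False
      mult_zero_right sum.neutral_const not_False_eq_True)
  then show ?thesis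
    by (simp add: fun_eq_iff sum_fun_apply scaleR_fun_apply)
qed

lemma normal_lift_data:
  assumes i: "i \<in> II" and "q \<in> Q_edge v i"
  shows "boundary_data skeleton (normal_lift v i q) (\<lambda>_. 0) (\<lambda>_. 0)"
proof -
  obtain c where q: "q = (\<Sum>\<kappa>\<in>Phi_index i. c \<kappa> *\<^sub>R Phi_on v (face_int v i) \<kappa>)"
    using assms by (rule Q_edge_expansion)
  show ?thesis
    unfolding q normal_lift_eq[OF i]
    using boundary_data_sum[of "Phi_index i" skeleton "Phi_lift i" "\<lambda>_ _. 0" "\<lambda>_ _. 0"] Phi_lift_data[OF i]
    by simp
qed

lemma normal_lift_linear:
  assumes i: "i \<in> II" and "q \<in> Q_edge v i" "r \<in> Q_edge v i"
  shows "normal_lift v i (a *\<^sub>R q + r) = a *\<^sub>R normal_lift v i q + normal_lift v i r"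
proof -
  obtain c where q: "q = (\<Sum>\<kappa>\<in>Phi_index i. c \<kappa> *\<^sub>R Phi_on v (face_int v i) \<kappa>)"
    using i assms(2) by (rule Q_edge_expansion)
  obtain d where r: "r = (\<Sum>\<kappa>\<in>Phi_index i. d \<kappa> *\<^sub>R Phi_on v (face_int v i) \<kappa>)"
    using i assms(3) by (rule Q_edge_expansion)
  have "a *\<^sub>R q + r = (\<Sum>\<kappa>\<in>Phi_index i. (a * c \<kappa> + d \<kappa>) *\<^sub>R Phi_on v (face_int v i) \<kappa>)"
    unfolding q r by (simp add: scaleR_sum_right scaleR_add_left sum.distrib)
  moreover have "normal_lift v i q = (\<Sum>\<kappa>\<in>Phi_index i. (c \<kappa> / dcoef v i i) *\<^sub>R Phi_lift i \<kappa>)"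
    "normal_lift v i r = (\<Sum>\<kappa>\<in>Phi_index i. (d \<kappa> / dcoef v i i) *\<^sub>R Phi_lift i \<kappa>)"
    unfolding q r by (rule normal_lift_eq[OF i])+
  ultimately show ?thesis
    by (simp only: normal_lift_eq[OF i])
      (simp add: scaleR_sum_right scaleR_add_left sum.distrib add_divide_distrib)
qed

lemma R_op_linear:
  assumes "y \<in> Ze v" "z \<in> Ze v"
  shows "R_op v (c *\<^sub>R y + z) = c *\<^sub>R R_op v y + R_op v z"
proof -
  have "normal_lift v i (sing_part v i (c *\<^sub>R y + z)) =
      c *\<^sub>R normal_lift v i (sing_part v i y) + normal_lift v i (sing_part v i z)" if i: "i \<in> II" for i
    unfolding sing_part_linear[OF i assms]
    by (intro normal_lift_linear i sing_part_in_Q_edge assms)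
  then show ?thesis
    unfolding R_op_def by (simp add: sum.distrib scaleR_diff_right scaleR_sum_right)
qed

text \<open>
  The correction changes neither the boundary values nor the gradients on the edges.
\<close>

lemma R_op_data:
  assumes "z \<in> Ze v" and z: "boundary_data (tet v) z V H"
  shows "boundary_data skeleton (R_op v z) V H"
proof -
  have "boundary_data skeleton (normal_lift v i (sing_part v i z)) (\<lambda>_. 0) (\<lambda>_. 0)" if i: "i \<in> II" for i
    by (intro normal_lift_data i sing_part_in_Q_edge assms)
  then have lift: "boundary_data skeleton (\<Sum>i\<in>II. (- 1) *\<^sub>R normal_lift v i (sing_part v i z)) (\<lambda>_. 0) (\<lambda>_. 0)"
    using boundary_data_sum[of II skeleton "\<lambda>i. normal_lift v i (sing_part v i z)" "\<lambda>_ _. 0" "\<lambda>_ _. 0" "\<lambda>_. - 1"] by simp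
  have "skeleton \<subseteq> tet v" by (auto simp: skeleton_def)
  from boundary_data_add[OF boundary_data_mono[OF z this] lift]
  have "boundary_data skeleton (z + (\<Sum>i\<in>II. (- 1) *\<^sub>R normal_lift v i (sing_part v i z))) V H"
    by simp
  moreover have "R_op v z = z + (\<Sum>i\<in>II. (- 1) *\<^sub>R normal_lift v i (sing_part v i z))"
    by (simp add: R_op_def sum_negf)
  ultimately show ?thesis by simp
qed

end

section \<open>Corrected face bubbles\<close>

lemma subspace_image_linear_on:
  assumes A: "subspace A" and lin: "\<And>c y z. y \<in> A \<Longrightarrow> z \<in> A \<Longrightarrow> f (c *\<^sub>R y + z) = c *\<^sub>R f y + f z"
  shows "subspace (f ` A)" and "f 0 = 0"
proof -
  have A0: "0 \<in> A" using A by (rule subspace_0)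
  show f0: "f 0 = 0"
    using lin[OF A0 A0, of 1] by simp
  show "subspace (f ` A)"
  proof (rule subspaceI)
    show "0 \<in> f ` A" using A0 f0 by force
  next
    fix x y assume "x \<in> f ` A" "y \<in> f ` A"
    then obtain x' y' where xy: "x = f x'" "y = f y'" "x' \<in> A" "y' \<in> A" by blast
    have "x + y = f (1 *\<^sub>R x' + y')"
      unfolding lin[OF xy(3,4)] xy(1,2) by simp
    moreover have "1 *\<^sub>R x' + y' \<in> A"
      using xy(3,4) A by (intro subspace_add subspace_scale)
    ultimately show "x + y \<in> f ` A" by blast
  next
    fix c x assume "x \<in> f ` A"
    then obtain x' where x: "x = f x'" "x' \<in> A" by blast
    have "c *\<^sub>R x = f (c *\<^sub>R x' + 0)"
      unfolding lin[OF x(2) A0] x(1) f0 by simp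
    moreover have "c *\<^sub>R x' + 0 \<in> A"
      using x(2) A0 A by (intro subspace_add subspace_scale)
    ultimately show "c *\<^sub>R x \<in> f ` A" by blast
  qed
qed

context tetrahedron
begin

lemma bary_midpoint:
  assumes "l \<in> II" "m \<in> II" "l \<noteq> m" "j \<in> II"
  shows "bary v j (midpoint (v l) (v m)) = (if j = l \<or> j = m then 1 / 2 else 0)"
proof -
  have "midpoint (v l) (v m) - v l = (1 / 2) *\<^sub>R (v m - v l)"
    by (simp add: midpoint_def vec_eq_iff field_simps)
  then have "bary v j (midpoint (v l) (v m)) - bary v j (v l) = (1 / 2) * (bary v j (v m) - bary v j (v l))"
    unfolding bgrad_diff[OF assms(4), symmetric] by simp
  then show ?thesis
    using assms by (simp add: bary_vertex split: if_splits)
qed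

lemma bary_mid_face:
  assumes "i \<in> II" "j \<in> II"
  shows "bary v j (mid_face v i) = (if j = i then 0 else 1 / 3)"
proof (rule bary_eqI[where u = "\<lambda>j. if j = i then 0 else 1 / 3", OF _ _ assms(2)])
  have s: "(\<Sum>j\<in>II. h j) = (\<Sum>j\<in>JJ i. h j)" if "h i = 0" for h :: "nat \<Rightarrow> 'b::comm_monoid_add"
    using that assms(1) by (simp add: JJ_def sum.remove[of II i])
  have c: "card (JJ i) = 3"
    using assms(1) by (simp add: JJ_def) (simp add: II_def)
  have "(\<Sum>j\<in>JJ i. if j = i then 0 else 1 / 3) = (\<Sum>j\<in>JJ i. 1 / 3 :: real)"
    by (rule sum.cong) (auto simp: JJ_def)
  then show "(\<Sum>j\<in>II. if j = i then 0 else 1 / 3 :: real) = 1"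
    by (subst s) (simp_all add: c)
  have "(\<Sum>j\<in>JJ i. (if j = i then 0 else 1 / 3) *\<^sub>R v j) = (\<Sum>j\<in>JJ i. (1 / 3) *\<^sub>R v j)"
    by (rule sum.cong) (auto simp: JJ_def)
  then show "(\<Sum>j\<in>II. (if j = i then 0 else 1 / 3) *\<^sub>R v j) = mid_face v i"
    by (subst s) (simp_all add: mid_face_def scaleR_sum_right)
qed

lemma vertex_in_skeleton:
  assumes "k \<in> II"
  shows "v k \<in> skeleton"
proof -
  obtain a b c where abc: "a < b" "b < c" "JJ k = {a, b, c}" using JJ_sorted[OF assms] .
  then have "a \<in> II" "b \<in> II" "a \<noteq> k" "b \<noteq> k" "a \<noteq> b" unfolding JJ_def by auto
  then have "a \<in> II \<and> b \<in> II \<and> a \<noteq> b \<and> bary v a (v k) = 0 \<and> bary v b (v k) = 0"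
    using assms by (simp add: bary_vertex)
  moreover have "v k \<in> tet v"
    using assms by (simp add: mem_tet_iff bary_vertex)
  ultimately show ?thesis unfolding skeleton_def by blast
qed

lemma edge_complement:
  assumes "l \<in> II" "m \<in> II" "l \<noteq> m"
  obtains a b where "a \<in> II" "b \<in> II" "a \<noteq> b" "a \<noteq> l" "a \<noteq> m" "b \<noteq> l" "b \<noteq> m"
proof -
  have "card (II - {l, m}) = 2"
    using assms by (subst card_Diff_subset) (auto simp: II_def)
  then obtain a b where "II - {l, m} = {a, b}" "a \<noteq> b"
    by (auto simp: card_2_iff)
  then show ?thesis using that by blast
qed

lemma midpoint_in_skeleton:
  assumes "l \<in> II" "m \<in> II" "l \<noteq> m"
  shows "midpoint (v l) (v m) \<in> skeleton"
proof -
  obtain a b where "a \<in> II" "b \<in> II" "a \<noteq> b" "a \<noteq> l" "a \<noteq> m" "b \<noteq> l" "b \<noteq> m"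
    using edge_complement[OF assms] .
  then have "a \<in> II \<and> b \<in> II \<and> a \<noteq> b \<and> bary v a (midpoint (v l) (v m)) = 0 \<and> bary v b (midpoint (v l) (v m)) = 0"
    using bary_midpoint[OF assms] by simp
  moreover have "midpoint (v l) (v m) \<in> tet v"
    using bary_midpoint[OF assms] by (simp add: mem_tet_iff)
  ultimately show ?thesis unfolding skeleton_def by blast
qed

lemma mid_face_in_boundary:
  assumes "i \<in> II"
  shows "mid_face v i \<in> tet v - tet_int v"
proof -
  have "mid_face v i \<in> tet v"
    using bary_mid_face[OF assms] by (simp add: mem_tet_iff)
  moreover have "\<not> 0 < bary v i (mid_face v i)"
    using bary_mid_face[OF assms assms] by simp
  ultimately show ?thesis
    using assms unfolding Diff_iff mem_tet_int_iff by blast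
qed

lemma sum_bgrad: "(\<Sum>j\<in>II. bgrad j) = 0"
proof -
  have "(\<Sum>j\<in>II. bgrad j) \<bullet> x = 0" for x
  proof -
    have "(\<Sum>j\<in>II. bgrad j) \<bullet> x = (\<Sum>j\<in>II. bary v j x - bary v j 0)"
      unfolding inner_sum_left using bgrad_diff[of _ x 0] by (intro sum.cong) auto
    then show ?thesis by (simp add: sum_subtractf sum_bary)
  qed
  then show ?thesis by (metis inner_eq_zero_iff)
qed

lemma face_bubble_data:
  assumes "i \<in> II" "a < b" "b < c" "JJ i = {a, b, c}"
  shows "boundary_data S (face_bubble v i) (\<lambda>p. bary v a p * bary v b p * bary v c p)
    (\<lambda>p. (bary v a p * bary v b p) *\<^sub>R bgrad c + (bary v a p * bary v c p) *\<^sub>R bgrad b + (bary v b p * bary v c p) *\<^sub>R bgrad a)"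
proof -
  have abc: "a \<in> II" "b \<in> II" "c \<in> II" using assms(4) unfolding JJ_def by blast+
  have eq: "face_bubble v i = restrict_to (tet_int v) (\<lambda>x. bary v a x * bary v b x * bary v c x)"
    using assms by (simp add: face_bubble_def mult.assoc)
  show ?thesis
    unfolding eq
  proof (rule boundary_data_smooth)
    fix x
    have "GDERIV (\<lambda>x. bary v a x * bary v b x * bary v c x) x :>
        (bary v a x * bary v b x) *\<^sub>R bgrad c + bary v c x *\<^sub>R (bary v a x *\<^sub>R bgrad b + bary v b x *\<^sub>R bgrad a)"
      by (intro GDERIV_mult GDERIV_bary abc)
    then show "GDERIV (\<lambda>x. bary v a x * bary v b x * bary v c x) x :>
        (bary v a x * bary v b x) *\<^sub>R bgrad c + (bary v a x * bary v c x) *\<^sub>R bgrad b + (bary v b x * bary v c x) *\<^sub>R bgrad a"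
      by (simp add: scaleR_add_right mult.commute add.assoc del: gderiv_deriv)
  qed (intro continuous_intros continuous_bary abc)
qed

text \<open>
  One of the three coordinates of the bubble vanishes at an edge point, and with it all functions
  \<open>Phi\<close>; only the quadratic term of the apex derivative remains.
\<close>

lemma bubble_on_skeleton:
  assumes "(l, m, n) \<in> bubble_index" "p \<in> skeleton"
  shows "bubble_val (l, m, n) p = 0" and "bubble_grad (l, m, n) p = (bary v l p * bary v m p) *\<^sub>R bgrad n"
proof -
  note d = bubble_indexD[OF assms(1)]
  obtain a b where ab: "a \<in> II" "b \<in> II" "a \<noteq> b" "bary v a p = 0" "bary v b p = 0"
    using assms(2) unfolding skeleton_def by blast
  have "a \<in> {l, m, n} \<or> b \<in> {l, m, n}"
  proof (rule ccontr)
    assume "\<not> ?thesis"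
    then have "card {a, b, l, m, n} = 5" using ab(3) d by auto
    moreover have "card {a, b, l, m, n} \<le> card II"
      using ab d by (intro card_mono) auto
    ultimately show False by (simp add: II_def)
  qed
  then have z: "bary v l p = 0 \<or> bary v m p = 0 \<or> bary v n p = 0"
    using ab by auto
  then show "bubble_val (l, m, n) p = 0"
    by (auto simp: bubble_val_def)
  have "Phi l m n k (\<lambda>j. bary v j p) = 0" if "k \<in> {l, m, n}" for k
    using that z d by (intro Phi_vanish) auto
  then show "bubble_grad (l, m, n) p = (bary v l p * bary v m p) *\<^sub>R bgrad n"
    by (simp add: bubble_grad_def)
qed

lemma face_edges_subset: "i \<in> II \<Longrightarrow> face_edges i \<subseteq> bubble_index"
  by (auto simp: face_edges_iff bubble_index_def mem_II_iff)

definition face_bubble_sum :: "nat \<Rightarrow> real ^ 3 \<Rightarrow> real" where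
  "face_bubble_sum i = (\<Sum>t\<in>face_edges i. bubble t)"

lemma R_op_zero: "R_op v 0 = 0"
  by (rule subspace_image_linear_on(2)[OF subspace_Ze]) (rule R_op_linear)

lemma R_op_sum:
  assumes "finite K" "\<And>s. s \<in> K \<Longrightarrow> f s \<in> Ze v"
  shows "R_op v (\<Sum>s\<in>K. c s *\<^sub>R f s) = (\<Sum>s\<in>K. c s *\<^sub>R R_op v (f s)) \<and> (\<Sum>s\<in>K. c s *\<^sub>R f s) \<in> Ze v"
  using assms
proof (induction K rule: finite_induct)
  case empty
  show ?case
    unfolding sum.empty using R_op_zero subspace_0[OF subspace_Ze] by blast
next
  case (insert s K)
  have IH: "R_op v (\<Sum>s\<in>K. c s *\<^sub>R f s) = (\<Sum>s\<in>K. c s *\<^sub>R R_op v (f s))" "(\<Sum>s\<in>K. c s *\<^sub>R f s) \<in> Ze v"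
    using insert by auto
  have s: "f s \<in> Ze v" using insert by simp
  show ?case
    unfolding sum.insert[OF insert.hyps] R_op_linear[OF s IH(2)] IH(1)
    using s IH(2) by (intro conjI refl subspace_add[OF subspace_Ze] subspace_scale[OF subspace_Ze])
qed

lemma face_bubble_sum_in_Ze: "i \<in> II \<Longrightarrow> face_bubble_sum i \<in> Ze v"
  unfolding face_bubble_sum_def using face_edges_subset
  by (intro subspace_sum[OF subspace_Ze] bubble_in_Ze) auto

lemma cor_bubble_eq:
  assumes "i \<in> II"
  shows "cor_bubble v i = face_bubble v i - R_op v (face_bubble_sum i)"
proof -
  have fin: "finite (face_edges i)"
    using face_edges_subset[OF assms] finite_bubble_index by (rule finite_subset)
  have "R_op v (\<Sum>t\<in>face_edges i. 1 *\<^sub>R bubble t) = (\<Sum>t\<in>face_edges i. 1 *\<^sub>R R_op v (bubble t))"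
    using R_op_sum[OF fin, of bubble "\<lambda>_. 1"] face_edges_subset[OF assms] bubble_in_Ze by blast
  then have "R_op v (face_bubble_sum i) = (\<Sum>t\<in>face_edges i. R_op v (bubble t))"
    by (simp add: face_bubble_sum_def)
  then show ?thesis
    unfolding cor_bubble_def bubble_def by (simp add: case_prod_unfold)
qed

text \<open>
  On the edges the gradient of the cubic bubble is the sum of the three products of two coordinates
  times the gradient of the third, and the gradients of the three edge bubbles cancel it term by term.
  At the barycenter of its face the cubic bubble is 1 / 27 and each edge bubble is
  \<open>(1 / 3)\<^sup>5 / (2 / 3)\<^sup>2 = 1 / 108\<close>.
\<close>

lemma cor_bubble_data:
  assumes i: "i \<in> II"
  shows "\<exists>V. boundary_data skeleton (cor_bubble v i) V (\<lambda>_. 0) \<and>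
    (\<forall>p\<in>skeleton. V p = 0) \<and> (\<forall>j\<in>II. V (mid_face v j) = (if i = j then 1 / 108 else 0))"
proof -
  obtain a b c where abc: "a < b" "b < c" "JJ i = {a, b, c}" using JJ_sorted[OF i] .
  have II: "a \<in> II" "b \<in> II" "c \<in> II" "i \<noteq> a" "i \<noteq> b" "i \<noteq> c" "II = {i, a, b, c}"
    using abc(3) i unfolding JJ_def by blast+
  have ne: "a \<noteq> b" "a \<noteq> c" "b \<noteq> c" using abc by auto
  have idx: "(a, b, c) \<in> bubble_index" "(a, c, b) \<in> bubble_index" "(b, c, a) \<in> bubble_index"
    using face_edges_subset[OF i] face_edges_eq[OF i abc] by auto
  define V where "V = (\<lambda>p. bary v a p * bary v b p * bary v c p +
    - 1 * (bubble_val (a, b, c) p + (bubble_val (a, c, b) p + bubble_val (b, c, a) p)))"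
  define B where "B = (\<lambda>p. (bary v a p * bary v b p) *\<^sub>R bgrad c + (bary v a p * bary v c p) *\<^sub>R bgrad b +
    (bary v b p * bary v c p) *\<^sub>R bgrad a)"
  define H where "H = (\<lambda>p. B p + (- 1) *\<^sub>R (bubble_grad (a, b, c) p + (bubble_grad (a, c, b) p + bubble_grad (b, c, a) p)))"
  have fs: "face_bubble_sum i = bubble (a, b, c) + (bubble (a, c, b) + bubble (b, c, a))"
    unfolding face_bubble_sum_def face_edges_eq[OF i abc] using ne by simp
  have "boundary_data (tet v) (face_bubble_sum i)
      (\<lambda>p. bubble_val (a, b, c) p + (bubble_val (a, c, b) p + bubble_val (b, c, a) p))
      (\<lambda>p. bubble_grad (a, b, c) p + (bubble_grad (a, c, b) p + bubble_grad (b, c, a) p))"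
    unfolding fs by (intro boundary_data_add bubble_data idx)
  then have "boundary_data skeleton (R_op v (face_bubble_sum i))
      (\<lambda>p. bubble_val (a, b, c) p + (bubble_val (a, c, b) p + bubble_val (b, c, a) p))
      (\<lambda>p. bubble_grad (a, b, c) p + (bubble_grad (a, c, b) p + bubble_grad (b, c, a) p))"
    by (rule R_op_data[OF face_bubble_sum_in_Ze[OF i]])
  from boundary_data_add[OF face_bubble_data[OF i abc] boundary_data_scaleR[OF this, of "- 1"]]
  have "boundary_data skeleton (face_bubble v i + (- 1) *\<^sub>R R_op v (face_bubble_sum i)) V H"
    unfolding V_def H_def B_def .
  moreover have "face_bubble v i + (- 1) *\<^sub>R R_op v (face_bubble_sum i) = cor_bubble v i"
    unfolding cor_bubble_eq[OF i] by simp
  moreover have H0: "H p = 0" if "p \<in> skeleton" for p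
    unfolding H_def B_def bubble_on_skeleton(2)[OF idx(1) that] bubble_on_skeleton(2)[OF idx(2) that]
      bubble_on_skeleton(2)[OF idx(3) that] by simp
  ultimately have 1: "boundary_data skeleton (cor_bubble v i) V (\<lambda>_. 0)"
    using boundary_data_cong[of skeleton "cor_bubble v i" V H V "\<lambda>_. 0"] by simp
  have 2: "V p = 0" if p: "p \<in> skeleton" for p
  proof -
    obtain r s where "r \<in> II" "s \<in> II" "r \<noteq> s" "bary v r p = 0" "bary v s p = 0"
      using p unfolding skeleton_def by blast
    then have "bary v a p = 0 \<or> bary v b p = 0 \<or> bary v c p = 0"
      unfolding II(7) by auto
    then have "bary v a p * bary v b p * bary v c p = 0"
      by (elim disjE) simp_all
    then show ?thesis
      unfolding V_def bubble_on_skeleton(1)[OF idx(1) p] bubble_on_skeleton(1)[OF idx(2) p]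
        bubble_on_skeleton(1)[OF idx(3) p] by simp
  qed
  have 3: "V (mid_face v j) = (if i = j then 1 / 108 else 0)" if j: "j \<in> II" for j
  proof (cases "i = j")
    case True
    then have third: "bary v a (mid_face v j) = 1 / 3" "bary v b (mid_face v j) = 1 / 3" "bary v c (mid_face v j) = 1 / 3"
      using bary_mid_face[OF j] II(1-6) by simp_all
    then show ?thesis
      unfolding V_def bubble_val_def prod.case third using True by (simp add: power2_eq_square)
  next
    case False
    then have "bary v a (mid_face v j) = 0 \<or> bary v b (mid_face v j) = 0 \<or> bary v c (mid_face v j) = 0"
    proof -
      have "j = a \<or> j = b \<or> j = c" using j False unfolding II(7) by blast
      then show ?thesis using bary_mid_face[OF j] j by (elim disjE) simp_all
    qed
    then show ?thesis
      using False by (elim disjE) (simp_all add: V_def bubble_val_def)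
  qed
  show ?thesis using 1 2 3 by blast
qed

definition Ze_fun :: "(nat \<times> nat \<Rightarrow> real) \<Rightarrow> (nat \<times> nat \<times> nat \<Rightarrow> real) \<Rightarrow> real ^ 3 \<Rightarrow> real" where
  "Ze_fun a c = (\<Sum>s\<in>II \<times> II. a s *\<^sub>R herm s) + (\<Sum>t\<in>bubble_index. c t *\<^sub>R bubble t)"

lemma face_bubble_sum_combination_in_Ze: "(\<Sum>i\<in>II. \<beta> i *\<^sub>R face_bubble_sum i) \<in> Ze v"
  by (intro subspace_sum[OF subspace_Ze] subspace_scale[OF subspace_Ze] face_bubble_sum_in_Ze)

text \<open>
  Cubic and corrected bubbles differ by elements of the corrected space. This identity translates
  between the two descriptions of \<open>Z_cub\<close>.
\<close>

lemma R_op_add_face_bubble_sums: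
  assumes "y \<in> Ze v"
  shows "R_op v (y + (\<Sum>i\<in>II. \<beta> i *\<^sub>R face_bubble_sum i)) + (\<Sum>i\<in>II. \<beta> i *\<^sub>R cor_bubble v i) =
      R_op v y + (\<Sum>i\<in>II. \<beta> i *\<^sub>R face_bubble v i)"
proof -
  have s: "R_op v (\<Sum>i\<in>II. \<beta> i *\<^sub>R face_bubble_sum i) = (\<Sum>i\<in>II. \<beta> i *\<^sub>R R_op v (face_bubble_sum i))"
    using R_op_sum[OF finite_II, of face_bubble_sum \<beta>] face_bubble_sum_in_Ze by blast
  have "R_op v (1 *\<^sub>R y + (\<Sum>i\<in>II. \<beta> i *\<^sub>R face_bubble_sum i)) = 1 *\<^sub>R R_op v y + (\<Sum>i\<in>II. \<beta> i *\<^sub>R R_op v (face_bubble_sum i))"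
    unfolding R_op_linear[OF assms face_bubble_sum_combination_in_Ze] s ..
  moreover have "(\<Sum>i\<in>II. \<beta> i *\<^sub>R cor_bubble v i) =
      (\<Sum>i\<in>II. \<beta> i *\<^sub>R face_bubble v i) - (\<Sum>i\<in>II. \<beta> i *\<^sub>R R_op v (face_bubble_sum i))"
    by (simp add: cor_bubble_eq scaleR_diff_right sum_subtractf)
  ultimately show ?thesis by simp
qed

lemma Ze_fun_in_Ze: "Ze_fun a c \<in> Ze v"
  unfolding Ze_fun_def by (rule Ze_combination)

definition cub_fun :: "(nat \<times> nat \<Rightarrow> real) \<Rightarrow> (nat \<times> nat \<times> nat \<Rightarrow> real) \<Rightarrow> (nat \<Rightarrow> real) \<Rightarrow> real ^ 3 \<Rightarrow> real" where
  "cub_fun a c \<beta> = R_op v (Ze_fun a c) + (\<Sum>i\<in>II. \<beta> i *\<^sub>R cor_bubble v i)"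

lemma cub_fun_in_Z_cub: "cub_fun a c \<beta> \<in> Z_cub v"
proof -
  let ?y = "Ze_fun a c - (\<Sum>i\<in>II. \<beta> i *\<^sub>R face_bubble_sum i)"
  have y: "?y \<in> Ze v"
    by (intro subspace_diff[OF subspace_Ze] Ze_fun_in_Ze face_bubble_sum_combination_in_Ze)
  have "cub_fun a c \<beta> = R_op v ?y + (\<Sum>i\<in>II. \<beta> i *\<^sub>R face_bubble v i)"
    using R_op_add_face_bubble_sums[OF y, of \<beta>] by (simp add: cub_fun_def)
  also have "\<dots> \<in> Z_cub v"
    unfolding Z_cub_def Z_sing_def B_cub_def using y
    by (intro set_plus_intro imageI span_sum span_scale span_base)
  finally show ?thesis .
qed

lemma Z_cub_expansion:
  assumes "z \<in> Z_cub v"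
  obtains a c \<beta> where "z = cub_fun a c \<beta>"
proof -
  obtain r b where rb: "r \<in> Z_sing v" "b \<in> B_cub v" "z = r + b"
    using assms unfolding Z_cub_def by (rule set_plus_elim)
  then obtain y where y: "y \<in> Ze v" "r = R_op v y"
    by (auto simp: Z_sing_def)
  obtain \<beta> where \<beta>: "b = (\<Sum>i\<in>II. \<beta> i *\<^sub>R face_bubble v i)"
    using span_image_sum[OF finite_II] rb(2) unfolding B_cub_def by blast
  have "y + (\<Sum>i\<in>II. \<beta> i *\<^sub>R face_bubble_sum i) \<in> Ze v"
    using y(1) by (intro subspace_add[OF subspace_Ze] face_bubble_sum_combination_in_Ze)
  then obtain a c where ac: "y + (\<Sum>i\<in>II. \<beta> i *\<^sub>R face_bubble_sum i) = Ze_fun a c"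
    unfolding Ze_fun_def by (rule Ze_expansion)
  have "z = cub_fun a c \<beta>"
    unfolding cub_fun_def ac[symmetric] R_op_add_face_bubble_sums[OF y(1)] rb(3) y(2) \<beta> ..
  then show ?thesis by (rule that)
qed

end

section \<open>Unisolvence\<close>

lemma linear_functional_on_sum:
  assumes N: "linear_functional_on Z N" and Z: "subspace Z" and "\<And>k. k \<in> K \<Longrightarrow> b k \<in> Z"
  shows "N (\<Sum>k\<in>K. c k *\<^sub>R b k) = (\<Sum>k\<in>K. c k * N (b k))"
  using assms(3)
proof (induction K rule: infinite_finite_induct)
  case (insert k K)
  have b: "b k \<in> Z" "(\<Sum>k\<in>K. c k *\<^sub>R b k) \<in> Z"
    using insert.prems by (auto intro!: subspace_sum[OF Z] subspace_scale[OF Z])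
  have "N (c k *\<^sub>R b k + (\<Sum>k\<in>K. c k *\<^sub>R b k)) = N (c k *\<^sub>R b k) + N (\<Sum>k\<in>K. c k *\<^sub>R b k)"
    using N b subspace_scale[OF Z b(1)] unfolding linear_functional_on_def by blast
  moreover have "N (c k *\<^sub>R b k) = c k * N (b k)"
    using N b unfolding linear_functional_on_def by blast
  moreover have "N (\<Sum>k\<in>K. c k *\<^sub>R b k) = (\<Sum>k\<in>K. c k * N (b k))"
    using insert by blast
  ultimately show ?case
    unfolding sum.insert[OF insert.hyps] by (simp only:)
next
  have "N (0 *\<^sub>R 0) = 0 * N 0"
    using N subspace_0[OF Z] unfolding linear_functional_on_def by blast
  then have "N 0 = 0" by simp
  then show "N (\<Sum>k\<in>{}. c k *\<^sub>R b k) = (\<Sum>k\<in>{}. c k * N (b k))"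
    "infinite K \<Longrightarrow> N (\<Sum>k\<in>K. c k *\<^sub>R b k) = (\<Sum>k\<in>K. c k * N (b k))" for K
    by simp_all
qed

text \<open>
  The preimages of the unit vectors are a basis: the functionals are their coordinates.
\<close>

lemma unisolvent_dim:
  assumes U: "unisolvent Ns Z"
  shows "dim Z = length Ns"
proof -
  define n where "n = length Ns"
  define f where "f = (\<lambda>z. map (\<lambda>N. N z) Ns)"
  have Z: "subspace Z" and N: "\<And>k. k < n \<Longrightarrow> linear_functional_on Z (Ns ! k)"
    and bij: "bij_betw f Z {c. length c = n}"
    using U by (auto simp: unisolvent_def f_def n_def)
  define b where "b = (\<lambda>k. inv_into Z f ((replicate n 0)[k := 1]))"
  have surj: "f ` Z = {c. length c = n}" and inj: "inj_on f Z"
    using bij by (auto simp: bij_betw_def)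
  have mem: "(replicate n 0)[k := 1] \<in> f ` Z" for k
    unfolding surj by simp
  have bZ: "b k \<in> Z" and fb: "f (b k) = (replicate n 0)[k := 1]" for k
    unfolding b_def by (rule inv_into_into[OF mem], rule f_inv_into_f[OF mem])
  have dual: "(Ns ! j) (b k) = (if j = k then 1 else 0)" if "j < n" for j k
  proof -
    have "(Ns ! j) (b k) = f (b k) ! j"
      using that by (simp add: f_def n_def)
    then show ?thesis
      unfolding fb using that by (simp add: nth_list_update)
  qed
  have comb: "(Ns ! j) (\<Sum>k<n. c k *\<^sub>R b k) = c j" if "j < n" for j c
    using that by (simp add: linear_functional_on_sum[OF N[OF that] Z] bZ dual if_distrib cong: if_cong)
  have combZ: "(\<Sum>k<n. c k *\<^sub>R b k) \<in> Z" for c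
    by (intro subspace_sum[OF Z] subspace_scale[OF Z] bZ)
  have inj_b: "inj_on b {..<n}"
    by (rule inj_onI) (metis dual lessThan_iff zero_neq_one)
  show ?thesis
    unfolding n_def[symmetric]
  proof (rule real_vector.dim_unique)
    show "b ` {..<n} \<subseteq> Z" using bZ by auto
    show "Z \<subseteq> span (b ` {..<n})"
    proof
      fix z assume z: "z \<in> Z"
      have "f z = f (\<Sum>k<n. (Ns ! k) z *\<^sub>R b k)"
        using comb by (intro nth_equalityI) (simp_all add: f_def n_def)
      then have "z = (\<Sum>k<n. (Ns ! k) z *\<^sub>R b k)"
        using inj z combZ by (auto dest: inj_onD)
      moreover have "(\<Sum>k<n. (Ns ! k) z *\<^sub>R b k) \<in> span (b ` {..<n})"
        by (intro span_sum span_scale span_base imageI)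
      ultimately show "z \<in> span (b ` {..<n})" by simp
    qed
    show "card (b ` {..<n}) = n" using inj_b by (simp add: card_image)
    show "independent (b ` {..<n})"
    proof (rule real_vector.independent_if_scalars_zero)
      fix u x assume "(\<Sum>x\<in>b ` {..<n}. u x *\<^sub>R x) = 0" "x \<in> b ` {..<n}"
      then obtain j where j: "j < n" "x = b j" and s: "(\<Sum>k<n. u (b k) *\<^sub>R b k) = 0"
        using inj_b by (auto simp: sum.reindex)
      have "u (b j) = (Ns ! j) (\<Sum>k<n. 0 *\<^sub>R b k)"
        using comb[OF j(1), of "\<lambda>k. u (b k)"] s by simp
      also have "\<dots> = 0"
        using comb[OF j(1), of "\<lambda>_. 0"] by simp
      finally show "u x = 0" using j by simp
    qed simp
  qed
qed

text \<open>
  Two independent vectors orthogonal to d form, together with d, a basis of the space, so the products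
  with these three vectors can be prescribed, and they determine a vector.
\<close>

lemma orthogonal_frame:
  fixes e1 e2 d :: "real ^ 3"
  assumes "e1 \<noteq> e2" "independent {e1, e2}" "e1 \<bullet> d = 0" "e2 \<bullet> d = 0" "d \<noteq> 0"
  shows "\<exists>w. w \<bullet> e1 = r1 \<and> w \<bullet> e2 = r2 \<and> w \<bullet> d = 0"
    and "u \<bullet> e1 = 0 \<Longrightarrow> u \<bullet> e2 = 0 \<Longrightarrow> u \<bullet> d = 0 \<Longrightarrow> u = 0"
proof -
  have "d \<notin> span {e1, e2}"
  proof
    assume "d \<in> span {e1, e2}"
    then have "orthogonal d d"
      using assms(3,4) by (intro orthogonal_to_span[of d "{e1, e2}"]) (auto simp: orthogonal_def inner_commute)
    then show False using assms(5) by (simp add: orthogonal_def)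
  qed
  then have ind: "independent {d, e1, e2}" and d: "d \<noteq> e1" "d \<noteq> e2"
    using assms(2) by (auto simp: independent_insert span_base)
  define h where "h = (\<lambda>x. if x = e1 then r1 else if x = e2 then r2 else 0)"
  obtain f where f: "linear f" "\<forall>x\<in>{d, e1, e2}. f x = h x"
    using linear_independent_extend[OF ind, of h] by blast
  have "f x = x \<bullet> adjoint f 1" for x
    using adjoint_works[OF f(1), of x 1] by simp
  then have "adjoint f 1 \<bullet> e1 = r1" "adjoint f 1 \<bullet> e2 = r2" "adjoint f 1 \<bullet> d = 0"
    using f(2) d assms(1) by (auto simp: h_def inner_commute)
  then show "\<exists>w. w \<bullet> e1 = r1 \<and> w \<bullet> e2 = r2 \<and> w \<bullet> d = 0" by blast
  assume u: "u \<bullet> e1 = 0" "u \<bullet> e2 = 0" "u \<bullet> d = 0"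
  have "card {d, e1, e2} = DIM(real ^ 3)"
    using d assms(1) by simp
  then have "span {d, e1, e2} = UNIV"
    using ind card_eq_dim[of "{d, e1, e2}" UNIV] by (metis dim_UNIV dim_eq_full dim_eq_card_independent)
  then have "orthogonal u u"
    using u by (intro orthogonal_to_span[of u "{d, e1, e2}"]) (auto simp: orthogonal_def)
  then show "u = 0" by (simp add: orthogonal_def)
qed

context tetrahedron
begin

lemma herm_at_vertex:
  assumes "i \<in> II" "j \<in> II" "k \<in> II"
  shows "herm_poly (i, j) (v k) = (if i = k \<and> j = k then 1 else 0)"
    and "herm_grad (i, j) (v k) = (if i = k then (if j = k then 2 else 1) *\<^sub>R bgrad j else 0)"
  using assms by (auto simp: herm_poly_def herm_grad_def bary_vertex)

definition Ze_fun_val :: "(nat \<times> nat \<Rightarrow> real) \<Rightarrow> (nat \<times> nat \<times> nat \<Rightarrow> real) \<Rightarrow> real ^ 3 \<Rightarrow> real" where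
  "Ze_fun_val a c p = (\<Sum>s\<in>II \<times> II. a s * herm_poly s p) + (\<Sum>t\<in>bubble_index. c t * bubble_val t p)"

definition Ze_fun_grad :: "(nat \<times> nat \<Rightarrow> real) \<Rightarrow> (nat \<times> nat \<times> nat \<Rightarrow> real) \<Rightarrow> real ^ 3 \<Rightarrow> real ^ 3" where
  "Ze_fun_grad a c p = (\<Sum>s\<in>II \<times> II. a s *\<^sub>R herm_grad s p) + (\<Sum>t\<in>bubble_index. c t *\<^sub>R bubble_grad t p)"

lemma cub_fun_data:
  "\<exists>V. boundary_data skeleton (cub_fun a c \<beta>) V (Ze_fun_grad a c) \<and>
    (\<forall>p\<in>skeleton. V p = Ze_fun_val a c p) \<and>
    (\<forall>j\<in>II. V (mid_face v j) = Ze_fun_val a c (mid_face v j) + \<beta> j / 108)"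
proof -
  have "\<forall>i\<in>II. \<exists>V. boundary_data skeleton (cor_bubble v i) V (\<lambda>_. 0) \<and>
      (\<forall>p\<in>skeleton. V p = 0) \<and> (\<forall>j\<in>II. V (mid_face v j) = (if i = j then 1 / 108 else 0))"
    using cor_bubble_data by (rule ballI)
  from bchoice[OF this] obtain W where W: "\<forall>i\<in>II. boundary_data skeleton (cor_bubble v i) (W i) (\<lambda>_. 0) \<and>
      (\<forall>p\<in>skeleton. W i p = 0) \<and> (\<forall>j\<in>II. W i (mid_face v j) = (if i = j then 1 / 108 else 0))" ..
  have R: "boundary_data skeleton (R_op v (Ze_fun a c)) (Ze_fun_val a c) (Ze_fun_grad a c)"
    using Ze_data[of a c] unfolding Ze_fun_def[symmetric] Ze_fun_val_def[symmetric] Ze_fun_grad_def[symmetric]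
    by (rule R_op_data[OF Ze_fun_in_Ze])
  have S: "boundary_data skeleton (\<Sum>i\<in>II. \<beta> i *\<^sub>R cor_bubble v i) (\<lambda>p. \<Sum>i\<in>II. \<beta> i * W i p) (\<lambda>p. \<Sum>i\<in>II. \<beta> i *\<^sub>R 0)"
    using W by (intro boundary_data_sum) blast
  show ?thesis
  proof (intro exI[of _ "\<lambda>p. Ze_fun_val a c p + (\<Sum>i\<in>II. \<beta> i * W i p)"] conjI ballI)
    show "boundary_data skeleton (cub_fun a c \<beta>) (\<lambda>p. Ze_fun_val a c p + (\<Sum>i\<in>II. \<beta> i * W i p)) (Ze_fun_grad a c)"
      using boundary_data_add[OF R S] unfolding cub_fun_def[symmetric] by simp
    show "Ze_fun_val a c p + (\<Sum>i\<in>II. \<beta> i * W i p) = Ze_fun_val a c p" if "p \<in> skeleton" for p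
      using W that by simp
    fix j assume j: "j \<in> II"
    have "(\<Sum>i\<in>II. \<beta> i * W i (mid_face v j)) = (\<Sum>i\<in>II. if i = j then \<beta> j / 108 else 0)"
      using W j by (intro sum.cong refl) auto
    then show "Ze_fun_val a c (mid_face v j) + (\<Sum>i\<in>II. \<beta> i * W i (mid_face v j)) = Ze_fun_val a c (mid_face v j) + \<beta> j / 108"
      using j by simp
  qed
qed

lemma Z_cub_data:
  assumes "z \<in> Z_cub v"
  shows "\<exists>V H. boundary_data skeleton z V H"
proof -
  obtain a c \<beta> where "z = cub_fun a c \<beta>" using assms by (rule Z_cub_expansion)
  then show ?thesis using cub_fun_data by blast
qed

lemma bd_cub_fun:
  "p \<in> skeleton \<Longrightarrow> bd_value v (cub_fun a c \<beta>) p = Ze_fun_val a c p"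
  "p \<in> skeleton \<Longrightarrow> bd_grad v (cub_fun a c \<beta>) p = Ze_fun_grad a c p"
  "i \<in> II \<Longrightarrow> bd_value v (cub_fun a c \<beta>) (mid_face v i) = Ze_fun_val a c (mid_face v i) + \<beta> i / 108"
proof -
  obtain V where V: "boundary_data skeleton (cub_fun a c \<beta>) V (Ze_fun_grad a c)"
    "\<forall>p\<in>skeleton. V p = Ze_fun_val a c p"
    "\<forall>j\<in>II. V (mid_face v j) = Ze_fun_val a c (mid_face v j) + \<beta> j / 108"
    using cub_fun_data by blast
  show "bd_value v (cub_fun a c \<beta>) p = Ze_fun_val a c p" "bd_grad v (cub_fun a c \<beta>) p = Ze_fun_grad a c p"
    if p: "p \<in> skeleton" for p
  proof -
    have p': "p \<in> tet v - tet_int v" using p skeleton_subset by blast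
    show "bd_value v (cub_fun a c \<beta>) p = Ze_fun_val a c p"
      using bd_value_eqI[OF V(1) p'] V(2) p by simp
    show "bd_grad v (cub_fun a c \<beta>) p = Ze_fun_grad a c p"
      using bd_grad_eqI[OF V(1) p] p' by simp
  qed
  show "bd_value v (cub_fun a c \<beta>) (mid_face v i) = Ze_fun_val a c (mid_face v i) + \<beta> i / 108" if "i \<in> II" for i
    using bd_value_eqI[OF V(1) mid_face_in_boundary[OF that]] V(3) that by simp
qed

lemma Ze_fun_at_vertex:
  assumes k: "k \<in> II"
  shows "Ze_fun_val a c (v k) = a (k, k)"
    and "Ze_fun_grad a c (v k) = (\<Sum>j\<in>II. ((if j = k then 2 else 1) * a (k, j)) *\<^sub>R bgrad j)"
proof -
  have prod: "(\<Sum>s\<in>II \<times> II. F s) = (\<Sum>i\<in>II. \<Sum>j\<in>II. F (i, j))" for F :: "nat \<times> nat \<Rightarrow> 'b::comm_monoid_add"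
    by (simp add: sum.cartesian_product)
  have sk: "v k \<in> skeleton" using k by (rule vertex_in_skeleton)
  have bub: "bubble_val t (v k) = 0 \<and> bubble_grad t (v k) = 0" if "t \<in> bubble_index" for t
  proof -
    obtain l m n where t: "t = (l, m, n)" by (cases t)
    have "bary v l (v k) * bary v m (v k) = 0"
      using bubble_indexD[of l m n] that k by (auto simp: t bary_vertex)
    then show ?thesis
      using bubble_on_skeleton[of l m n "v k"] that sk by (simp add: t)
  qed
  have "Ze_fun_val a c (v k) = (\<Sum>i\<in>II. \<Sum>j\<in>II. a (i, j) * herm_poly (i, j) (v k))"
    using bub by (simp add: Ze_fun_val_def prod)
  also have "\<dots> = (\<Sum>i\<in>II. if i = k then \<Sum>j\<in>II. if j = k then a (i, j) else 0 else 0)"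
    by (intro sum.cong refl) (auto simp: herm_at_vertex k simp del: sum.delta intro!: sum.cong sum.neutral)
  also have "\<dots> = a (k, k)" using k by simp
  finally show "Ze_fun_val a c (v k) = a (k, k)" .
  have "Ze_fun_grad a c (v k) = (\<Sum>i\<in>II. \<Sum>j\<in>II. a (i, j) *\<^sub>R herm_grad (i, j) (v k))"
    using bub by (simp add: Ze_fun_grad_def prod)
  also have "\<dots> = (\<Sum>i\<in>II. if i = k then \<Sum>j\<in>II. ((if j = k then 2 else 1) * a (k, j)) *\<^sub>R bgrad j else 0)"
    by (intro sum.cong refl) (auto simp: herm_at_vertex k mult.commute intro!: sum.cong sum.neutral)
  also have "\<dots> = (\<Sum>j\<in>II. ((if j = k then 2 else 1) * a (k, j)) *\<^sub>R bgrad j)" using k by simp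
  finally show "Ze_fun_grad a c (v k) = (\<Sum>j\<in>II. ((if j = k then 2 else 1) * a (k, j)) *\<^sub>R bgrad j)" .
qed

definition herm_edge_grad :: "(nat \<times> nat \<Rightarrow> real) \<Rightarrow> nat \<Rightarrow> nat \<Rightarrow> real ^ 3" where
  "herm_edge_grad a l m = (\<Sum>s\<in>II \<times> II. a s *\<^sub>R herm_grad s (midpoint (v l) (v m)))"

text \<open>
  On the open edge from l to m only the two bubbles of this edge have a nonzero gradient.
\<close>

lemma Ze_fun_grad_at_midpoint:
  assumes "l < m" "m \<le> 3"
  shows "Ze_fun_grad a c (midpoint (v l) (v m)) =
    herm_edge_grad a l m + (1 / 4) *\<^sub>R (\<Sum>n\<in>II - {l, m}. c (l, m, n) *\<^sub>R bgrad n)"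
proof -
  have lm: "l \<in> II" "m \<in> II" "l \<noteq> m" using assms by (auto simp: mem_II_iff)
  let ?p = "midpoint (v l) (v m)"
  let ?K = "(\<lambda>n. (l, m, n)) ` (II - {l, m})"
  have K: "?K \<subseteq> bubble_index" using assms by (auto simp: bubble_index_def)
  have bub: "bubble_grad (l', m', n) ?p = (if l' = l \<and> m' = m then (1 / 4) *\<^sub>R bgrad n else 0)"
    if t: "(l', m', n) \<in> bubble_index" for l' m' n
  proof -
    note d = bubble_indexD[OF t]
    have "bary v l' ?p * bary v m' ?p = (if l' = l \<and> m' = m then 1 / 4 else 0)"
      using bary_midpoint[OF lm d(1)] bary_midpoint[OF lm d(2)] d(7) assms(1) by auto
    then show ?thesis
      using bubble_on_skeleton(2)[OF t midpoint_in_skeleton[OF lm]] by simp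
  qed
  have "(\<Sum>t\<in>bubble_index. c t *\<^sub>R bubble_grad t ?p) = (\<Sum>t\<in>?K. c t *\<^sub>R bubble_grad t ?p)"
  proof (rule sum.mono_neutral_right[OF finite_bubble_index K], rule ballI)
    fix t assume "t \<in> bubble_index - ?K"
    moreover obtain l' m' n where t: "t = (l', m', n)" by (cases t)
    ultimately have t': "(l', m', n) \<in> bubble_index" "(l', m', n) \<notin> ?K" by auto
    then have "\<not> (l' = l \<and> m' = m)"
      by (auto simp: bubble_index_def)
    then show "c t *\<^sub>R bubble_grad t ?p = 0"
      unfolding t bub[OF t'(1)] by auto
  qed
  also have "\<dots> = (\<Sum>n\<in>II - {l, m}. c (l, m, n) *\<^sub>R bubble_grad (l, m, n) ?p)"
    by (subst sum.reindex) (auto simp: inj_on_def)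
  also have "\<dots> = (\<Sum>n\<in>II - {l, m}. (1 / 4) *\<^sub>R (c (l, m, n) *\<^sub>R bgrad n))"
  proof (rule sum.cong[OF refl])
    fix n assume "n \<in> II - {l, m}"
    then have "(l, m, n) \<in> bubble_index" using K by blast
    then show "c (l, m, n) *\<^sub>R bubble_grad (l, m, n) ?p = (1 / 4) *\<^sub>R (c (l, m, n) *\<^sub>R bgrad n)"
      by (simp add: bub)
  qed
  finally show ?thesis
    unfolding Ze_fun_grad_def herm_edge_grad_def by (simp add: scaleR_sum_right)
qed

definition Ze_fun_facet :: "(nat \<times> nat \<Rightarrow> real) \<Rightarrow> (nat \<times> nat \<times> nat \<Rightarrow> real) \<Rightarrow> nat \<Rightarrow> real" where
  "Ze_fun_facet a c i = 6 * Ze_fun_val a c (mid_face v i) - 2 * (\<Sum>j\<in>JJ i. Ze_fun_val a c (v j)) +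
    (\<Sum>j\<in>JJ i. Ze_fun_grad a c (v j) \<bullet> (v j - mid_face v i))"

text \<open>
  The corrected bubbles enter the facet functional through the barycenter of the face only, with weight
  6 / 108.
\<close>

lemma facet_functional_cub_fun:
  assumes i: "i \<in> II"
  shows "facet_functional v i (cub_fun a c \<beta>) = Ze_fun_facet a c i + \<beta> i / 18"
proof -
  have "v j \<in> skeleton" if "j \<in> JJ i" for j
    using that vertex_in_skeleton by (simp add: JJ_def)
  then have "(\<Sum>j\<in>JJ i. bd_value v (cub_fun a c \<beta>) (v j)) = (\<Sum>j\<in>JJ i. Ze_fun_val a c (v j))"
    "(\<Sum>j\<in>JJ i. bd_grad v (cub_fun a c \<beta>) (v j) \<bullet> (v j - mid_face v i)) =
      (\<Sum>j\<in>JJ i. Ze_fun_grad a c (v j) \<bullet> (v j - mid_face v i))"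
    by (simp_all add: bd_cub_fun)
  then show ?thesis
    unfolding facet_functional_def Ze_fun_facet_def bd_cub_fun(3)[OF i] by (simp add: field_simps)
qed

lemma Ze_fun_zero:
  assumes "\<And>s. s \<in> II \<times> II \<Longrightarrow> a s = 0" "\<And>t. t \<in> bubble_index \<Longrightarrow> c t = 0"
  shows "Ze_fun a c = 0" "Ze_fun_facet a c i = 0"
  using assms by (simp_all add: Ze_fun_def Ze_fun_facet_def Ze_fun_val_def Ze_fun_grad_def)

lemma herm_edge_grad_zero:
  assumes "\<And>s. s \<in> II \<times> II \<Longrightarrow> a s = 0"
  shows "herm_edge_grad a l m = 0"
  using assms by (simp add: herm_edge_grad_def)

end

lemma dofs_unfold:
  "dofs v \<gamma> =
    [\<lambda>z. bd_value v z (v 0), \<lambda>z. bd_value v z (v 1), \<lambda>z. bd_value v z (v 2), \<lambda>z. bd_value v z (v 3)] @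
    [\<lambda>z. bd_grad v z (v 0) $ 1, \<lambda>z. bd_grad v z (v 0) $ 2, \<lambda>z. bd_grad v z (v 0) $ 3,
     \<lambda>z. bd_grad v z (v 1) $ 1, \<lambda>z. bd_grad v z (v 1) $ 2, \<lambda>z. bd_grad v z (v 1) $ 3,
     \<lambda>z. bd_grad v z (v 2) $ 1, \<lambda>z. bd_grad v z (v 2) $ 2, \<lambda>z. bd_grad v z (v 2) $ 3,
     \<lambda>z. bd_grad v z (v 3) $ 1, \<lambda>z. bd_grad v z (v 3) $ 2, \<lambda>z. bd_grad v z (v 3) $ 3] @
    [\<lambda>z. 4 * (bd_grad v z (midpoint (v 0) (v 1)) \<bullet> \<gamma> 0 1 0), \<lambda>z. 4 * (bd_grad v z (midpoint (v 0) (v 1)) \<bullet> \<gamma> 0 1 1),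
     \<lambda>z. 4 * (bd_grad v z (midpoint (v 0) (v 2)) \<bullet> \<gamma> 0 2 0), \<lambda>z. 4 * (bd_grad v z (midpoint (v 0) (v 2)) \<bullet> \<gamma> 0 2 1),
     \<lambda>z. 4 * (bd_grad v z (midpoint (v 0) (v 3)) \<bullet> \<gamma> 0 3 0), \<lambda>z. 4 * (bd_grad v z (midpoint (v 0) (v 3)) \<bullet> \<gamma> 0 3 1),
     \<lambda>z. 4 * (bd_grad v z (midpoint (v 1) (v 2)) \<bullet> \<gamma> 1 2 0), \<lambda>z. 4 * (bd_grad v z (midpoint (v 1) (v 2)) \<bullet> \<gamma> 1 2 1),
     \<lambda>z. 4 * (bd_grad v z (midpoint (v 1) (v 3)) \<bullet> \<gamma> 1 3 0), \<lambda>z. 4 * (bd_grad v z (midpoint (v 1) (v 3)) \<bullet> \<gamma> 1 3 1),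
     \<lambda>z. 4 * (bd_grad v z (midpoint (v 2) (v 3)) \<bullet> \<gamma> 2 3 0), \<lambda>z. 4 * (bd_grad v z (midpoint (v 2) (v 3)) \<bullet> \<gamma> 2 3 1)] @
    [facet_functional v 0, facet_functional v 1, facet_functional v 2, facet_functional v 3]"
  by (simp add: dofs_def)

lemma length_dofs: "length (dofs v \<gamma>) = 32"
  by (simp add: dofs_unfold)

text \<open>
  The four groups of functionals as families, so that statements about them need no case distinction
  over the list entries.
\<close>

lemma set_dofs:
  "set (dofs v \<gamma>) = (\<lambda>k z. bd_value v z (v k)) ` II \<union> (\<lambda>(k, r) z. bd_grad v z (v k) $ r) ` (II \<times> UNIV) \<union>
    (\<lambda>(l, m, j) z. 4 * (bd_grad v z (midpoint (v l) (v m)) \<bullet> \<gamma> l m j)) ` {(l, m, j). l < m \<and> m \<le> 3 \<and> j \<in> {0, 1}} \<union>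
    facet_functional v ` II"
proof -
  have pairs: "set (concat (map (\<lambda>k. map (f k) rs) ks)) = (\<lambda>(k, r). f k r) ` (set ks \<times> set rs)"
    for f :: "nat \<Rightarrow> 3 \<Rightarrow> 'b" and ks rs
    by (auto simp: image_iff)
  have triples: "set (concat (map (\<lambda>(l, m). map (g l m) js) es)) = (\<lambda>(l, m, j). g l m j) ` {(l, m, j). (l, m) \<in> set es \<and> j \<in> set js}"
    for g :: "nat \<Rightarrow> nat \<Rightarrow> nat \<Rightarrow> 'b" and es js
  proof (intro equalityI subsetI)
    fix y assume "y \<in> set (concat (map (\<lambda>(l, m). map (g l m) js) es))"
    then obtain l m j where "(l, m) \<in> set es" "j \<in> set js" "y = g l m j" by auto
    then show "y \<in> (\<lambda>(l, m, j). g l m j) ` {(l, m, j). (l, m) \<in> set es \<and> j \<in> set js}"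
      by (intro image_eqI[where x = "(l, m, j)"]) simp_all
  next
    fix y assume "y \<in> (\<lambda>(l, m, j). g l m j) ` {(l, m, j). (l, m) \<in> set es \<and> j \<in> set js}"
    then obtain l m j where "(l, m) \<in> set es" "j \<in> set js" "y = g l m j" by auto
    then show "y \<in> set (concat (map (\<lambda>(l, m). map (g l m) js) es))"
      by (auto intro!: bexI[of _ "(l, m)"])
  qed
  have E: "{(l, m, j). (l, m) \<in> set [(0, 1), (0, 2), (0, 3), (1, 2), (1, 3), (2, 3)] \<and> j \<in> set [0, 1]} =
      {(l, m, j). l < m \<and> m \<le> (3::nat) \<and> j \<in> {0, 1::nat}}"
    by auto
  have lists: "set [0, 1, 2, 3] = II" "set [1, 2, 3] = (UNIV :: 3 set)"
    by (simp_all add: II_def UNIV_3)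
  show ?thesis
    unfolding dofs_def set_append pairs triples E set_map lists by (simp only: Un_assoc)
qed

locale framed_tetrahedron = tetrahedron +
  fixes \<gamma> :: "nat \<Rightarrow> nat \<Rightarrow> nat \<Rightarrow> real ^ 3"
  assumes frame_perp: "\<And>l m. l < m \<Longrightarrow> m \<le> 3 \<Longrightarrow> \<gamma> l m 0 \<in> edge_perp v l m \<and> \<gamma> l m 1 \<in> edge_perp v l m"
    and frame_independent: "\<And>l m. l < m \<Longrightarrow> m \<le> 3 \<Longrightarrow> \<gamma> l m 0 \<noteq> \<gamma> l m 1 \<and> independent {\<gamma> l m 0, \<gamma> l m 1}"
begin

lemma edge_frame:
  assumes "l < m" "m \<le> 3"
  shows "\<exists>w. w \<bullet> \<gamma> l m 0 = r0 \<and> w \<bullet> \<gamma> l m 1 = r1 \<and> w \<bullet> (v m - v l) = 0"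
    and "u \<bullet> \<gamma> l m 0 = 0 \<Longrightarrow> u \<bullet> \<gamma> l m 1 = 0 \<Longrightarrow> u \<bullet> (v m - v l) = 0 \<Longrightarrow> u = 0"
proof -
  have "v m - v l \<noteq> 0"
    using inj_onD[OF inj_v, of m l] assms by (auto simp: mem_II_iff)
  moreover have "\<gamma> l m 0 \<bullet> (v m - v l) = 0" "\<gamma> l m 1 \<bullet> (v m - v l) = 0"
    using frame_perp[OF assms] by (auto simp: edge_perp_def orthogonal_def)
  ultimately show "\<exists>w. w \<bullet> \<gamma> l m 0 = r0 \<and> w \<bullet> \<gamma> l m 1 = r1 \<and> w \<bullet> (v m - v l) = 0"
    "u \<bullet> \<gamma> l m 0 = 0 \<Longrightarrow> u \<bullet> \<gamma> l m 1 = 0 \<Longrightarrow> u \<bullet> (v m - v l) = 0 \<Longrightarrow> u = 0"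
    using orthogonal_frame[of "\<gamma> l m 0" "\<gamma> l m 1" "v m - v l"] frame_independent[OF assms] by blast+
qed

text \<open>
  The vector w with the prescribed products is orthogonal to the edge. Expanded in the gradients of the
  barycentric coordinates, with the end l as base point, it has no component for the two ends.
\<close>

lemma edge_interpolation:
  assumes "l < m" "m \<le> 3"
  shows "\<exists>c. (\<Sum>n\<in>II - {l, m}. c n *\<^sub>R bgrad n) \<bullet> \<gamma> l m 0 = r0 \<and> (\<Sum>n\<in>II - {l, m}. c n *\<^sub>R bgrad n) \<bullet> \<gamma> l m 1 = r1"
proof -
  have lm: "l \<in> II" "m \<in> II" using assms by (auto simp: mem_II_iff)
  obtain w where w: "w \<bullet> \<gamma> l m 0 = r0" "w \<bullet> \<gamma> l m 1 = r1" "w \<bullet> (v m - v l) = 0"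
    using edge_frame(1)[OF assms] by blast
  have "w = (\<Sum>n\<in>II. (w \<bullet> (v n - v l)) *\<^sub>R bgrad n)"
    by (rule bgrad_expansion[OF lm(1)])
  also have "\<dots> = (\<Sum>n\<in>II - {l, m}. (w \<bullet> (v n - v l)) *\<^sub>R bgrad n)"
    using w(3) by (intro sum.mono_neutral_right) auto
  finally have "(\<Sum>n\<in>II - {l, m}. (w \<bullet> (v n - v l)) *\<^sub>R bgrad n) = w" ..
  then show ?thesis
    using w(1,2) by (intro exI[of _ "\<lambda>n. w \<bullet> (v n - v l)"]) simp
qed

lemma edge_unisolvent:
  assumes "l < m" "m \<le> 3" and n: "n \<in> II - {l, m}"
    and "(\<Sum>n\<in>II - {l, m}. c n *\<^sub>R bgrad n) \<bullet> \<gamma> l m 0 = 0" "(\<Sum>n\<in>II - {l, m}. c n *\<^sub>R bgrad n) \<bullet> \<gamma> l m 1 = 0"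
  shows "c n = 0"
proof -
  have lm: "l \<in> II" "m \<in> II" using assms by (auto simp: mem_II_iff)
  let ?u = "\<Sum>n\<in>II - {l, m}. c n *\<^sub>R bgrad n"
  have u: "?u \<bullet> (v k - v l) = (\<Sum>n\<in>II - {l, m}. if n = k then c n else 0)" if "k \<in> II" for k
    unfolding inner_sum_left using that lm
    by (intro sum.cong refl) (auto simp: bgrad_diff bary_vertex)
  have "?u \<bullet> (v m - v l) = 0"
    unfolding u[OF lm(2)] by (intro sum.neutral) auto
  then have "?u = 0"
    using edge_frame(2)[OF assms(1,2)] assms(4,5) by blast
  then have "?u \<bullet> (v n - v l) = 0"
    by simp
  then have "(\<Sum>k\<in>II - {l, m}. if k = n then c k else 0) = 0"
    using u[of n] n by simp
  then show ?thesis using n by simp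
qed

text \<open>
  The triangular system is solved by vertices, edges and faces in turn. The edge data are corrected by
  the contribution of the Hermite functions, and the facet data by the contribution of all functions that
  are already determined.
\<close>

lemma interpolation:
  shows "\<exists>z\<in>Z_cub v. (\<forall>k\<in>II. bd_value v z (v k) = r k) \<and> (\<forall>k\<in>II. bd_grad v z (v k) = G k) \<and>
    (\<forall>l m j. l < m \<longrightarrow> m \<le> 3 \<longrightarrow> j \<in> {0, 1} \<longrightarrow> 4 * (bd_grad v z (midpoint (v l) (v m)) \<bullet> \<gamma> l m j) = T l m j) \<and>
    (\<forall>i\<in>II. facet_functional v i z = F i)"
proof -
  \<comment> \<open>The value r k at vertex k brings the gradient 2 r k of coordinate k. The same amount is added for
    every j, which changes nothing as the gradients of the four coordinates have sum 0.\<close>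
  define a where "a = (\<lambda>(k, j). if j = k then r k else G k \<bullet> (v j - v k) + 2 * r k)"
  have vert: "Ze_fun_val a c (v k) = r k" "Ze_fun_grad a c (v k) = G k" if k: "k \<in> II" for k c
  proof -
    show "Ze_fun_val a c (v k) = r k"
      unfolding Ze_fun_at_vertex(1)[OF k] by (simp add: a_def)
    have "Ze_fun_grad a c (v k) = (\<Sum>j\<in>II. (G k \<bullet> (v j - v k)) *\<^sub>R bgrad j + (2 * r k) *\<^sub>R bgrad j)"
      unfolding Ze_fun_at_vertex(2)[OF k] by (intro sum.cong refl) (auto simp: a_def scaleR_add_left)
    also have "\<dots> = G k"
      using bgrad_expansion[OF k, of "G k"] sum_bgrad by (simp add: sum.distrib scaleR_sum_right[symmetric])
    finally show "Ze_fun_grad a c (v k) = G k" .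
  qed
  define P where "P = (\<lambda>l m d. (\<Sum>n\<in>II - {l, m}. d n *\<^sub>R bgrad n) \<bullet> \<gamma> l m 0 = T l m 0 - 4 * (herm_edge_grad a l m \<bullet> \<gamma> l m 0) \<and>
      (\<Sum>n\<in>II - {l, m}. d n *\<^sub>R bgrad n) \<bullet> \<gamma> l m 1 = T l m 1 - 4 * (herm_edge_grad a l m \<bullet> \<gamma> l m 1))"
  define d where "d = (\<lambda>l m. SOME e. P l m e)"
  have "P l m (d l m)" if "l < m" "m \<le> 3" for l m
  proof -
    have "\<exists>e. P l m e"
      unfolding P_def by (rule edge_interpolation[OF that])
    then show ?thesis
      unfolding d_def by (rule someI_ex)
  qed
  then have d: "(\<Sum>n\<in>II - {l, m}. d l m n *\<^sub>R bgrad n) \<bullet> \<gamma> l m 0 = T l m 0 - 4 * (herm_edge_grad a l m \<bullet> \<gamma> l m 0)"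
      "(\<Sum>n\<in>II - {l, m}. d l m n *\<^sub>R bgrad n) \<bullet> \<gamma> l m 1 = T l m 1 - 4 * (herm_edge_grad a l m \<bullet> \<gamma> l m 1)"
    if "l < m" "m \<le> 3" for l m
    using that unfolding P_def by blast+
  define c where "c = (\<lambda>(l, m, n). d l m n)"
  have edge: "4 * (Ze_fun_grad a c (midpoint (v l) (v m)) \<bullet> \<gamma> l m j) = T l m j"
    if "l < m" "m \<le> 3" "j \<in> {0, 1}" for l m j
  proof -
    have "4 * (Ze_fun_grad a c (midpoint (v l) (v m)) \<bullet> u) =
        4 * (herm_edge_grad a l m \<bullet> u) + (\<Sum>n\<in>II - {l, m}. d l m n *\<^sub>R bgrad n) \<bullet> u" for u
      unfolding Ze_fun_grad_at_midpoint[OF that(1,2)] by (simp add: c_def inner_add_left)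
    then show ?thesis
      using d[OF that(1,2)] that(3) by (elim insertE emptyE) simp_all
  qed
  define \<beta> where "\<beta> = (\<lambda>i. 18 * (F i - Ze_fun_facet a c i))"
  show ?thesis
  proof (intro bexI[of _ "cub_fun a c \<beta>"] conjI ballI allI impI)
    show "bd_value v (cub_fun a c \<beta>) (v k) = r k" "bd_grad v (cub_fun a c \<beta>) (v k) = G k" if "k \<in> II" for k
      using that by (simp_all add: bd_cub_fun vertex_in_skeleton vert)
    show "4 * (bd_grad v (cub_fun a c \<beta>) (midpoint (v l) (v m)) \<bullet> \<gamma> l m j) = T l m j"
      if "l < m" "m \<le> 3" "j \<in> {0, 1}" for l m j
    proof -
      have "midpoint (v l) (v m) \<in> skeleton"
        using that by (intro midpoint_in_skeleton) (auto simp: mem_II_iff)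
      then show ?thesis
        using edge[OF that] by (simp add: bd_cub_fun)
    qed
    show "facet_functional v i (cub_fun a c \<beta>) = F i" if "i \<in> II" for i
      using that by (simp add: facet_functional_cub_fun \<beta>_def field_simps)
  qed (rule cub_fun_in_Z_cub)
qed

text \<open>
  The same triangular system with zero data, solved in the same order.
\<close>

lemma cub_fun_coefficients_zero:
  assumes dof0: "\<And>N. N \<in> set (dofs v \<gamma>) \<Longrightarrow> N (cub_fun a c \<beta>) = 0"
  shows "Ze_fun a c = 0" and "\<And>i. i \<in> II \<Longrightarrow> \<beta> i = 0"
proof -
  let ?z = "cub_fun a c \<beta>"
  have a: "a (k, j) = 0" if "k \<in> II" "j \<in> II" for k j
  proof -
    have "(\<lambda>z. bd_value v z (v k)) \<in> set (dofs v \<gamma>)"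
      using that unfolding set_dofs by blast
    from dof0[OF this] have akk: "a (k, k) = 0"
      using that by (simp add: bd_cub_fun vertex_in_skeleton Ze_fun_at_vertex)
    have "bd_grad v ?z (v k) $ r = 0" for r
    proof -
      have "(\<lambda>(k, r) z. bd_grad v z (v k) $ r) (k, r) \<in> set (dofs v \<gamma>)"
        using that unfolding set_dofs by blast
      from dof0[OF this] show ?thesis by simp
    qed
    then have "bd_grad v ?z (v k) = 0" by (simp add: vec_eq_iff)
    then have "(\<Sum>i\<in>II. ((if i = k then 2 else 1) * a (k, i)) *\<^sub>R bgrad i) \<bullet> (v j - v k) = 0"
      using that by (simp add: bd_cub_fun vertex_in_skeleton Ze_fun_at_vertex)
    also have "(\<Sum>i\<in>II. ((if i = k then 2 else 1) * a (k, i)) *\<^sub>R bgrad i) \<bullet> (v j - v k) = (\<Sum>i\<in>II. if i = j then a (k, j) else 0)"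
      unfolding inner_sum_left using that akk
      by (intro sum.cong refl) (auto simp: bgrad_diff bary_vertex)
    finally show ?thesis using that by simp
  qed
  have c: "c (l, m, n) = 0" if t: "(l, m, n) \<in> bubble_index" for l m n
  proof -
    have lm: "l < m" "m \<le> 3" "n \<in> II - {l, m}" using t by (auto simp: bubble_index_def)
    have sk: "midpoint (v l) (v m) \<in> skeleton"
      using lm by (intro midpoint_in_skeleton) (auto simp: mem_II_iff)
    have "(\<Sum>n\<in>II - {l, m}. c (l, m, n) *\<^sub>R bgrad n) \<bullet> \<gamma> l m j = 0" if "j \<in> {0, 1}" for j
    proof -
      have "(\<lambda>(l, m, j) z. 4 * (bd_grad v z (midpoint (v l) (v m)) \<bullet> \<gamma> l m j)) (l, m, j) \<in> set (dofs v \<gamma>)"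
        using lm that unfolding set_dofs by blast
      from dof0[OF this] have "bd_grad v ?z (midpoint (v l) (v m)) \<bullet> \<gamma> l m j = 0" by simp
      moreover have "herm_edge_grad a l m = 0"
        using a by (intro herm_edge_grad_zero) auto
      ultimately show ?thesis
        by (simp add: bd_cub_fun(2)[OF sk] Ze_fun_grad_at_midpoint[OF lm(1,2)])
    qed
    then show ?thesis
      using edge_unisolvent[OF lm, of "\<lambda>n. c (l, m, n)"] by simp
  qed
  have z: "\<And>s. s \<in> II \<times> II \<Longrightarrow> a s = 0" "\<And>t. t \<in> bubble_index \<Longrightarrow> c t = 0"
    using a c by auto
  show "Ze_fun a c = 0"
    using z by (rule Ze_fun_zero(1))
  show "\<beta> i = 0" if i: "i \<in> II" for i
  proof -
    have "facet_functional v i \<in> set (dofs v \<gamma>)"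
      using i unfolding set_dofs by blast
    from dof0[OF this] have "Ze_fun_facet a c i + \<beta> i / 18 = 0"
      unfolding facet_functional_cub_fun[OF i] .
    moreover have "Ze_fun_facet a c i = 0"
      using z by (rule Ze_fun_zero(2))
    ultimately show ?thesis by simp
  qed
qed

lemma subspace_Z_sing: "subspace (Z_sing v)"
  unfolding Z_sing_def by (rule subspace_image_linear_on(1)[OF subspace_Ze]) (rule R_op_linear)

lemma subspace_Z_cub: "subspace (Z_cub v)"
  unfolding Z_cub_def B_cub_def by (intro subspace_set_plus subspace_Z_sing subspace_span)

lemma bd_linear:
  assumes "y \<in> Z_cub v" "z \<in> Z_cub v"
  shows "p \<in> tet v - tet_int v \<Longrightarrow> bd_value v (y + z) p = bd_value v y p + bd_value v z p"
    and "p \<in> tet v - tet_int v \<Longrightarrow> bd_value v (c *\<^sub>R z) p = c * bd_value v z p"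
    and "p \<in> skeleton \<Longrightarrow> bd_grad v (y + z) p = bd_grad v y p + bd_grad v z p"
    and "p \<in> skeleton \<Longrightarrow> bd_grad v (c *\<^sub>R z) p = c *\<^sub>R bd_grad v z p"
proof -
  obtain V H where y: "boundary_data skeleton y V H" using Z_cub_data[OF assms(1)] by blast
  obtain V' H' where z: "boundary_data skeleton z V' H'" using Z_cub_data[OF assms(2)] by blast
  note add = boundary_data_add[OF y z] and scale = boundary_data_scaleR[OF z, of c]
  show "bd_value v (y + z) p = bd_value v y p + bd_value v z p" "bd_value v (c *\<^sub>R z) p = c * bd_value v z p"
    if "p \<in> tet v - tet_int v"
    using bd_value_eqI[OF add that] bd_value_eqI[OF scale that] bd_value_eqI[OF y that] bd_value_eqI[OF z that] by simp_all
  show "bd_grad v (y + z) p = bd_grad v y p + bd_grad v z p" "bd_grad v (c *\<^sub>R z) p = c *\<^sub>R bd_grad v z p"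
    if p: "p \<in> skeleton"
  proof -
    have p': "p \<in> tet v" using p by (simp add: skeleton_def)
    show "bd_grad v (y + z) p = bd_grad v y p + bd_grad v z p" "bd_grad v (c *\<^sub>R z) p = c *\<^sub>R bd_grad v z p"
      using bd_grad_eqI[OF add p p'] bd_grad_eqI[OF scale p p'] bd_grad_eqI[OF y p p'] bd_grad_eqI[OF z p p'] by simp_all
  qed
qed

lemma dofs_linear:
  assumes "N \<in> set (dofs v \<gamma>)"
  shows "linear_functional_on (Z_cub v) N"
proof -
  have vert: "v k \<in> skeleton" "v k \<in> tet v - tet_int v" if "k \<in> II" for k
    using vertex_in_skeleton[OF that] skeleton_subset by auto
  have mid: "midpoint (v l) (v m) \<in> skeleton" if "l < m" "m \<le> 3" for l m
    using that by (intro midpoint_in_skeleton) (auto simp: mem_II_iff)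
  from assms consider k where "k \<in> II" "N = (\<lambda>z. bd_value v z (v k))"
    | k r where "k \<in> II" "N = (\<lambda>z. bd_grad v z (v k) $ r)"
    | l m j where "l < m" "m \<le> 3" "N = (\<lambda>z. 4 * (bd_grad v z (midpoint (v l) (v m)) \<bullet> \<gamma> l m j))"
    | i where "i \<in> II" "N = facet_functional v i"
    unfolding set_dofs by auto
  then show ?thesis
  proof cases
    case 1
    then show ?thesis
      using vert by (simp add: linear_functional_on_def bd_linear)
  next
    case 2
    then show ?thesis
      using vert by (simp add: linear_functional_on_def bd_linear)
  next
    case 3
    then show ?thesis
      using mid by (simp add: linear_functional_on_def bd_linear inner_add_left distrib_left)
  next
    case 4
    have J: "v j \<in> skeleton" "v j \<in> tet v - tet_int v" if "j \<in> JJ i" for j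
      using that vert by (simp_all add: JJ_def)
    have m: "mid_face v i \<in> tet v - tet_int v" using 4 by (intro mid_face_in_boundary)
    show ?thesis
      unfolding linear_functional_on_def 4(2)
    proof (intro conjI ballI allI)
      fix y z assume yz: "y \<in> Z_cub v" "z \<in> Z_cub v"
      have s: "(\<Sum>j\<in>JJ i. bd_value v (y + z) (v j)) = (\<Sum>j\<in>JJ i. bd_value v y (v j)) + (\<Sum>j\<in>JJ i. bd_value v z (v j))"
        "(\<Sum>j\<in>JJ i. bd_grad v (y + z) (v j) \<bullet> (v j - mid_face v i)) =
         (\<Sum>j\<in>JJ i. bd_grad v y (v j) \<bullet> (v j - mid_face v i)) + (\<Sum>j\<in>JJ i. bd_grad v z (v j) \<bullet> (v j - mid_face v i))"
        unfolding sum.distrib[symmetric]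
        by (intro sum.cong refl; simp only: bd_linear(1)[OF yz J(2)] bd_linear(3)[OF yz J(1)] inner_add_left)+
      show "facet_functional v i (y + z) = facet_functional v i y + facet_functional v i z"
        unfolding facet_functional_def s bd_linear(1)[OF yz m] by (simp add: algebra_simps)
    next
      fix c z assume z: "z \<in> Z_cub v"
      have s: "(\<Sum>j\<in>JJ i. bd_value v (c *\<^sub>R z) (v j)) = c * (\<Sum>j\<in>JJ i. bd_value v z (v j))"
        "(\<Sum>j\<in>JJ i. bd_grad v (c *\<^sub>R z) (v j) \<bullet> (v j - mid_face v i)) =
         c * (\<Sum>j\<in>JJ i. bd_grad v z (v j) \<bullet> (v j - mid_face v i))"
        unfolding sum_distrib_left
        by (intro sum.cong refl; simp only: bd_linear(2)[OF z z J(2)] bd_linear(4)[OF z z J(1)] inner_scaleR_left)+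
      show "facet_functional v i (c *\<^sub>R z) = c * facet_functional v i z"
        unfolding facet_functional_def s bd_linear(2)[OF z z m] by (simp add: algebra_simps)
    qed
  qed
qed

lemma dofs_zero_imp_zero:
  assumes "z \<in> Z_cub v" "\<And>N. N \<in> set (dofs v \<gamma>) \<Longrightarrow> N z = 0"
  shows "z = 0"
proof -
  obtain a c \<beta> where z: "z = cub_fun a c \<beta>" using assms(1) by (rule Z_cub_expansion)
  have "Ze_fun a c = 0" "\<And>i. i \<in> II \<Longrightarrow> \<beta> i = 0"
    using cub_fun_coefficients_zero[of a c \<beta>] assms(2) unfolding z by blast+
  then show ?thesis
    unfolding z cub_fun_def by (simp add: R_op_zero)
qed

lemma dofs_at_zero: "N \<in> set (dofs v \<gamma>) \<Longrightarrow> N 0 = 0"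
  using linear_functional_on_sum[OF dofs_linear subspace_Z_cub, of N "{}"] by simp

lemma dofs_inj: "inj_on (\<lambda>z. map (\<lambda>N. N z) (dofs v \<gamma>)) (Z_cub v)"
proof (rule inj_onI)
  fix y z assume yz: "y \<in> Z_cub v" "z \<in> Z_cub v"
    and "map (\<lambda>N. N y) (dofs v \<gamma>) = map (\<lambda>N. N z) (dofs v \<gamma>)"
  then have eq: "N y = N z" if "N \<in> set (dofs v \<gamma>)" for N
    using that by simp
  have mz: "(- 1) *\<^sub>R z \<in> Z_cub v"
    by (intro subspace_scale[OF subspace_Z_cub] yz)
  have "y + (- 1) *\<^sub>R z = 0"
  proof (rule dofs_zero_imp_zero)
    show "y + (- 1) *\<^sub>R z \<in> Z_cub v"
      by (intro subspace_add[OF subspace_Z_cub] yz mz)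
    fix N assume N: "N \<in> set (dofs v \<gamma>)"
    have "N (y + (- 1) *\<^sub>R z) = N y + N ((- 1) *\<^sub>R z)" "N ((- 1) *\<^sub>R z) = (- 1) * N z"
      using dofs_linear[OF N] yz mz unfolding linear_functional_on_def by blast+
    then show "N (y + (- 1) *\<^sub>R z) = 0"
      using eq[OF N] by simp
  qed
  then show "y = z" by simp
qed

lemma dofs_surj:
  fixes x :: "real list"
  assumes "length x = 32"
  shows "\<exists>z\<in>Z_cub v. map (\<lambda>N. N z) (dofs v \<gamma>) = x"
proof -
  define G :: "nat \<Rightarrow> real ^ 3" where "G = (\<lambda>k. vector [x ! (4 + 3 * k), x ! (5 + 3 * k), x ! (6 + 3 * k)])"
  \<comment> \<open>In the lexicographic order of the edges (0, 1), ..., (2, 3), the edge (l, m) has the position m - 1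
    if l = 0, and l + m otherwise. Each edge has two entries, and 16 entries precede them.\<close>
  define T where "T = (\<lambda>l m j. x ! (16 + 2 * (if l = 0 then m - 1 else l + m) + j))"
  obtain z where z: "z \<in> Z_cub v" and data: "(\<forall>k\<in>II. bd_value v z (v k) = x ! k) \<and> (\<forall>k\<in>II. bd_grad v z (v k) = G k) \<and>
    (\<forall>l m j. l < m \<longrightarrow> m \<le> 3 \<longrightarrow> j \<in> {0, 1} \<longrightarrow> 4 * (bd_grad v z (midpoint (v l) (v m)) \<bullet> \<gamma> l m j) = T l m j) \<and>
    (\<forall>i\<in>II. facet_functional v i z = x ! (28 + i))"
    using interpolation[of "\<lambda>k. x ! k" G T "\<lambda>i. x ! (28 + i)"] by (rule bexE)
  have val: "bd_value v z (v k) = x ! k" and gr: "bd_grad v z (v k) = G k" if "k \<in> II" for k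
    using data that by simp_all
  have ed: "4 * (bd_grad v z (midpoint (v l) (v m)) \<bullet> \<gamma> l m j) = T l m j" if "l < m" "m \<le> 3" "j \<in> {0, 1}" for l m j
    using data that by blast
  have fa: "facet_functional v i z = x ! (28 + i)" if "i \<in> II" for i
    using data that by simp
  have mem: "0 \<in> II" "1 \<in> II" "2 \<in> II" "3 \<in> II" by (simp_all add: II_def)
  have upt: "[0..<32] = [0, 1, 2, 3, 4, 5, 6, 7, 8, 9, 10, 11, 12, 13, 14, 15, 16, 17, 18, 19, 20, 21, 22, 23, 24,
      25, 26, 27, 28, 29, 30, 31]"
    by (simp add: upt_conv_Cons)
  have grads: "bd_grad v z (v 0) $ 1 = x ! 4" "bd_grad v z (v 0) $ 2 = x ! 5" "bd_grad v z (v 0) $ 3 = x ! 6"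
      "bd_grad v z (v 1) $ 1 = x ! 7" "bd_grad v z (v 1) $ 2 = x ! 8" "bd_grad v z (v 1) $ 3 = x ! 9"
      "bd_grad v z (v 2) $ 1 = x ! 10" "bd_grad v z (v 2) $ 2 = x ! 11" "bd_grad v z (v 2) $ 3 = x ! 12"
      "bd_grad v z (v 3) $ 1 = x ! 13" "bd_grad v z (v 3) $ 2 = x ! 14" "bd_grad v z (v 3) $ 3 = x ! 15"
    using gr[OF mem(1)] gr[OF mem(2)] gr[OF mem(3)] gr[OF mem(4)] by (simp_all add: G_def vector_3)
  have edges: "4 * (bd_grad v z (midpoint (v 0) (v 1)) \<bullet> \<gamma> 0 1 0) = x ! 16" "4 * (bd_grad v z (midpoint (v 0) (v 1)) \<bullet> \<gamma> 0 1 1) = x ! 17"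
      "4 * (bd_grad v z (midpoint (v 0) (v 2)) \<bullet> \<gamma> 0 2 0) = x ! 18" "4 * (bd_grad v z (midpoint (v 0) (v 2)) \<bullet> \<gamma> 0 2 1) = x ! 19"
      "4 * (bd_grad v z (midpoint (v 0) (v 3)) \<bullet> \<gamma> 0 3 0) = x ! 20" "4 * (bd_grad v z (midpoint (v 0) (v 3)) \<bullet> \<gamma> 0 3 1) = x ! 21"
      "4 * (bd_grad v z (midpoint (v 1) (v 2)) \<bullet> \<gamma> 1 2 0) = x ! 22" "4 * (bd_grad v z (midpoint (v 1) (v 2)) \<bullet> \<gamma> 1 2 1) = x ! 23"
      "4 * (bd_grad v z (midpoint (v 1) (v 3)) \<bullet> \<gamma> 1 3 0) = x ! 24" "4 * (bd_grad v z (midpoint (v 1) (v 3)) \<bullet> \<gamma> 1 3 1) = x ! 25"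
      "4 * (bd_grad v z (midpoint (v 2) (v 3)) \<bullet> \<gamma> 2 3 0) = x ! 26" "4 * (bd_grad v z (midpoint (v 2) (v 3)) \<bullet> \<gamma> 2 3 1) = x ! 27"
    using ed[of 0 1 0] ed[of 0 1 1] ed[of 0 2 0] ed[of 0 2 1] ed[of 0 3 0] ed[of 0 3 1] ed[of 1 2 0] ed[of 1 2 1] ed[of 1 3 0] ed[of 1 3 1] ed[of 2 3 0] ed[of 2 3 1]
    by (simp_all add: T_def)
  have facets: "facet_functional v 0 z = x ! 28" "facet_functional v 1 z = x ! 29" "facet_functional v 2 z = x ! 30" "facet_functional v 3 z = x ! 31"
    using fa[OF mem(1)] fa[OF mem(2)] fa[OF mem(3)] fa[OF mem(4)] by simp_all
  have "map (\<lambda>N. N z) (dofs v \<gamma>) = map ((!) x) [0, 1, 2, 3, 4, 5, 6, 7, 8, 9, 10, 11, 12, 13, 14, 15, 16, 17, 18, 19, 20, 21, 22, 23, 24,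
      25, 26, 27, 28, 29, 30, 31]"
    unfolding dofs_unfold append.simps list.map val[OF mem(1)] val[OF mem(2)] val[OF mem(3)] val[OF mem(4)]
      grads edges facets ..
  also have "\<dots> = map ((!) x) [0..<length x]"
    unfolding assms upt ..
  also have "\<dots> = x"
    by (rule map_nth)
  finally show ?thesis using z by blast
qed

lemma unisolvent_Z_cub: "unisolvent (dofs v \<gamma>) (Z_cub v)"
proof -
  have "(\<lambda>z. map (\<lambda>N. N z) (dofs v \<gamma>)) ` Z_cub v = {c. length c = length (dofs v \<gamma>)}"
  proof (intro equalityI subsetI)
    fix x assume "x \<in> (\<lambda>z. map (\<lambda>N. N z) (dofs v \<gamma>)) ` Z_cub v"
    then obtain z where "x = map (\<lambda>N. N z) (dofs v \<gamma>)" by blast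
    then show "x \<in> {c. length c = length (dofs v \<gamma>)}"
      unfolding mem_Collect_eq by (simp only: length_map)
  next
    fix x :: "real list"
    assume "x \<in> {c. length c = length (dofs v \<gamma>)}"
    then have "length x = 32"
      unfolding mem_Collect_eq length_dofs .
    then obtain z where "z \<in> Z_cub v" "map (\<lambda>N. N z) (dofs v \<gamma>) = x"
      using dofs_surj by blast
    then show "x \<in> (\<lambda>z. map (\<lambda>N. N z) (dofs v \<gamma>)) ` Z_cub v" by blast
  qed
  then show ?thesis
    unfolding unisolvent_def bij_betw_def using subspace_Z_cub dofs_linear dofs_inj by blast
qed

text \<open>
  If R u = R w plus a combination of corrected bubbles, then R (w - u) plus that combination is 0, and
  so are all its degrees of freedom.
\<close>

lemma Z_sing_cor_bubbles_independent:
  assumes "y \<in> Z_sing v" "y = R_op v w + (\<Sum>i\<in>II. \<beta> i *\<^sub>R cor_bubble v i)" "w \<in> Ze v"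
    and i: "i \<in> II"
  shows "\<beta> i = 0"
proof -
  obtain u where u: "u \<in> Ze v" "y = R_op v u"
    using assms(1) by (auto simp: Z_sing_def)
  have "(- 1) *\<^sub>R u + w \<in> Ze v"
    using u assms(3) by (intro subspace_add[OF subspace_Ze] subspace_scale[OF subspace_Ze])
  then obtain a c where ac: "(- 1) *\<^sub>R u + w = Ze_fun a c"
    unfolding Ze_fun_def by (rule Ze_expansion)
  have "cub_fun a c \<beta> = 0"
    unfolding cub_fun_def ac[symmetric] R_op_linear[OF u(1) assms(3)] using assms(2) u(2) by simp
  then have "N (cub_fun a c \<beta>) = 0" if "N \<in> set (dofs v \<gamma>)" for N
    using dofs_at_zero[OF that] by simp
  then show ?thesis
    using i by (rule cub_fun_coefficients_zero(2))
qed

lemma Z_sing_Int_B_cub: "Z_sing v \<inter> B_cub v = {0}"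
proof (intro equalityI subsetI)
  fix y assume y: "y \<in> Z_sing v \<inter> B_cub v"
  obtain \<beta> where \<beta>: "y = (\<Sum>i\<in>II. \<beta> i *\<^sub>R face_bubble v i)"
    using span_image_sum[OF finite_II] y unfolding B_cub_def by blast
  have "R_op v (0 + (\<Sum>i\<in>II. \<beta> i *\<^sub>R face_bubble_sum i)) + (\<Sum>i\<in>II. \<beta> i *\<^sub>R cor_bubble v i) = R_op v 0 + y"
    unfolding \<beta> by (rule R_op_add_face_bubble_sums[OF subspace_0[OF subspace_Ze]])
  then have eq: "y = R_op v (\<Sum>i\<in>II. \<beta> i *\<^sub>R face_bubble_sum i) + (\<Sum>i\<in>II. \<beta> i *\<^sub>R cor_bubble v i)"
    unfolding R_op_zero add_0 ..
  have "y \<in> Z_sing v" using y by blast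
  then have "\<beta> i = 0" if "i \<in> II" for i
    using eq face_bubble_sum_combination_in_Ze that by (rule Z_sing_cor_bubbles_independent)
  then show "y \<in> {0}" by (simp add: \<beta>)
next
  show "y \<in> Z_sing v \<inter> B_cub v" if "y \<in> {0}" for y
    using that subspace_0[OF subspace_Z_sing] by (simp add: B_cub_def span_zero)
qed

lemma Z_sing_Int_B_cub_cor: "Z_sing v \<inter> B_cub_cor v = {0}"
proof (intro equalityI subsetI)
  fix y assume y: "y \<in> Z_sing v \<inter> B_cub_cor v"
  obtain \<beta> where \<beta>: "y = (\<Sum>i\<in>II. \<beta> i *\<^sub>R cor_bubble v i)"
    using span_image_sum[OF finite_II] y unfolding B_cub_cor_def by blast
  then have eq: "y = R_op v 0 + (\<Sum>i\<in>II. \<beta> i *\<^sub>R cor_bubble v i)"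
    unfolding R_op_zero add_0 .
  have "y \<in> Z_sing v" using y by blast
  then have "\<beta> i = 0" if "i \<in> II" for i
    using eq subspace_0[OF subspace_Ze] that by (rule Z_sing_cor_bubbles_independent)
  then show "y \<in> {0}" by (simp add: \<beta>)
next
  show "y \<in> Z_sing v \<inter> B_cub_cor v" if "y \<in> {0}" for y
    using that subspace_0[OF subspace_Z_sing] by (simp add: B_cub_cor_def span_zero)
qed

end

theorem lemma3p16:
  fixes v :: "nat \<Rightarrow> real ^ 3" and \<gamma> :: "nat \<Rightarrow> nat \<Rightarrow> nat \<Rightarrow> real ^ 3"
  assumes "nondegenerate v"
    and "\<And>l m. l < m \<Longrightarrow> m \<le> 3 \<Longrightarrow> \<gamma> l m 0 \<in> edge_perp v l m \<and> \<gamma> l m 1 \<in> edge_perp v l m"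
    and "\<And>l m. l < m \<Longrightarrow> m \<le> 3 \<Longrightarrow> \<gamma> l m 0 \<noteq> \<gamma> l m 1 \<and> independent {\<gamma> l m 0, \<gamma> l m 1}"
  shows "length (dofs v \<gamma>) = 32 \<and> unisolvent (dofs v \<gamma>) (Z_cub v) \<and>
    Z_sing v \<inter> B_cub v = {0} \<and> Z_sing v \<inter> B_cub_cor v = {0} \<and>
    dim (Z_cub v) = 32"
proof -
  interpret framed_tetrahedron v \<gamma>
    using assms by unfold_locales
  show ?thesis
    using length_dofs[of v \<gamma>] unisolvent_Z_cub Z_sing_Int_B_cub Z_sing_Int_B_cub_cor
      unisolvent_dim[OF unisolvent_Z_cub, unfolded length_dofs] by (intro conjI)
qed

end
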